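(* Let $\tau$ be the Prouhet-Thue-Morse substitution over $\{a,b\}$, given by $\tau(a)=ab$ and $\tau(b)=ba$. Then the Schützenberger group $G(\tau)$ admits, as a profinite group, the presentation $$\langle x,y,z\mid \Psi^\omega(x)=x,\ \Psi^\omega(y)=y,\ \Psi^\omega(z)=z\rangle_{\mathsf G},$$ where $\Psi$ is the unique continuous endomorphism of the free profinite group $\overline\Omega_{\{x,y,z\}}\mathsf G$ such that $\Psi(x)=zxy$, $\Psi(y)=zyx^{-1}zxy$, and $\Psi(z)=zxyx^{-1}zy$.
   Context: $\overline\Omega_Y\mathsf G$ is the free profinite group on the finite set $Y$; its continuous endomorphisms form a profinite monoid under pointwise convergence, in which $\Psi^\omega=\lim_n\Psi^{n!}$ is the idempotent power of $\Psi$. $\langle Y\mid R\rangle_{\mathsf G}$ denotes the quotient of $\overline\Omega_Y\mathsf G$ by the closed congruence generated by $R$; a profinite group admits the presentation if it is isomorphic (as a topological group) to this quotient. $\overline\Omega_A\mathsf S$ is the free profinite semigroup on the finite set $A$; the subsemigroup generated by $A$ is identified with the free semigroup $A^+$. A substitution over $A$ is an endomorphism $\varphi$ of $A^+$; it is primitive if there is $n\ge1$ such that every letter $c$ occurs in $\varphi^n(d)$ for all $c,d\in A$, and $\lim_n|\varphi^n(d)|=\infty$. A primitive $\varphi$ (such as $\tau$) defines a minimal subshift $\mathcal X_\varphi\subseteq A^{\mathbb Z}$ whose language $L(\mathcal X_\varphi)$ of finite blocks consists of the words that are factors of $\varphi^k(c)$ for all $c\in A$ and all sufficiently large $k$. The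 closure of $L(\mathcal X_\varphi)$ in $\overline\Omega_A\mathsf S$ is the disjoint union of $L(\mathcal X_\varphi)$ and a regular $\mathcal J$-class $J(\varphi)$. The Schützenberger group $G(\varphi)$ is the profinite group isomorphic to the maximal subgroups of $J(\varphi)$ (which are all isomorphic). *)

theory Defs
  imports "HOL-Analysis.Analysis" "HOL-Algebra.Group" "HOL-Library.Sublist"
begin

section \<open>Semigroups, congruences, quotients\<close>

text \<open>A semigroup is given by a carrier and a multiplication. Such a semigroup is a group
  iff it becomes one once equipped with its (necessarily unique) neutral element.\<close>

definition as_group :: "'c set \<Rightarrow> ('c \<Rightarrow> 'c \<Rightarrow> 'c) \<Rightarrow> 'c monoid" where
  "as_group X m =
     \<lparr>carrier = X, mult = m, one = (THE e. e \<in> X \<and> (\<forall>u\<in>X. m e u = u \<and> m u e = u))\<rparr>"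

definition is_group :: "'c set \<Rightarrow> ('c \<Rightarrow> 'c \<Rightarrow> 'c) \<Rightarrow> bool" where
  "is_group X m \<longleftrightarrow> group (as_group X m)"

definition congruence :: "'c set \<Rightarrow> ('c \<Rightarrow> 'c \<Rightarrow> 'c) \<Rightarrow> ('c \<times> 'c) set \<Rightarrow> bool" where
  "congruence X m r \<longleftrightarrow>
     equiv X r \<and> (\<forall>(u, v) \<in> r. \<forall>(u', v') \<in> r. (m u u', m v v') \<in> r)"

definition quot_mult :: "('c \<Rightarrow> 'c \<Rightarrow> 'c) \<Rightarrow> ('c \<times> 'c) set \<Rightarrow> 'c set \<Rightarrow> 'c set \<Rightarrow> 'c set" where
  "quot_mult m r U V = r `` {m u v | u v. u \<in> U \<and> v \<in> V}"

definition quot_top :: "'c topology \<Rightarrow> ('c \<times> 'c) set \<Rightarrow> 'c set topology" where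
  "quot_top T r = topology (\<lambda>W. W \<subseteq> topspace T // r \<and> openin T (\<Union>W))"

lemma openin_quot_top:
  assumes "equiv (topspace T) r"
  shows "openin (quot_top T r) W \<longleftrightarrow> W \<subseteq> topspace T // r \<and> openin T (\<Union>W)"
proof -
  have int: "\<Union>(S \<inter> S') = \<Union>S \<inter> \<Union>S'"
    if "S \<subseteq> topspace T // r" "S' \<subseteq> topspace T // r" for S S'
    using that quotient_disj[OF assms] by blast
  have "istopology (\<lambda>W. W \<subseteq> topspace T // r \<and> openin T (\<Union>W))"
    unfolding istopology_def
  proof (intro conjI allI impI)
    fix K assume K: "\<forall>S\<in>K. S \<subseteq> topspace T // r \<and> openin T (\<Union>S)"
    then show "\<Union>K \<subseteq> topspace T // r" by blast
    have "\<Union>(\<Union>K) = \<Union>(Union ` K)" by blast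
    with K show "openin T (\<Union>(\<Union>K))" by (metis (mono_tags, lifting) imageE openin_Union)
  qed (auto simp: int)
  then show ?thesis
    by (simp add: quot_top_def)
qed

section \<open>Relatively free profinite semigroups and groups\<close>

text \<open>For a pseudovariety \<open>V\<close> of finite semigroups (given as a predicate on finite semigroups)
  and a finite alphabet \<open>'a\<close>, the profinite semigroup \<open>Omega V\<close> is the projective limit
  of the \<open>'a\<close>-generated members of \<open>V\<close>, that is, of the quotients of \<open>'a\<^sup>+\<close>
  by the finite-index congruences whose quotient is in \<open>V\<close>. The free profinite semigroup and the
  free profinite group are the cases where \<open>V\<close> consists of all finite semigroups, respectively
  of all finite groups; note that a finite group generated by \<open>'a\<close> as a group is also
  generated by \<open>'a\<close> as a semigroup.\<close>

type_synonym 'a pseudovariety = "'a list set set \<Rightarrow> ('a list set \<Rightarrow> 'a list set \<Rightarrow> 'a list set) \<Rightarrow> bool"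
type_synonym 'a pro = "('a list \<times> 'a list) set \<Rightarrow> 'a list set"

definition all_semigroups :: "'a::finite pseudovariety" where
  "all_semigroups X m \<longleftrightarrow> True"

definition all_groups :: "'a::finite pseudovariety" where
  "all_groups X m \<longleftrightarrow> is_group X m"

definition free_semigroup :: "'a::finite list set" where
  "free_semigroup = {w. w \<noteq> []}"

definition congs :: "'a::finite pseudovariety \<Rightarrow> ('a list \<times> 'a list) set set" where
  "congs V = {r. congruence free_semigroup (@) r \<and> finite (free_semigroup // r)
                 \<and> V (free_semigroup // r) (quot_mult (@) r)}"

definition Omega :: "'a::finite pseudovariety \<Rightarrow> 'a pro set" where
  "Omega V = {f \<in> (\<Pi>\<^sub>E r\<in>congs V. free_semigroup // r).
                \<forall>r\<in>congs V. \<forall>s\<in>congs V. r \<subseteq> s \<longrightarrow> f r \<subseteq> f s}"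

definition Omega_mult :: "'a::finite pseudovariety \<Rightarrow> 'a pro \<Rightarrow> 'a pro \<Rightarrow> 'a pro" where
  "Omega_mult V f g = (\<lambda>r\<in>congs V. quot_mult (@) r (f r) (g r))"

definition Omega_top :: "'a::finite pseudovariety \<Rightarrow> 'a pro topology" where
  "Omega_top V =
     subtopology (product_topology (\<lambda>r. discrete_topology (free_semigroup // r)) (congs V)) (Omega V)"

text \<open>The canonical image of a nonempty word in \<open>Omega V\<close>.\<close>

definition of_word :: "'a::finite pseudovariety \<Rightarrow> 'a list \<Rightarrow> 'a pro" where
  "of_word V w = (\<lambda>r\<in>congs V. r `` {w})"

section \<open>Profinite group presentations\<close>

definition free_pg :: "'a::finite pro monoid" where
  "free_pg = as_group (Omega all_groups) (Omega_mult all_groups)"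

abbreviation free_pg_top :: "'a::finite pro topology" where
  "free_pg_top \<equiv> Omega_top all_groups"

definition pg_gen :: "'a::finite \<Rightarrow> 'a pro" where
  "pg_gen c = of_word all_groups [c]"

definition closed_congruence_generated ::
    "('c, 'd) monoid_scheme \<Rightarrow> 'c topology \<Rightarrow> ('c \<times> 'c) set \<Rightarrow> ('c \<times> 'c) set" where
  "closed_congruence_generated G T R =
     \<Inter>{r. congruence (carrier G) (mult G) r \<and> closedin (prod_topology T T) r \<and> R \<subseteq> r}"

definition presented_pg :: "('a::finite pro \<times> 'a pro) set \<Rightarrow> 'a pro set monoid" where
  "presented_pg R =
     (let r = closed_congruence_generated free_pg free_pg_top R
      in as_group (carrier free_pg // r) (quot_mult (mult free_pg) r))"

definition presented_pg_top :: "('a::finite pro \<times> 'a pro) set \<Rightarrow> 'a pro set topology" where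
  "presented_pg_top R = quot_top free_pg_top (closed_congruence_generated free_pg free_pg_top R)"

definition admits_presentation ::
    "('g, 'd) monoid_scheme \<Rightarrow> 'g topology \<Rightarrow> ('a::finite pro \<times> 'a pro) set \<Rightarrow> bool" where
  "admits_presentation G T R \<longleftrightarrow>
     (\<exists>h. h \<in> iso (presented_pg R) G \<and> homeomorphic_map (presented_pg_top R) T h)"

section \<open>Continuous endomorphisms\<close>

definition cont_endos :: "('c, 'd) monoid_scheme \<Rightarrow> 'c topology \<Rightarrow> ('c \<Rightarrow> 'c) set" where
  "cont_endos G T = {f \<in> hom G G \<inter> extensional (carrier G). continuous_map T T f}"

text \<open>The topology of pointwise convergence.\<close>

definition cont_endos_top :: "('c, 'd) monoid_scheme \<Rightarrow> 'c topology \<Rightarrow> ('c \<Rightarrow> 'c) topology" where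
  "cont_endos_top G T = subtopology (product_topology (\<lambda>_. T) (carrier G)) (cont_endos G T)"

definition omega_power ::
    "('c, 'd) monoid_scheme \<Rightarrow> 'c topology \<Rightarrow> ('c \<Rightarrow> 'c) \<Rightarrow> 'c \<Rightarrow> 'c" where
  "omega_power G T f =
     (THE g. limitin (cont_endos_top G T) (\<lambda>n. restrict (f ^^ fact n) (carrier G)) g sequentially)"

section \<open>The Schuetzenberger group of a primitive substitution\<close>

abbreviation free_ps :: "'a::finite pro set" where
  "free_ps \<equiv> Omega all_semigroups"

abbreviation free_ps_mult :: "'a::finite pro \<Rightarrow> 'a pro \<Rightarrow> 'a pro" where
  "free_ps_mult \<equiv> Omega_mult all_semigroups"

abbreviation free_ps_top :: "'a::finite pro topology" where
  "free_ps_top \<equiv> Omega_top all_semigroups"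

text \<open>The language of the minimal subshift of a primitive substitution \<open>\<phi>\<close>, without the
  empty word, which is not an element of the free semigroup.\<close>

definition language :: "('a::finite list \<Rightarrow> 'a list) \<Rightarrow> 'a list set" where
  "language \<phi> = {w \<in> free_semigroup. \<exists>K. \<forall>k\<ge>K. \<forall>c. sublist w ((\<phi> ^^ k) [c])}"

text \<open>For primitive \<open>\<phi>\<close> the following set is a regular J-class of the free profinite semigroup.\<close>

definition J_class :: "('a::finite list \<Rightarrow> 'a list) \<Rightarrow> 'a pro set" where
  "J_class \<phi> = free_ps_top closure_of (of_word all_semigroups ` language \<phi>)
               - of_word all_semigroups ` language \<phi>"

definition maximal_subgroup :: "'c set \<Rightarrow> ('c \<Rightarrow> 'c \<Rightarrow> 'c) \<Rightarrow> 'c set \<Rightarrow> bool" where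
  "maximal_subgroup S m H \<longleftrightarrow>
     H \<subseteq> S \<and> is_group H m \<and> (\<forall>K. H \<subseteq> K \<and> K \<subseteq> S \<and> is_group K m \<longrightarrow> K = H)"

text \<open>The maximal subgroups in \<open>J_class \<phi>\<close>, whose common isomorphism type as topological groups
  is the Schuetzenberger group of \<open>\<phi>\<close>.\<close>

definition schuetzenberger_groups :: "('a::finite list \<Rightarrow> 'a list) \<Rightarrow> 'a pro set set" where
  "schuetzenberger_groups \<phi> =
     {H. H \<subseteq> J_class \<phi> \<and> maximal_subgroup free_ps free_ps_mult H}"

section \<open>The Prouhet-Thue-Morse substitution\<close>

datatype ab = La | Lb

instance ab :: finite
proof
  have "UNIV = {La, Lb}" using ab.exhaust by blast
  then show "finite (UNIV :: ab set)" by (metis finite.emptyI finite.insertI)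
qed

fun tau_letter :: "ab \<Rightarrow> ab list" where
  "tau_letter La = [La, Lb]"
| "tau_letter Lb = [Lb, La]"

definition tau :: "ab list \<Rightarrow> ab list" where
  "tau w = concat (map tau_letter w)"

datatype xyz = Gx | Gy | Gz

instance xyz :: finite
proof
  have "UNIV = {Gx, Gy, Gz}" using xyz.exhaust by blast
  then show "finite (UNIV :: xyz set)" by (metis finite.emptyI finite.insertI)
qed

end

theory Submission
  imports Defs
begin

text \<open>Write \<open>\<phi> = \<tau>\<^sup>2\<close> and let \<open>\<Phi> = \<phi>\<^sup>\<omega>\<close> be its idempotent power on the free profinite semigroup. The words that
  start with \<open>a\<close>, end with \<open>b\<close> and contain no cube of a letter form the free semigroup \<open>D\<close> on the return
  words \<open>ab\<close>, \<open>aab\<close>, \<open>abb\<close>, \<open>aabb\<close> of \<open>b.a\<close>. The image of every return word under \<open>\<phi>\<close> starts with \<open>abb\<close> and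
  ends with \<open>aab\<close>, which forces the image \<open>K\<close> of the closure of \<open>D\<close> under \<open>\<Phi>\<close> to be a group. By
  recognizability of \<open>\<tau>\<close>, \<open>K\<close> is a maximal subgroup of the J-class, and the others are conjugate to it.

  Put \<open>X = \<Phi>(ab)\<close>, \<open>Y = \<Phi>(aab)\<close>, \<open>Z = \<Phi>(abb)\<close>. In \<open>K\<close> one has \<open>\<Phi>(aabb) = Y X\<^sup>-\<^sup>1 Z\<close>, so \<open>x \<mapsto> X\<close>, \<open>y \<mapsto> Y\<close>, \<open>z \<mapsto> Z\<close>
  defines a map \<open>\<kappa>\<close> of the free profinite group onto \<open>K\<close>. In the other direction, weights on the letters of
  the words of \<open>D\<close> define a homomorphism \<open>Q\<close> from the closure of \<open>D\<close> to the free profinite group with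
  \<open>Q \<circ> \<phi> = \<Psi> \<circ> Q\<close>. Then \<open>\<kappa> \<circ> Q = \<Phi>\<close> and \<open>Q \<circ> \<kappa> = \<Psi>\<^sup>\<omega>\<close>, so that \<open>\<kappa>\<close> and the retraction \<open>\<Psi>\<^sup>\<omega>\<close> have the
  same kernel, and the kernel of a retraction is generated by its values on the generators.\<close>

section \<open>Semigroups and groups on a carrier set\<close>

text \<open>\<open>tau\<close> itself does not preserve \<open>returns\<close>, since
  \<open>tau_letter Lb\<close> ends in \<open>La\<close>; the images abba and baab of the letters
  under \<open>phi\<close> begin and end with the letter itself. \<open>Psi\<close> is the table of
  \<open>phi\<close> on return words: ab goes to abb.ab.aab, aab to abb.aabb.ab.aab, abb to
  abb.ab.aabb.aab, read with x, y, z and y x^-1 z for ab, aab, abb and aabb.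

  D contains words outside the language, such as ababab. This is what makes its closure a
  subsemigroup; membership in the closure of the language is recovered later, from divisibility in
  the group.

  The obstacle is that cutting, desubstituting and weighing concern words, while the elements in
  question are limits. Congruences are closed under intersection, so a single coordinate describes a
  basic neighbourhood. Each argument is carried out on words that represent the limits at a fine
  enough coordinate, and is transferred by uniform continuity or by compactness. Weights serve to
  define \<open>Q\<close> on words: the weight of a letter depends only on its predecessor, so at
  each finite quotient the weight of a word is a finite-state computation.\<close>

definition semigroup_on :: "'c set \<Rightarrow> ('c \<Rightarrow> 'c \<Rightarrow> 'c) \<Rightarrow> bool" where
  "semigroup_on X m \<longleftrightarrow> (\<forall>u\<in>X. \<forall>v\<in>X. m u v \<in> X)
     \<and> (\<forall>u\<in>X. \<forall>v\<in>X. \<forall>w\<in>X. m (m u v) w = m u (m v w))"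

lemma semigroup_onD:
  assumes "semigroup_on X m"
  shows "u \<in> X \<Longrightarrow> v \<in> X \<Longrightarrow> m u v \<in> X"
    and "u \<in> X \<Longrightarrow> v \<in> X \<Longrightarrow> w \<in> X \<Longrightarrow> m (m u v) w = m u (m v w)"
  using assms unfolding semigroup_on_def by blast+

lemma is_groupI_unit:
  assumes sg: "semigroup_on X m" and e: "e \<in> X" "\<And>u. u \<in> X \<Longrightarrow> m e u = u \<and> m u e = u"
    and inv: "\<And>u. u \<in> X \<Longrightarrow> \<exists>v\<in>X. m v u = e"
  shows "is_group X m"
proof -
  have the_one: "(THE e. e \<in> X \<and> (\<forall>u\<in>X. m e u = u \<and> m u e = u)) = e"
    using e by (intro the_equality) metis+
  show ?thesis
    unfolding is_group_def
    by (rule groupI) (use the_one e inv semigroup_onD[OF sg] in \<open>simp_all add: as_group_def\<close>)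
qed

text \<open>If \<open>m a e = a\<close> for a single \<open>a\<close>, then \<open>e\<close> is a
  right unit, because every \<open>u\<close> has the form \<open>m w a\<close>; symmetrically on the
  left, and the two one-sided units coincide.\<close>

lemma is_groupI:
  assumes sg: "semigroup_on X m" and ne: "X \<noteq> {}"
    and l: "\<And>u v. u \<in> X \<Longrightarrow> v \<in> X \<Longrightarrow> \<exists>w\<in>X. m u w = v"
    and r: "\<And>u v. u \<in> X \<Longrightarrow> v \<in> X \<Longrightarrow> \<exists>w\<in>X. m w u = v"
  shows "is_group X m"
proof -
  obtain a where a: "a \<in> X" using ne by blast
  obtain e where e: "e \<in> X" "m a e = a" using l a by blast
  obtain e' where e': "e' \<in> X" "m e' a = a" using r a by blast
  have re: "m u e = u" if u: "u \<in> X" for u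
  proof -
    obtain w where "w \<in> X" "m w a = u" using r a u by blast
    with semigroup_onD(2)[OF sg this(1) a e(1)] e show ?thesis by simp
  qed
  have le: "m e' u = u" if u: "u \<in> X" for u
  proof -
    obtain w where "w \<in> X" "m a w = u" using l a u by blast
    with semigroup_onD(2)[OF sg e'(1) a this(1)] e' show ?thesis by simp
  qed
  have "e' = e" using re[OF e'(1)] le[OF e(1)] by simp
  with re le e(1) r show ?thesis
    by (intro is_groupI_unit[OF sg e(1)]) auto
qed

lemma is_groupE:
  assumes "is_group X m"
  obtains e where "e \<in> X" "\<And>u. u \<in> X \<Longrightarrow> m e u = u" "\<And>u. u \<in> X \<Longrightarrow> m u e = u"
    "\<And>u. u \<in> X \<Longrightarrow> \<exists>v\<in>X. m u v = e \<and> m v u = e" "semigroup_on X m"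
proof -
  interpret group "as_group X m" using assms by (simp add: is_group_def)
  let ?e = "one (as_group X m)"
  show ?thesis
  proof
    show "?e \<in> X" using one_closed by (simp add: as_group_def)
    show "m ?e u = u" if "u \<in> X" for u using l_one[of u] that by (simp add: as_group_def)
    show "m u ?e = u" if "u \<in> X" for u using r_one[of u] that by (simp add: as_group_def)
    show "\<exists>v\<in>X. m u v = ?e \<and> m v u = ?e" if "u \<in> X" for u
      using inv_closed[of u] l_inv[of u] r_inv[of u] that by (auto simp: as_group_def)
    show "semigroup_on X m"
      using m_closed m_assoc by (auto simp: as_group_def semigroup_on_def)
  qed
qed

lemma is_group_solvable:
  assumes gr: "is_group X m" and u: "u \<in> X" and v: "v \<in> X"
  shows "\<exists>w\<in>X. m u w = v" and "\<exists>w\<in>X. m w u = v"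
proof -
  obtain e where sg: "semigroup_on X m" and e: "m e v = v" "m v e = v" "\<exists>w\<in>X. m u w = e \<and> m w u = e"
    by (rule is_groupE[OF gr]) (use u v in metis)
  then obtain w where w: "w \<in> X" "m u w = e" "m w u = e" by blast
  show "\<exists>w\<in>X. m u w = v"
    using semigroup_onD[OF sg] u v w e by (intro bexI[of _ "m w v"]) (metis, blast)
  show "\<exists>w\<in>X. m w u = v"
    using semigroup_onD[OF sg] u v w e by (intro bexI[of _ "m v w"]) (metis, blast)
qed

lemma finite_cancellative_solvable:
  assumes fin: "finite X" and sg: "semigroup_on X m"
    and l: "\<And>u. u \<in> X \<Longrightarrow> inj_on (m u) X" and r: "\<And>u. u \<in> X \<Longrightarrow> inj_on (\<lambda>v. m v u) X"
    and u: "u \<in> X" and v: "v \<in> X"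
  shows "\<exists>w\<in>X. m u w = v" and "\<exists>w\<in>X. m w u = v"
proof -
  have "m u ` X = X"
    by (rule endo_inj_surj[OF fin _ l[OF u]]) (use semigroup_onD(1)[OF sg u] in blast)
  with v show "\<exists>w\<in>X. m u w = v" by (metis imageE)
  have "(\<lambda>w. m w u) ` X = X"
    by (rule endo_inj_surj[OF fin _ r[OF u]]) (use semigroup_onD(1)[OF sg _ u] in blast)
  with v show "\<exists>w\<in>X. m w u = v" by (metis (no_types, lifting) imageE)
qed

lemma is_group_finite_cancellative:
  assumes "finite X" "semigroup_on X m" "X \<noteq> {}"
    and "\<And>u. u \<in> X \<Longrightarrow> inj_on (m u) X" "\<And>u. u \<in> X \<Longrightarrow> inj_on (\<lambda>v. m v u) X"
  shows "is_group X m"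
  by (rule is_groupI[OF assms(2,3)]) (rule finite_cancellative_solvable[OF assms(1,2,4,5)]; assumption)+

section \<open>Congruences of finite index on words\<close>

abbreviation word_cong :: "('a::finite list \<times> 'a list) set \<Rightarrow> bool" where
  "word_cong r \<equiv> congruence free_semigroup (@) r"

abbreviation cls :: "('a::finite list \<times> 'a list) set \<Rightarrow> 'a list \<Rightarrow> 'a list set" where
  "cls r w \<equiv> r `` {w}"

abbreviation cmult :: "('a::finite list \<times> 'a list) set \<Rightarrow> 'a list set \<Rightarrow> 'a list set \<Rightarrow> 'a list set" where
  "cmult r \<equiv> quot_mult (@) r"

abbreviation quots :: "('a::finite list \<times> 'a list) set \<Rightarrow> 'a list set set" where
  "quots r \<equiv> free_semigroup // r"

lemma free_semigroup_iff [simp]: "w \<in> free_semigroup \<longleftrightarrow> w \<noteq> []"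
  by (simp add: free_semigroup_def)

lemma word_cong_equiv: "word_cong r \<Longrightarrow> equiv free_semigroup r"
  by (simp add: congruence_def)

lemma word_cong_append:
  "word_cong r \<Longrightarrow> (u, v) \<in> r \<Longrightarrow> (u', v') \<in> r \<Longrightarrow> (u @ u', v @ v') \<in> r"
  unfolding congruence_def by blast

lemma word_cong_refl: "word_cong r \<Longrightarrow> w \<noteq> [] \<Longrightarrow> (w, w) \<in> r"
  using word_cong_equiv by (fastforce simp: equiv_def refl_on_def)

lemma cls_eq_iff: "word_cong r \<Longrightarrow> u \<noteq> [] \<Longrightarrow> v \<noteq> [] \<Longrightarrow> cls r u = cls r v \<longleftrightarrow> (u, v) \<in> r"
  by (rule eq_equiv_class_iff[OF word_cong_equiv]) auto

lemma cls_in_quotient: "w \<noteq> [] \<Longrightarrow> cls r w \<in> quots r"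
  by (simp add: quotientI)

lemma quotient_cls: "U \<in> quots r \<Longrightarrow> \<exists>w. w \<noteq> [] \<and> U = cls r w"
  by (auto simp: quotient_def)

lemma cls_self: "word_cong r \<Longrightarrow> w \<noteq> [] \<Longrightarrow> w \<in> cls r w"
  by (simp add: word_cong_refl)

lemma quot_mult_cls:
  assumes r: "word_cong r" and "u \<noteq> []" "v \<noteq> []"
  shows "cmult r (cls r u) (cls r v) = cls r (u @ v)"
proof -
  have e: "equiv free_semigroup r" using word_cong_equiv[OF r] .
  have "(u @ v, w) \<in> r" if "(u, u') \<in> r" "(v, v') \<in> r" "(u' @ v', w) \<in> r" for u' v' w
    using word_cong_append[OF r that(1,2)] that(3) e by (meson equivE transE)
  moreover have "u @ v \<in> {u' @ v' | u' v'. u' \<in> cls r u \<and> v' \<in> cls r v}"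
    using cls_self[OF r] assms(2,3) by blast
  ultimately show ?thesis
    unfolding quot_mult_def by blast
qed

lemma semigroup_on_quot:
  assumes r: "word_cong r"
  shows "semigroup_on (quots r) (cmult r)"
proof -
  have "cmult r U V \<in> quots r"
    if UV: "U \<in> quots r" "V \<in> quots r" for U V
  proof -
    obtain u v where "u \<noteq> []" "U = cls r u" "v \<noteq> []" "V = cls r v"
      using UV[THEN quotient_cls] by blast
    then show ?thesis by (simp add: quot_mult_cls[OF r] cls_in_quotient)
  qed
  moreover have "cmult r (cmult r U V) W = cmult r U (cmult r V W)"
    if UVW: "U \<in> quots r" "V \<in> quots r" "W \<in> quots r" for U V W
  proof -
    obtain u v w where "u \<noteq> []" "U = cls r u" "v \<noteq> []" "V = cls r v" "w \<noteq> []" "W = cls r w"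
      using UVW[THEN quotient_cls] by blast
    then show ?thesis by (simp add: quot_mult_cls[OF r])
  qed
  ultimately show ?thesis by (simp add: semigroup_on_def)
qed

definition ker_cong :: "('a::finite list \<Rightarrow> 'k) \<Rightarrow> ('a list \<times> 'a list) set" where
  "ker_cong g = {(u, v). u \<noteq> [] \<and> v \<noteq> [] \<and> g u = g v}"

lemma word_cong_ker_cong:
  assumes "\<And>u v u' v'. u \<noteq> [] \<Longrightarrow> v \<noteq> [] \<Longrightarrow> u' \<noteq> [] \<Longrightarrow> v' \<noteq> [] \<Longrightarrow>
     g u = g v \<Longrightarrow> g u' = g v' \<Longrightarrow> g (u @ u') = g (v @ v')"
  shows "word_cong (ker_cong g)"
  unfolding congruence_def
proof
  show "equiv free_semigroup (ker_cong g)"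
    by (intro equivI) (auto simp: ker_cong_def refl_on_def sym_def trans_def)
qed (use assms in \<open>auto simp: ker_cong_def\<close>)

lemma finite_ker_cong:
  assumes "finite (g ` free_semigroup)"
  shows "finite (free_semigroup // ker_cong g)"
proof -
  have "free_semigroup // ker_cong g \<subseteq> (\<lambda>k. {v. v \<noteq> [] \<and> g v = k}) ` (g ` free_semigroup)"
  proof
    fix U assume "U \<in> free_semigroup // ker_cong g"
    then obtain u where "u \<noteq> []" "U = cls (ker_cong g) u" using quotient_cls by blast
    then show "U \<in> (\<lambda>k. {v. v \<noteq> [] \<and> g v = k}) ` (g ` free_semigroup)"
      by (intro image_eqI[of _ _ "g u"]) (auto simp: ker_cong_def)
  qed
  then show ?thesis using assms by (meson finite_imageI finite_subset)
qed

lemma word_cong_Int: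
  assumes "word_cong r" "word_cong s"
  shows "word_cong (r \<inter> s)"
  unfolding congruence_def
proof
  show "equiv free_semigroup (r \<inter> s)"
  proof (rule equivI)
    show "r \<inter> s \<subseteq> free_semigroup \<times> free_semigroup"
      using assms(1) word_cong_equiv equiv_type by fastforce
    show "refl_on free_semigroup (r \<inter> s)"
      using assms word_cong_refl by (auto simp: refl_on_def)
    show "sym (r \<inter> s)" "trans (r \<inter> s)"
      using assms[THEN word_cong_equiv] by (auto simp: equiv_def sym_Int trans_Int)
  qed
  show "\<forall>(u, v)\<in>r \<inter> s. \<forall>(u', v')\<in>r \<inter> s. (u @ u', v @ v') \<in> r \<inter> s"
    using assms[THEN word_cong_append] by auto
qed

lemma finite_index_Int:
  assumes r: "word_cong r" and s: "word_cong s"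
    and "finite (quots r)" "finite (quots s)"
  shows "finite (quots (r \<inter> s))"
proof -
  have "quots (r \<inter> s) \<subseteq> (\<lambda>(U, V). U \<inter> V) ` (quots r \<times> quots s)"
  proof
    fix U assume "U \<in> quots (r \<inter> s)"
    then obtain u where "u \<noteq> []" "U = cls (r \<inter> s) u" using quotient_cls by blast
    then show "U \<in> (\<lambda>(U, V). U \<inter> V) ` (quots r \<times> quots s)"
      by (intro image_eqI[of _ _ "(cls r u, cls s u)"]) (auto simp: cls_in_quotient)
  qed
  then show ?thesis using assms by (meson finite_SigmaI finite_imageI finite_subset)
qed

lemma congsD:
  assumes "r \<in> congs V"
  shows "word_cong r" and "finite (quots r)"
  using assms by (auto simp: congs_def)

lemma congs_all_semigroups:
  "r \<in> congs all_semigroups \<longleftrightarrow> word_cong r \<and> finite (quots r)"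
  by (auto simp: congs_def all_semigroups_def)

text \<open>A finite semigroup is a group iff it is cancellative. Cancellation, unlike the existence
  of a unit, is a condition on pairs of words that visibly passes to intersections of
  congruences.\<close>

lemma congs_all_groups:
  "r \<in> congs all_groups \<longleftrightarrow> word_cong r \<and> finite (quots r)
     \<and> (\<forall>u v w. u \<noteq> [] \<longrightarrow> v \<noteq> [] \<longrightarrow> w \<noteq> [] \<longrightarrow> ((u @ v, u @ w) \<in> r \<or> (v @ u, w @ u) \<in> r) \<longrightarrow> (v, w) \<in> r)"
    (is "?l \<longleftrightarrow> ?r")
proof
  assume ?l
  then have r: "word_cong r" and fin: "finite (quots r)"
    and gr: "is_group (quots r) (cmult r)"
    by (auto simp: congs_def all_groups_def)
  from gr obtain e where e: "\<And>U. U \<in> quots r \<Longrightarrow> cmult r e U = U"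
    "\<And>U. U \<in> quots r \<Longrightarrow> cmult r U e = U"
    "\<And>U. U \<in> quots r \<Longrightarrow>
       \<exists>V\<in>quots r. cmult r U V = e \<and> cmult r V U = e"
    by (rule is_groupE) (rule that; assumption)
  have "(v, w) \<in> r"
    if ne: "u \<noteq> []" "v \<noteq> []" "w \<noteq> []" and eq: "(u @ v, u @ w) \<in> r \<or> (v @ u, w @ u) \<in> r" for u v w
  proof -
    obtain V where V: "V \<in> quots r"
      "cmult r (cls r u) V = e" "cmult r V (cls r u) = e"
      using e(3) cls_in_quotient ne(1) by blast
    obtain u' where u': "u' \<noteq> []" "V = cls r u'" using V(1) quotient_cls by blast
    have *: "cls r (u @ u') = e" "cls r (u' @ u) = e"
      using V u' by (simp_all add: quot_mult_cls[OF r] ne)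
    have l: "cls r (u' @ u @ x) = cls r x" "cls r (x @ u @ u') = cls r x" if "x \<noteq> []" for x
      using that e(1,2)[OF cls_in_quotient[OF that]] * ne u'
        quot_mult_cls[OF r, of "u' @ u" x] quot_mult_cls[OF r, of x "u @ u'"] by simp_all
    from eq have "(u' @ u @ v, u' @ u @ w) \<in> r \<or> (v @ u @ u', w @ u @ u') \<in> r"
      using word_cong_append[OF r word_cong_refl[OF r u'(1)]]
        word_cong_append[OF r _ word_cong_refl[OF r u'(1)]] by fastforce
    then have "cls r (u' @ u @ v) = cls r (u' @ u @ w) \<or> cls r (v @ u @ u') = cls r (w @ u @ u')"
      using ne by (simp add: cls_eq_iff[OF r])
    then have "cls r v = cls r w"
      by (simp only: l[OF ne(2)] l[OF ne(3)]) simp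
    then show ?thesis using cls_eq_iff[OF r] ne by blast
  qed
  with r fin show ?r by blast
next
  assume rhs: ?r
  then have r: "word_cong r" and fin: "finite (quots r)" by auto
  have "is_group (quots r) (cmult r)"
  proof (rule is_group_finite_cancellative[OF fin semigroup_on_quot[OF r]])
    show "quots r \<noteq> {}"
      using cls_in_quotient[of "[undefined]" r] by auto
  next
    fix U assume "U \<in> quots r"
    then obtain u where u: "u \<noteq> []" "U = cls r u" using quotient_cls by blast
    have *: "V = W" if VW: "V \<in> quots r" "W \<in> quots r"
      and eq: "cmult r U V = cmult r U W \<or> cmult r V U = cmult r W U" for V W
    proof -
      obtain v w where vw: "v \<noteq> []" "V = cls r v" "w \<noteq> []" "W = cls r w"
        using quotient_cls VW by meson
      then have "(u @ v, u @ w) \<in> r \<or> (v @ u, w @ u) \<in> r"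
        using eq u by (simp add: quot_mult_cls[OF r] cls_eq_iff[OF r])
      with rhs u vw have "(v, w) \<in> r" by blast
      with vw cls_eq_iff[OF r] show ?thesis by blast
    qed
    show "inj_on (cmult r U) (quots r)"
      using * by (intro inj_onI) blast
    show "inj_on (\<lambda>V. cmult r V U) (quots r)"
      using * by (intro inj_onI) blast
  qed
  with r fin show ?l by (simp add: congs_def all_groups_def)
qed

text \<open>Closure under intersection lets one congruence replace finitely many; this is what makes
  single coordinates a base of the topology of \<open>Omega V\<close>.\<close>

definition directed :: "'a::finite pseudovariety \<Rightarrow> bool" where
  "directed V \<longleftrightarrow> congs V \<noteq> {} \<and> (\<forall>r\<in>congs V. \<forall>s\<in>congs V. r \<inter> s \<in> congs V)"

lemma directed_all_semigroups: "directed all_semigroups"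
proof -
  have "ker_cong (\<lambda>_. ()) \<in> congs all_semigroups"
    by (auto simp: congs_all_semigroups intro!: word_cong_ker_cong finite_ker_cong)
  then show ?thesis
    unfolding directed_def by (auto simp: congs_all_semigroups word_cong_Int finite_index_Int)
qed

lemma directed_all_groups: "directed all_groups"
proof -
  have "ker_cong (\<lambda>_. ()) \<in> congs all_groups"
    unfolding congs_all_groups
    by (intro conjI word_cong_ker_cong finite_ker_cong) (auto simp: ker_cong_def)
  moreover have "r \<inter> s \<in> congs all_groups" if "r \<in> congs all_groups" "s \<in> congs all_groups" for r s
  proof -
    from that have "word_cong (r \<inter> s) \<and> finite (quots (r \<inter> s))"
      unfolding congs_all_groups by (simp add: word_cong_Int finite_index_Int)
    moreover have "(v, w) \<in> r \<inter> s"
      if "u \<noteq> []" "v \<noteq> []" "w \<noteq> []" "(u @ v, u @ w) \<in> r \<inter> s \<or> (v @ u, w @ u) \<in> r \<inter> s" for u v w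
      using that \<open>r \<in> congs all_groups\<close> \<open>s \<in> congs all_groups\<close> unfolding congs_all_groups by blast
    ultimately show ?thesis unfolding congs_all_groups by blast
  qed
  ultimately show ?thesis
    unfolding directed_def by blast
qed

lemma directed_finite:
  assumes V: "directed V" and "finite F" "F \<subseteq> congs V"
  shows "\<exists>t\<in>congs V. \<forall>r\<in>F. t \<subseteq> r"
  using assms(2,3)
proof (induction F rule: finite_induct)
  case empty
  then show ?case using V by (auto simp: directed_def)
next
  case (insert r F)
  then obtain t where "t \<in> congs V" "\<forall>r\<in>F. t \<subseteq> r" by auto
  then show ?case
    using V insert.prems unfolding directed_def by (intro bexI[of _ "t \<inter> r"]) auto
qed

section \<open>Elements of the projective limit\<close>

lemma Omega_apply:
  assumes "f \<in> Omega V" "r \<in> congs V"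
  shows "f r \<in> quots r" and "\<exists>w. w \<noteq> [] \<and> f r = cls r w"
proof -
  show "f r \<in> quots r"
    using assms by (auto simp: Omega_def)
  then show "\<exists>w. w \<noteq> [] \<and> f r = cls r w"
    by (rule quotient_cls)
qed

lemma Omega_cls_mono:
  assumes f: "f \<in> Omega V" and r: "r \<in> congs V" and s: "s \<in> congs V" and "r \<subseteq> s"
    and w: "w \<noteq> []" "f r = cls r w"
  shows "f s = cls s w"
proof -
  have "\<forall>r\<in>congs V. \<forall>s\<in>congs V. r \<subseteq> s \<longrightarrow> f r \<subseteq> f s" using f by (simp add: Omega_def)
  then have "f r \<subseteq> f s" using r s \<open>r \<subseteq> s\<close> by blast
  then have "w \<in> f s" using w cls_self[OF congsD(1)[OF r]] by auto
  moreover obtain v where "v \<noteq> []" "f s = cls s v" using Omega_apply[OF f s] by blast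
  ultimately show ?thesis using w congsD(1)[OF s] cls_eq_iff by blast
qed

lemma Omega_agree_mono:
  assumes "f \<in> Omega V" "g \<in> Omega V" "r \<in> congs V" "s \<in> congs V" "r \<subseteq> s" "f r = g r"
  shows "f s = g s"
  using assms Omega_apply[OF assms(1,3)] Omega_cls_mono by metis

lemma Omega_eqI:
  assumes "f \<in> Omega V" "g \<in> Omega V" "\<And>r. r \<in> congs V \<Longrightarrow> f r = g r"
  shows "f = g"
proof (rule PiE_ext)
  show "f \<in> (\<Pi>\<^sub>E r\<in>congs V. quots r)" "g \<in> (\<Pi>\<^sub>E r\<in>congs V. quots r)"
    using assms(1,2) by (auto simp: Omega_def)
qed (rule assms(3))

lemma OmegaI:
  assumes "f \<in> extensional (congs V)"
    and w: "\<And>r s. r \<in> congs V \<Longrightarrow> s \<in> congs V \<Longrightarrow> r \<subseteq> s \<Longrightarrow> \<exists>w. w \<noteq> [] \<and> f r = cls r w \<and> f s = cls s w"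
  shows "f \<in> Omega V"
proof -
  have "f r \<in> quots r" if "r \<in> congs V" for r
    using w[OF that that] cls_in_quotient by auto
  moreover have "f r \<subseteq> f s" if "r \<in> congs V" "s \<in> congs V" "r \<subseteq> s" for r s
    using w[OF that] that(3) by auto
  ultimately show ?thesis
    using assms(1) by (auto simp: Omega_def PiE_def)
qed

lemma of_word_apply: "r \<in> congs V \<Longrightarrow> of_word V w r = cls r w"
  by (simp add: of_word_def)

lemma of_word_in_Omega [simp]: "w \<noteq> [] \<Longrightarrow> of_word V w \<in> Omega V"
  by (rule OmegaI) (auto simp: of_word_def)

lemma Omega_mult_apply: "r \<in> congs V \<Longrightarrow> Omega_mult V f g r = cmult r (f r) (g r)"
  by (simp add: Omega_mult_def)

lemma Omega_mult_cls:
  assumes "r \<in> congs V" "u \<noteq> []" "v \<noteq> []" "f r = cls r u" "g r = cls r v"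
  shows "Omega_mult V f g r = cls r (u @ v)"
  using assms by (simp add: Omega_mult_apply quot_mult_cls[OF congsD(1)])

lemma Omega_mult_in_Omega [simp]:
  assumes f: "f \<in> Omega V" and g: "g \<in> Omega V"
  shows "Omega_mult V f g \<in> Omega V"
proof (rule OmegaI)
  show "Omega_mult V f g \<in> extensional (congs V)" by (simp add: Omega_mult_def)
next
  fix r s assume rs: "r \<in> congs V" "s \<in> congs V" "r \<subseteq> s"
  obtain u v where uv: "u \<noteq> []" "f r = cls r u" "v \<noteq> []" "g r = cls r v"
    using Omega_apply(2)[OF f rs(1)] Omega_apply(2)[OF g rs(1)] by blast
  then have "f s = cls s u" "g s = cls s v"
    using Omega_cls_mono[OF f rs] Omega_cls_mono[OF g rs] by auto
  with uv rs show "\<exists>w. w \<noteq> [] \<and> Omega_mult V f g r = cls r w \<and> Omega_mult V f g s = cls s w"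
    by (intro exI[of _ "u @ v"]) (simp add: Omega_mult_cls)
qed

lemma Omega_mult_assoc:
  assumes f: "f \<in> Omega V" and g: "g \<in> Omega V" and h: "h \<in> Omega V"
  shows "Omega_mult V (Omega_mult V f g) h = Omega_mult V f (Omega_mult V g h)"
proof (rule Omega_eqI)
  fix r assume r: "r \<in> congs V"
  show "Omega_mult V (Omega_mult V f g) h r = Omega_mult V f (Omega_mult V g h) r"
    using Omega_apply(1)[OF f r] Omega_apply(1)[OF g r] Omega_apply(1)[OF h r]
      semigroup_onD(2)[OF semigroup_on_quot[OF congsD(1)[OF r]]]
    by (simp add: Omega_mult_apply r)
qed (use f g h in auto)

lemma semigroup_on_Omega: "semigroup_on (Omega V) (Omega_mult V)"
  by (simp add: semigroup_on_def Omega_mult_assoc)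

lemma of_word_append:
  assumes "u \<noteq> []" "v \<noteq> []"
  shows "of_word V (u @ v) = Omega_mult V (of_word V u) (of_word V v)"
  by (rule Omega_eqI[where V = V]) (use assms in \<open>auto simp: of_word_apply Omega_mult_cls\<close>)

lemma Omega_mult_agree:
  "r \<in> congs V \<Longrightarrow> f r = f' r \<Longrightarrow> g r = g' r \<Longrightarrow> Omega_mult V f g r = Omega_mult V f' g' r"
  by (simp add: Omega_mult_apply)

section \<open>The topology\<close>

text \<open>Closure in the form used throughout, as approximation at one coordinate at a time. For
  directed \<open>V\<close> and subsets of \<open>Omega V\<close> it is the topological closure, by
  \<open>closure_of_Omega_top\<close>.\<close>

definition cl :: "'a::finite pseudovariety \<Rightarrow> 'a pro set \<Rightarrow> 'a pro set" where
  "cl V C = {f \<in> Omega V. \<forall>r\<in>congs V. \<exists>g\<in>C. f r = g r}"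

abbreviation words_cl :: "'a::finite pseudovariety \<Rightarrow> 'a list set \<Rightarrow> 'a pro set" where
  "words_cl V D \<equiv> cl V (of_word V ` D)"

lemma clI: "f \<in> Omega V \<Longrightarrow> (\<And>r. r \<in> congs V \<Longrightarrow> \<exists>g\<in>C. f r = g r) \<Longrightarrow> f \<in> cl V C"
  by (simp add: cl_def)

lemma words_clI:
  "f \<in> Omega V \<Longrightarrow> (\<And>r. r \<in> congs V \<Longrightarrow> \<exists>w\<in>D. f r = cls r w) \<Longrightarrow> f \<in> words_cl V D"
  by (simp add: cl_def of_word_apply)

lemma words_clD: "f \<in> words_cl V D \<Longrightarrow> r \<in> congs V \<Longrightarrow> \<exists>w\<in>D. f r = cls r w"
  by (auto simp: cl_def of_word_apply)

lemma clD: "f \<in> cl V C \<Longrightarrow> r \<in> congs V \<Longrightarrow> \<exists>g\<in>C. f r = g r"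
  by (simp add: cl_def)

lemma cl_subset_Omega: "f \<in> cl V C \<Longrightarrow> f \<in> Omega V"
  by (simp add: cl_def)

lemma subset_cl: "C \<subseteq> Omega V \<Longrightarrow> C \<subseteq> cl V C"
  by (auto simp: cl_def)

lemma cl_mono: "C \<subseteq> C' \<Longrightarrow> cl V C \<subseteq> cl V C'"
  unfolding cl_def by blast

lemma cl_cl: "cl V (cl V C) = cl V C"
proof (intro equalityI subsetI)
  fix f assume f: "f \<in> cl V (cl V C)"
  show "f \<in> cl V C"
    by (rule clI[OF cl_subset_Omega[OF f]]) (metis clD f)
next
  fix f assume f: "f \<in> cl V C"
  then show "f \<in> cl V (cl V C)"
    using cl_subset_Omega by (intro clI) blast+
qed

lemma words_cl_free: "words_cl V free_semigroup = Omega V"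
proof (intro equalityI subsetI)
  fix f assume "f \<in> Omega V"
  then show "f \<in> words_cl V free_semigroup"
    using Omega_apply(2)[of f V] by (intro words_clI) (blast, auto simp: Bex_def)
qed (rule cl_subset_Omega)

lemma cl_mult:
  assumes "\<And>f g. f \<in> C \<Longrightarrow> g \<in> C \<Longrightarrow> Omega_mult V f g \<in> C" "f \<in> cl V C" "g \<in> cl V C"
  shows "Omega_mult V f g \<in> cl V C"
proof (rule clI)
  show "Omega_mult V f g \<in> Omega V"
    using assms(2,3) by (simp add: cl_subset_Omega)
  fix r assume r: "r \<in> congs V"
  obtain f' g' where "f' \<in> C" "f r = f' r" "g' \<in> C" "g r = g' r"
    using clD[OF assms(2) r] clD[OF assms(3) r] by blast
  then show "\<exists>h\<in>C. Omega_mult V f g r = h r"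
    using assms(1) Omega_mult_agree[OF r] by metis
qed

lemma topspace_Omega_top [simp]: "topspace (Omega_top V) = Omega V"
  by (auto simp: Omega_top_def Omega_def PiE_def)

text \<open>A basic open set of the product constrains finitely many coordinates;
  \<open>directed_finite\<close> supplies one congruence contained in all of them, and agreement
  there implies agreement at each.\<close>

lemma openin_Omega_top:
  assumes V: "directed V"
  shows "openin (Omega_top V) U \<longleftrightarrow>
    U \<subseteq> Omega V \<and> (\<forall>f\<in>U. \<exists>r\<in>congs V. \<forall>g\<in>Omega V. g r = f r \<longrightarrow> g \<in> U)" (is "?l \<longleftrightarrow> ?r")
proof
  assume ?l
  then obtain S where
    S: "openin (product_topology (\<lambda>r. discrete_topology (quots r)) (congs V)) S"
    and U: "U = S \<inter> Omega V"
    by (auto simp: Omega_top_def openin_subtopology)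
  have "\<exists>r\<in>congs V. \<forall>g\<in>Omega V. g r = f r \<longrightarrow> g \<in> U" if "f \<in> U" for f
  proof -
    have f: "f \<in> Omega V" "f \<in> S" using that U by auto
    obtain X where fin: "finite {r \<in> congs V. X r \<noteq> quots r}"
      and fX: "f \<in> Pi\<^sub>E (congs V) X" and XS: "Pi\<^sub>E (congs V) X \<subseteq> S"
      using S f(2) unfolding openin_product_topology_alt by auto
    obtain t where t: "t \<in> congs V" "\<And>r. r \<in> congs V \<Longrightarrow> X r \<noteq> quots r \<Longrightarrow> t \<subseteq> r"
      using directed_finite[OF V fin] by auto
    have "g \<in> U" if g: "g \<in> Omega V" "g t = f t" for g
    proof -
      have "g r \<in> X r" if r: "r \<in> congs V" for r
      proof (cases "X r = quots r")
        case True
        then show ?thesis using Omega_apply(1)[OF g(1) r] by simp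
      next
        case False
        then have "g r = f r" using Omega_agree_mono[OF g(1) f(1) t(1) r t(2)[OF r]] g(2) by simp
        then show ?thesis using fX r by auto
      qed
      then have "g \<in> Pi\<^sub>E (congs V) X" using g(1) by (auto simp: Omega_def PiE_def)
      then show ?thesis using XS U g(1) by auto
    qed
    with t(1) show ?thesis by blast
  qed
  with U show ?r by auto
next
  assume rhs: ?r
  define N where "N = (\<lambda>f r. {g \<in> Omega V. g r = f r})"
  have "openin (Omega_top V) (N f r)" if "f \<in> Omega V" "r \<in> congs V" for f r
  proof -
    have "openin (product_topology (\<lambda>r. discrete_topology (quots r)) (congs V))
       {g \<in> topspace (product_topology (\<lambda>r. discrete_topology (quots r)) (congs V)). g r \<in> {f r}}"
      by (rule openin_continuous_map_preimage[OF continuous_map_product_projection[OF that(2)]])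
         (use Omega_apply(1)[OF that] in simp)
    moreover have "N f r = {g \<in> topspace (product_topology (\<lambda>r. discrete_topology (quots r)) (congs V)). g r \<in> {f r}} \<inter> Omega V"
      by (auto simp: N_def Omega_def)
    ultimately show ?thesis unfolding Omega_top_def openin_subtopology by blast
  qed
  moreover have "\<exists>K. f \<in> K \<and> K \<subseteq> U \<and> openin (Omega_top V) K" if f: "f \<in> U" for f
  proof -
    obtain r where "r \<in> congs V" "\<forall>g\<in>Omega V. g r = f r \<longrightarrow> g \<in> U" using rhs f by blast
    then show ?thesis
      using rhs f calculation[of f r] by (intro exI[of _ "N f r"]) (auto simp: N_def)
  qed
  ultimately show ?l by (subst openin_subopen) blast
qed

lemma closure_of_Omega_top:
  assumes V: "directed V" and C: "C \<subseteq> Omega V"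
  shows "Omega_top V closure_of C = cl V C"
proof (intro equalityI subsetI)
  fix f assume f: "f \<in> Omega_top V closure_of C"
  show "f \<in> cl V C"
  proof (rule clI)
    show fO: "f \<in> Omega V" using f by (auto simp: in_closure_of)
    fix r assume r: "r \<in> congs V"
    have "openin (Omega_top V) {g \<in> Omega V. g r = f r}"
      unfolding openin_Omega_top[OF V] using r by auto
    moreover have "f \<in> {g \<in> Omega V. g r = f r}" using fO by simp
    ultimately have "\<exists>g. g \<in> C \<and> g \<in> {g \<in> Omega V. g r = f r}"
      using f unfolding in_closure_of by (elim conjE allE impE) (rule conjI)
    then show "\<exists>g\<in>C. f r = g r" by auto
  qed
next
  fix f assume f: "f \<in> cl V C"
  show "f \<in> Omega_top V closure_of C"
    unfolding in_closure_of
  proof (intro conjI allI impI)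
    show "f \<in> topspace (Omega_top V)" using f by (simp add: cl_def)
    fix T assume T: "f \<in> T \<and> openin (Omega_top V) T"
    then obtain r where r: "r \<in> congs V" "\<forall>g\<in>Omega V. g r = f r \<longrightarrow> g \<in> T"
      using openin_Omega_top[OF V] by meson
    obtain g where "g \<in> C" "f r = g r" using clD[OF f r(1)] by blast
    then show "\<exists>g. g \<in> C \<and> g \<in> T" using r(2) C by (metis subsetD)
  qed
qed

lemma closedin_cl: "directed V \<Longrightarrow> C \<subseteq> Omega V \<Longrightarrow> closedin (Omega_top V) (cl V C)"
  using closure_of_Omega_top closedin_closure_of by metis

lemma closedin_iff_cl:
  assumes "directed V" "C \<subseteq> Omega V"
  shows "closedin (Omega_top V) C \<longleftrightarrow> cl V C \<subseteq> C"
  using assms closure_of_Omega_top closure_of_eq subset_cl by (metis subset_antisym subset_refl)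

lemma Hausdorff_Omega_top: "Hausdorff_space (Omega_top V)"
  by (simp add: Omega_top_def Hausdorff_space_subtopology Hausdorff_space_product_topology
      Hausdorff_space_discrete_topology)

text \<open>The product of the finite discrete quotients is compact by Tychonoff, and each
  compatibility condition \<open>f r \<subseteq> f s\<close> involves two coordinates only, so it is
  closed.\<close>

lemma compact_Omega_top: "compact_space (Omega_top V)"
proof -
  let ?D = "\<lambda>r. discrete_topology (quots r)"
  let ?P = "product_topology ?D (congs V)"
  have comp: "compact_space ?P"
    by (auto simp: compact_space_product_topology compact_space_discrete_topology congsD(2))
  have cl: "closedin ?P {f \<in> topspace ?P. f r \<subseteq> f s}" if "r \<in> congs V" "s \<in> congs V" for r s
  proof -
    let ?A = "{p \<in> quots r \<times> quots s. fst p \<subseteq> snd p}"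
    have "continuous_map ?P (prod_topology (?D r) (?D s)) (\<lambda>f. (f r, f s))"
      by (intro continuous_map_pairedI continuous_map_product_projection that)
    moreover have "closedin (prod_topology (?D r) (?D s)) ?A"
      by (subst prod_topology_discrete_topology[symmetric]) auto
    ultimately have "closedin ?P {f \<in> topspace ?P. (f r, f s) \<in> ?A}"
      by (rule closedin_continuous_map_preimage)
    moreover have "{f \<in> topspace ?P. (f r, f s) \<in> ?A} = {f \<in> topspace ?P. f r \<subseteq> f s}"
      using that by auto
    ultimately show ?thesis by simp
  qed
  \<comment> \<open>The whole space is added so that the family is nonempty, as
    \<open>closedin_Inter\<close> demands: here \<open>V\<close> is arbitrary and
    \<open>congs V\<close> might be empty.\<close>
  define \<K> where "\<K> = insert (topspace ?P)
    {{f \<in> topspace ?P. f r \<subseteq> f s} | r s. r \<in> congs V \<and> s \<in> congs V \<and> r \<subseteq> s}"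
  have "closedin ?P (\<Inter>\<K>)"
  proof (rule closedin_Inter)
    show "closedin ?P S" if "S \<in> \<K>" for S
      using that cl closedin_topspace[of ?P] unfolding \<K>_def by blast
  qed (simp add: \<K>_def)
  moreover have "\<Inter>\<K> = Omega V"
    unfolding \<K>_def Omega_def by auto
  ultimately have "compactin ?P (Omega V)"
    using closedin_compact_space[OF comp] by metis
  then show ?thesis by (simp add: Omega_top_def compact_space_subtopology)
qed

section \<open>Uniformly continuous maps\<close>

text \<open>Uniform continuity expressed by coordinates. It is relative to a subset \<open>C\<close>
  because some maps, such as the one defined by weights, exist only on the closure of
  \<open>returns\<close>.\<close>

definition unif :: "'a::finite pseudovariety \<Rightarrow> 'b::finite pseudovariety \<Rightarrow> 'a pro set \<Rightarrow> ('a pro \<Rightarrow> 'b pro) \<Rightarrow> bool" where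
  "unif V W C F \<longleftrightarrow> C \<subseteq> Omega V \<and> (\<forall>f\<in>C. F f \<in> Omega W)
     \<and> (\<forall>s\<in>congs W. \<exists>r\<in>congs V. \<forall>f\<in>C. \<forall>g\<in>C. f r = g r \<longrightarrow> F f s = F g s)"

lemma unifD:
  assumes "unif V W C F"
  shows "f \<in> C \<Longrightarrow> f \<in> Omega V" and "f \<in> C \<Longrightarrow> F f \<in> Omega W"
    and "s \<in> congs W \<Longrightarrow> \<exists>r\<in>congs V. \<forall>f\<in>C. \<forall>g\<in>C. f r = g r \<longrightarrow> F f s = F g s"
  using assms unfolding unif_def by blast+

lemma unifI_same:
  assumes "C \<subseteq> Omega V" "\<And>f. f \<in> C \<Longrightarrow> F f \<in> Omega V"
    and "\<And>s f g. s \<in> congs V \<Longrightarrow> f \<in> C \<Longrightarrow> g \<in> C \<Longrightarrow> f s = g s \<Longrightarrow> F f s = F g s"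
  shows "unif V V C F"
  using assms unfolding unif_def by blast

lemma unif_subset: "unif V W C F \<Longrightarrow> C' \<subseteq> C \<Longrightarrow> unif V W C' F"
  unfolding unif_def by (meson subsetD subset_trans)

lemma unif_comp:
  assumes F: "unif V W C F" and G: "unif W X C' G" and "\<And>f. f \<in> C \<Longrightarrow> F f \<in> C'"
  shows "unif V X C (\<lambda>f. G (F f))"
  unfolding unif_def
proof (intro conjI ballI)
  show "C \<subseteq> Omega V" using unifD(1)[OF F] by blast
  show "G (F f) \<in> Omega X" if "f \<in> C" for f using unifD(2)[OF G] assms(3) that by blast
  fix t assume "t \<in> congs X"
  then obtain s where s: "s \<in> congs W" "\<forall>f\<in>C'. \<forall>g\<in>C'. f s = g s \<longrightarrow> G f t = G g t"
    using unifD(3)[OF G] by blast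
  then obtain r where "r \<in> congs V" "\<forall>f\<in>C. \<forall>g\<in>C. f r = g r \<longrightarrow> F f s = F g s"
    using unifD(3)[OF F] by blast
  with s assms(3) show "\<exists>r\<in>congs V. \<forall>f\<in>C. \<forall>g\<in>C. f r = g r \<longrightarrow> G (F f) t = G (F g) t"
    by blast
qed

lemma unif_continuous:
  assumes V: "directed V" and W: "directed W" and F: "unif V W C F"
  shows "continuous_map (subtopology (Omega_top V) C) (Omega_top W) F"
  unfolding continuous_map
proof (intro conjI allI impI)
  have CO: "C \<subseteq> Omega V" using unifD(1)[OF F] by blast
  then have top: "topspace (subtopology (Omega_top V) C) = C" by auto
  show "F ` topspace (subtopology (Omega_top V) C) \<subseteq> topspace (Omega_top W)"
    using unifD(2)[OF F] by (auto simp: top)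
  fix U assume U: "openin (Omega_top W) U"
  let ?S = "{x \<in> topspace (subtopology (Omega_top V) C). F x \<in> U}"
  have "\<exists>N. openin (subtopology (Omega_top V) C) N \<and> f \<in> N \<and> N \<subseteq> ?S" if f: "f \<in> ?S" for f
  proof -
    have fC: "f \<in> C" "F f \<in> U" using f by (auto simp: top)
    then obtain s where s: "s \<in> congs W" "\<And>g. g \<in> Omega W \<Longrightarrow> g s = F f s \<Longrightarrow> g \<in> U"
      using U unfolding openin_Omega_top[OF W] by meson
    then obtain r where r: "r \<in> congs V" "\<And>f g. f \<in> C \<Longrightarrow> g \<in> C \<Longrightarrow> f r = g r \<Longrightarrow> F f s = F g s"
      using unifD(3)[OF F] by meson
    define N where "N = {g \<in> Omega V. g r = f r}"
    have "openin (Omega_top V) N"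
      unfolding openin_Omega_top[OF V] N_def using r(1) by auto
    then have "openin (subtopology (Omega_top V) C) (N \<inter> C)"
      by (rule openin_subtopology_Int)
    moreover have "f \<in> N \<inter> C" using fC CO by (auto simp: N_def)
    moreover have "N \<inter> C \<subseteq> ?S"
    proof
      fix g assume g: "g \<in> N \<inter> C"
      then have "F g s = F f s" using r(2)[of g f] fC by (simp add: N_def)
      then show "g \<in> ?S" using s(2)[of "F g"] unifD(2)[OF F] g CO by (auto simp: top)
    qed
    ultimately show ?thesis by blast
  qed
  then show "openin (subtopology (Omega_top V) C) ?S"
    by (subst openin_subopen) meson
qed

text \<open>The intersection of \<open>t\<close> with the modulus of \<open>F\<close> at
  \<open>s\<close> is again a coordinate. Controlling \<open>f t\<close> as well allows a second
  map, with its own modulus, to be followed along the same approximation.\<close>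

lemma unif_approx:
  assumes V: "directed V" and F: "unif V W (cl V C) F" and C: "C \<subseteq> Omega V"
    and f: "f \<in> cl V C" and s: "s \<in> congs W" and t: "t \<in> congs V"
  shows "\<exists>g\<in>C. F f s = F g s \<and> f t = g t"
proof -
  obtain r where r: "r \<in> congs V" "\<And>f g. f \<in> cl V C \<Longrightarrow> g \<in> cl V C \<Longrightarrow> f r = g r \<Longrightarrow> F f s = F g s"
    using unifD(3)[OF F s] by meson
  have rt: "r \<inter> t \<in> congs V" using V r t by (auto simp: directed_def)
  obtain g where g: "g \<in> C" "f (r \<inter> t) = g (r \<inter> t)" using clD[OF f rt] by blast
  have gO: "g \<in> Omega V" and fO: "f \<in> Omega V" using g C cl_subset_Omega[OF f] by auto
  have "f r = g r" "f t = g t"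
    using Omega_agree_mono[OF fO gO rt r(1) _ g(2)] Omega_agree_mono[OF fO gO rt t _ g(2)] by auto
  then show ?thesis using r(2)[OF f, of g] g(1) subset_cl[OF C] by (meson subsetD)
qed

lemma unif_eqI:
  assumes V: "directed V" and F: "unif V W (cl V C) F" and G: "unif V W (cl V C) G"
    and C: "C \<subseteq> Omega V" and eq: "\<And>f. f \<in> C \<Longrightarrow> F f = G f" and f: "f \<in> cl V C"
  shows "F f = G f"
proof (rule Omega_eqI)
  show "F f \<in> Omega W" "G f \<in> Omega W" using unifD(2)[OF F f] unifD(2)[OF G f] .
  fix s assume s: "s \<in> congs W"
  obtain t where t: "t \<in> congs V" "\<And>f g. f \<in> cl V C \<Longrightarrow> g \<in> cl V C \<Longrightarrow> f t = g t \<Longrightarrow> G f s = G g s"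
    using unifD(3)[OF G s] by meson
  obtain g where g: "g \<in> C" "F f s = F g s" "f t = g t"
    using unif_approx[OF V F C f s t(1)] by blast
  then show "F f s = G f s"
    using t(2)[OF f, of g] subset_cl[OF C] eq[OF g(1)] by auto
qed

lemma unif_range:
  assumes V: "directed V" and F: "unif V W (cl V C) F" and C: "C \<subseteq> Omega V"
    and ran: "\<And>f. f \<in> C \<Longrightarrow> F f \<in> cl W E" and f: "f \<in> cl V C"
  shows "F f \<in> cl W E"
proof (rule clI)
  show "F f \<in> Omega W" using unifD(2)[OF F f] .
  fix s assume s: "s \<in> congs W"
  obtain t where "t \<in> congs V" using V by (auto simp: directed_def)
  then obtain g where "g \<in> C" "F f s = F g s"
    using unif_approx[OF V F C f s] by blast
  then show "\<exists>h\<in>E. F f s = h s" using clD[OF ran s] by metis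
qed

lemma unif_mult:
  assumes V: "directed V" and F: "unif V W (cl V C) F" and C: "C \<subseteq> Omega V"
    and mult: "\<And>f g. f \<in> C \<Longrightarrow> g \<in> C \<Longrightarrow> Omega_mult V f g \<in> C"
    and hom: "\<And>f g. f \<in> C \<Longrightarrow> g \<in> C \<Longrightarrow> F (Omega_mult V f g) = Omega_mult W (F f) (F g)"
    and f: "f \<in> cl V C" and g: "g \<in> cl V C"
  shows "F (Omega_mult V f g) = Omega_mult W (F f) (F g)"
proof (rule Omega_eqI)
  have fg: "Omega_mult V f g \<in> cl V C" using cl_mult[OF mult f g] .
  show "F (Omega_mult V f g) \<in> Omega W" "Omega_mult W (F f) (F g) \<in> Omega W"
    using unifD(2)[OF F] f g fg by simp_all
  fix s assume s: "s \<in> congs W"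
  obtain r where r: "r \<in> congs V" "\<And>f g. f \<in> cl V C \<Longrightarrow> g \<in> cl V C \<Longrightarrow> f r = g r \<Longrightarrow> F f s = F g s"
    using unifD(3)[OF F s] by meson
  obtain f' where f': "f' \<in> C" "F f s = F f' s" "f r = f' r"
    using unif_approx[OF V F C f s r(1)] by blast
  obtain g' where g': "g' \<in> C" "F g s = F g' s" "g r = g' r"
    using unif_approx[OF V F C g s r(1)] by blast
  have "F (Omega_mult V f g) s = F (Omega_mult V f' g') s"
  proof (rule r(2)[OF fg])
    show "Omega_mult V f' g' \<in> cl V C"
      using mult[OF f'(1) g'(1)] subset_cl[OF C] by (rule rev_subsetD)
    show "Omega_mult V f g r = Omega_mult V f' g' r"
      by (rule Omega_mult_agree) fact+
  qed
  also have "\<dots> = Omega_mult W (F f) (F g) s"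
    unfolding hom[OF f'(1) g'(1)] by (rule Omega_mult_agree[OF s]) (simp_all add: f' g')
  finally show "F (Omega_mult V f g) s = Omega_mult W (F f) (F g) s" .
qed

text \<open>The image of \<open>cl V C\<close> is compact, hence closed, and solutions at every
  single coordinate place \<open>b\<close> in its closure.\<close>

lemma unif_solve:
  assumes V: "directed V" and W: "directed W" and F: "unif V W (cl V C) F" and C: "C \<subseteq> Omega V"
    and b: "b \<in> Omega W" and sol: "\<And>s. s \<in> congs W \<Longrightarrow> \<exists>f\<in>cl V C. F f s = b s"
  shows "\<exists>f\<in>cl V C. F f = b"
proof -
  have clO: "cl V C \<subseteq> Omega V" using cl_subset_Omega by blast
  have FO: "F ` cl V C \<subseteq> Omega W" using unifD(2)[OF F] by blast
  have "compactin (Omega_top V) (cl V C)"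
    by (rule closedin_compact_space[OF compact_Omega_top closedin_cl[OF V C]])
  then have "compactin (subtopology (Omega_top V) (cl V C)) (cl V C)"
    by (simp add: compactin_subtopology)
  from image_compactin[OF this unif_continuous[OF V W F]]
  have "closedin (Omega_top W) (F ` cl V C)"
    by (rule compactin_imp_closedin[OF Hausdorff_Omega_top])
  then have "cl W (F ` cl V C) \<subseteq> F ` cl V C"
    using closedin_iff_cl[OF W FO] by blast
  moreover have "b \<in> cl W (F ` cl V C)"
    by (rule clI[OF b]) (use sol in force)
  ultimately show ?thesis by blast
qed

text \<open>The coordinate \<open>s\<close> of the extension is read off from any word of
  \<open>D\<close> that represents the argument at the modulus \<open>R s\<close>; uniform
  continuity makes the choice of the word immaterial.\<close>

lemma unif_extension:
  fixes m :: "'a::finite list \<Rightarrow> 'b::finite pro"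
  assumes V: "directed V" and D: "D \<subseteq> free_semigroup" and m: "\<And>w. w \<in> D \<Longrightarrow> m w \<in> Omega W"
    and uc: "\<And>s. s \<in> congs W \<Longrightarrow> \<exists>r\<in>congs V. \<forall>u\<in>D. \<forall>v\<in>D. (u, v) \<in> r \<longrightarrow> m u s = m v s"
  shows "\<exists>F. unif V W (words_cl V D) F \<and> (\<forall>w\<in>D. F (of_word V w) = m w)"
proof -
  obtain R where R: "\<And>s. s \<in> congs W \<Longrightarrow> R s \<in> congs V"
    "\<And>s u v. s \<in> congs W \<Longrightarrow> u \<in> D \<Longrightarrow> v \<in> D \<Longrightarrow> (u, v) \<in> R s \<Longrightarrow> m u s = m v s"
    using uc by metis
  define F where "F = (\<lambda>f. \<lambda>s\<in>congs W. m (SOME w. w \<in> D \<and> f (R s) = cls (R s) w) s)"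
  have F: "F f s = m w s" if "s \<in> congs W" "w \<in> D" "f (R s) = cls (R s) w" for f s w
  proof -
    define w' where "w' = (SOME w. w \<in> D \<and> f (R s) = cls (R s) w)"
    have w': "w' \<in> D" "f (R s) = cls (R s) w'"
      using someI_ex[of "\<lambda>w. w \<in> D \<and> f (R s) = cls (R s) w"] that unfolding w'_def by blast+
    then have "(w, w') \<in> R s"
      using cls_eq_iff[OF congsD(1)[OF R(1)[OF that(1)]], of w w'] that D
      by (metis free_semigroup_iff subsetD)
    then show ?thesis using R(2)[OF that(1,2) w'(1)] that(1) by (simp add: F_def w'_def)
  qed
  have clF: "F f \<in> Omega W" if f: "f \<in> words_cl V D" for f
  proof (rule OmegaI)
    show "F f \<in> extensional (congs W)" by (simp add: F_def)
    fix r s assume rs: "r \<in> congs W" "s \<in> congs W" "r \<subseteq> s"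
    \<comment> \<open>A word that represents \<open>f\<close> at the common refinement gives both
      coordinates of \<open>F f\<close>, which makes them compatible.\<close>
    define t where "t = R r \<inter> R s"
    have t: "t \<in> congs V" using V R(1) rs by (auto simp: t_def directed_def)
    obtain w where w: "w \<in> D" "f t = cls t w" using words_clD[OF f t] by blast
    have "f (R r) = cls (R r) w" "f (R s) = cls (R s) w"
      using Omega_cls_mono[OF cl_subset_Omega[OF f] t _ _ _ w(2)] R(1) rs w D by (auto simp: t_def)
    then have "F f r = m w r" "F f s = m w s" using F rs w by auto
    moreover obtain v where "v \<noteq> []" "m w r = cls r v"
      using Omega_apply(2)[OF m[OF w(1)] rs(1)] by blast
    moreover have "m w s = cls s v"
      using Omega_cls_mono[OF m[OF w(1)] rs] calculation by simp
    ultimately show "\<exists>v. v \<noteq> [] \<and> F f r = cls r v \<and> F f s = cls s v" by auto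
  qed
  have "unif V W (words_cl V D) F"
    unfolding unif_def
  proof (intro conjI ballI)
    show "words_cl V D \<subseteq> Omega V" using cl_subset_Omega by blast
    show "F f \<in> Omega W" if "f \<in> words_cl V D" for f using clF that .
    fix s assume s: "s \<in> congs W"
    have "F f s = F g s" if fg: "f \<in> words_cl V D" "g \<in> words_cl V D" "f (R s) = g (R s)" for f g
    proof -
      obtain w where "w \<in> D" "f (R s) = cls (R s) w" using words_clD[OF fg(1) R(1)[OF s]] by blast
      then show ?thesis using F[OF s] fg(3) by metis
    qed
    then show "\<exists>r\<in>congs V. \<forall>f\<in>words_cl V D. \<forall>g\<in>words_cl V D. f r = g r \<longrightarrow> F f s = F g s"
      using R(1)[OF s] by blast
  qed
  moreover have "F (of_word V w) = m w" if w: "w \<in> D" for w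
  proof (rule Omega_eqI[OF _ m[OF w]])
    show "F (of_word V w) \<in> Omega W"
      using clF subset_cl[of "of_word V ` D" V] w D by fastforce
    show "F (of_word V w) s = m w s" if "s \<in> congs W" for s
      using F[OF that w] by (simp add: of_word_apply R(1)[OF that])
  qed
  ultimately show ?thesis by blast
qed

section \<open>Homomorphisms with prescribed values on the letters\<close>

fun word_prod :: "('c \<Rightarrow> 'c \<Rightarrow> 'c) \<Rightarrow> ('a \<Rightarrow> 'c) \<Rightarrow> 'a list \<Rightarrow> 'c" where
  "word_prod M \<theta> [] = undefined"
| "word_prod M \<theta> [c] = \<theta> c"
| "word_prod M \<theta> (c # d # w) = M (\<theta> c) (word_prod M \<theta> (d # w))"

lemma word_prod_Cons: "w \<noteq> [] \<Longrightarrow> word_prod M \<theta> (c # w) = M (\<theta> c) (word_prod M \<theta> w)"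
  by (cases w) auto

lemma word_prod_in:
  assumes "semigroup_on X M" "\<And>c. \<theta> c \<in> X" "w \<noteq> []"
  shows "word_prod M \<theta> w \<in> X"
  using assms(3)
proof (induction w)
  case (Cons c w)
  then show ?case
    using assms semigroup_onD(1)[OF assms(1)] by (cases "w = []") (auto simp: word_prod_Cons)
qed simp

lemma word_prod_append:
  assumes sg: "semigroup_on X M" and \<theta>: "\<And>c. \<theta> c \<in> X" and "u \<noteq> []" "v \<noteq> []"
  shows "word_prod M \<theta> (u @ v) = M (word_prod M \<theta> u) (word_prod M \<theta> v)"
  using assms(3)
proof (induction u)
  case (Cons c u)
  then show ?case
    using word_prod_in[OF sg, of \<theta>] semigroup_onD(2)[OF sg] \<theta> assms(4)
    by (cases "u = []") (simp_all add: word_prod_Cons)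
qed simp

text \<open>The pseudovariety enters only through the last hypothesis: at each coordinate of the
  target, the kernel of the word map must be one of the congruences that define
  \<open>Omega V\<close>. That kernel is then the modulus of uniform continuity.\<close>

lemma hom_extension:
  fixes \<theta> :: "'a::finite \<Rightarrow> 'b::finite pro"
  assumes V: "directed V" and K: "K \<subseteq> Omega W" and sg: "semigroup_on K (Omega_mult W)"
    and \<theta>: "\<And>c. \<theta> c \<in> K"
    and ker: "\<forall>s\<in>congs W. ker_cong (\<lambda>w. word_prod (Omega_mult W) \<theta> w s) \<in> congs V"
  shows "\<exists>F. unif V W (Omega V) F \<and> (\<forall>f\<in>Omega V. F f \<in> cl W K)
    \<and> (\<forall>f\<in>Omega V. \<forall>g\<in>Omega V. F (Omega_mult V f g) = Omega_mult W (F f) (F g))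
    \<and> (\<forall>c. F (of_word V [c]) = \<theta> c)"
proof -
  let ?m = "word_prod (Omega_mult W) \<theta>" and ?C = "of_word V ` free_semigroup"
  have m: "?m w \<in> K" if "w \<noteq> []" for w using word_prod_in[OF sg \<theta> that] .
  have C: "?C \<subseteq> Omega V" by auto
  obtain F where F: "unif V W (cl V ?C) F" "\<And>w. w \<in> free_semigroup \<Longrightarrow> F (of_word V w) = ?m w"
    using unif_extension[OF V, of free_semigroup ?m W] m K ker
    by (smt (verit) CollectD case_prodD dual_order.refl free_semigroup_iff ker_cong_def subsetD)
  have ran: "F f \<in> cl W K" if "f \<in> cl V ?C" for f
    by (rule unif_range[OF V F(1) C _ that]) (use F(2) m subset_cl[OF K] in auto)
  have "F (Omega_mult V f g) = Omega_mult W (F f) (F g)" if "f \<in> cl V ?C" "g \<in> cl V ?C" for f g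
  proof (rule unif_mult[OF V F(1) C _ _ that])
    fix f g assume "f \<in> ?C" "g \<in> ?C"
    then obtain u v where uv: "u \<noteq> []" "v \<noteq> []" "f = of_word V u" "g = of_word V v" by auto
    then have *: "Omega_mult V f g = of_word V (u @ v)" by (simp add: of_word_append)
    with uv show "Omega_mult V f g \<in> ?C" by (intro image_eqI[of _ _ "u @ v"]) auto
    show "F (Omega_mult V f g) = Omega_mult W (F f) (F g)"
      unfolding * using uv F(2) word_prod_append[OF sg \<theta> uv(1,2)] by simp
  qed
  moreover have "F (of_word V [c]) = \<theta> c" for c using F(2)[of "[c]"] by simp
  ultimately show ?thesis
    using F(1) ran unfolding words_cl_free by blast
qed

lemma word_cong_ker_word_prod:
  fixes \<theta> :: "'a::finite \<Rightarrow> 'b::finite pro"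
  assumes K: "K \<subseteq> Omega W" and sg: "semigroup_on K (Omega_mult W)" and \<theta>: "\<And>c. \<theta> c \<in> K"
    and s: "s \<in> congs W"
  shows "word_cong (ker_cong (\<lambda>w. word_prod (Omega_mult W) \<theta> w s))" (is ?A)
    and "finite (free_semigroup // ker_cong (\<lambda>w. word_prod (Omega_mult W) \<theta> w s))" (is ?B)
proof -
  show ?A
  proof (rule word_cong_ker_cong)
    fix u v u' v' :: "'a list"
    assume "u \<noteq> []" "v \<noteq> []" "u' \<noteq> []" "v' \<noteq> []"
      "word_prod (Omega_mult W) \<theta> u s = word_prod (Omega_mult W) \<theta> v s"
      "word_prod (Omega_mult W) \<theta> u' s = word_prod (Omega_mult W) \<theta> v' s"
    then show "word_prod (Omega_mult W) \<theta> (u @ u') s = word_prod (Omega_mult W) \<theta> (v @ v') s"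
      by (simp add: word_prod_append[OF sg \<theta>] Omega_mult_apply s)
  qed
  have "(\<lambda>w. word_prod (Omega_mult W) \<theta> w s) ` free_semigroup \<subseteq> quots s"
    using word_prod_in[OF sg, of \<theta>] \<theta> K Omega_apply(1)[OF _ s] by (auto simp: subset_iff)
  then show ?B
    using finite_ker_cong congsD(2)[OF s] finite_subset by blast
qed

section \<open>Idempotent powers of endomorphisms\<close>

definition pro_endo :: "'a::finite pseudovariety \<Rightarrow> ('a pro \<Rightarrow> 'a pro) \<Rightarrow> bool" where
  "pro_endo V F \<longleftrightarrow> unif V V (Omega V) F
     \<and> (\<forall>f\<in>Omega V. \<forall>g\<in>Omega V. F (Omega_mult V f g) = Omega_mult V (F f) (F g))"

lemma pro_endoD:
  assumes "pro_endo V F"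
  shows "unif V V (Omega V) F" and "f \<in> Omega V \<Longrightarrow> F f \<in> Omega V"
    and "f \<in> Omega V \<Longrightarrow> g \<in> Omega V \<Longrightarrow> F (Omega_mult V f g) = Omega_mult V (F f) (F g)"
  using assms unfolding pro_endo_def unif_def by blast+

lemma pro_endo_id: "pro_endo V (\<lambda>f. f)"
  unfolding pro_endo_def by (auto intro!: unifI_same)

lemma pro_endo_comp:
  assumes F: "pro_endo V F" and G: "pro_endo V G"
  shows "pro_endo V (\<lambda>f. G (F f))"
  unfolding pro_endo_def
  using unif_comp[OF pro_endoD(1)[OF F] pro_endoD(1)[OF G] pro_endoD(2)[OF F]]
    pro_endoD(2,3)[OF F] pro_endoD(3)[OF G] by simp

lemma pro_endo_funpow:
  assumes V: "directed V" and F: "pro_endo V F"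
  shows "pro_endo V (F ^^ n)"
proof (induction n)
  case 0
  then show ?case using pro_endo_id by (simp add: id_def)
next
  case (Suc n)
  then show ?case using pro_endo_comp[OF Suc F] by (simp add: comp_def)
qed

text \<open>Multiplication acts coordinatewise, so agreement at one fixed \<open>s\<close> spreads
  from letters to words without any assumption on other coordinates; density of words does the
  rest.\<close>

lemma pro_endo_agree_gens:
  assumes V: "directed V" and F: "pro_endo V F" and G: "pro_endo V G" and s: "s \<in> congs V"
    and gen: "\<And>c. F (of_word V [c]) s = G (of_word V [c]) s" and f: "f \<in> Omega V"
  shows "F f s = G f s"
proof -
  have w: "F (of_word V w) s = G (of_word V w) s" if "w \<noteq> []" for w
    using that
  proof (induction w)
    case (Cons c w)
    show ?case
    proof (cases "w = []")
      case False
      have "H (of_word V (c # w)) = Omega_mult V (H (of_word V [c])) (H (of_word V w))"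
        if "pro_endo V H" for H
        using of_word_append[of "[c]" w V] False pro_endoD(3)[OF that] by simp
      with F G Cons.IH[OF False] gen[of c] show ?thesis
        by (simp add: Omega_mult_apply s)
    qed (simp add: gen)
  qed simp
  have uF: "unif V V (words_cl V free_semigroup) F" and f': "f \<in> words_cl V free_semigroup"
    and W: "of_word V ` free_semigroup \<subseteq> Omega V"
    using pro_endoD(1)[OF F] f unfolding words_cl_free by auto
  obtain t where t: "t \<in> congs V" "\<And>f g. f \<in> Omega V \<Longrightarrow> g \<in> Omega V \<Longrightarrow> f t = g t \<Longrightarrow> G f s = G g s"
    using unifD(3)[OF pro_endoD(1)[OF G] s] by meson
  obtain g where g: "g \<in> of_word V ` free_semigroup" "F f s = F g s" "f t = g t"
    using unif_approx[OF V uF W f' s t(1)] by blast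
  then obtain u where u: "u \<noteq> []" "g = of_word V u" by auto
  have "G f s = G g s" using t(2)[of f g] f g(3) u by simp
  with g(2) w[OF u(1)] u(2) show ?thesis by simp
qed

text \<open>At \<open>s\<close>, an endomorphism is determined by the classes of the images of the
  letters. These range over a finite set of functions, so two powers of \<open>F\<close> coincide at
  \<open>s\<close>.\<close>

lemma pro_endo_eventually_periodic:
  assumes V: "directed V" and F: "pro_endo V F" and s: "s \<in> congs V"
  obtains i p where "p \<ge> 1" "\<And>n f. n \<ge> i \<Longrightarrow> f \<in> Omega V \<Longrightarrow> (F ^^ (n + p)) f s = (F ^^ n) f s"
proof -
  define \<rho> where "\<rho> = (\<lambda>n c. (F ^^ n) (of_word V [c]) s)"
  have "\<rho> n \<in> Pi\<^sub>E UNIV (\<lambda>_. quots s)" for n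
    using Omega_apply(1)[OF pro_endoD(2)[OF pro_endo_funpow[OF V F]] s] by (auto simp: \<rho>_def)
  moreover have "finite (Pi\<^sub>E (UNIV :: 'a set) (\<lambda>_. quots s))"
    by (intro finite_PiE) (auto simp: congsD(2)[OF s])
  ultimately have "finite (range \<rho>)"
    by (meson finite_subset image_subsetI)
  then have "\<not> inj \<rho>" using finite_imageD infinite_UNIV_nat by blast
  then obtain j k where "j < k" "\<rho> j = \<rho> k"
    by (metis injI linorder_neq_iff)
  then have "\<And>c. (F ^^ k) (of_word V [c]) s = (F ^^ j) (of_word V [c]) s"
    by (auto simp: \<rho>_def dest: fun_cong)
  then have jk: "(F ^^ k) f s = (F ^^ j) f s" if "f \<in> Omega V" for f
    by (rule pro_endo_agree_gens[OF V pro_endo_funpow[OF V F] pro_endo_funpow[OF V F] s _ that])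
  show ?thesis
  proof
    show "k - j \<ge> 1" using \<open>j < k\<close> by simp
    fix n f assume n: "n \<ge> j" and f: "f \<in> Omega V"
    then have e: "n + (k - j) = k + (n - j)" "n = j + (n - j)" using \<open>j < k\<close> by auto
    \<comment> \<open>The additional iterates are applied to the argument first: agreement at
      \<open>s\<close> need not survive a further application of \<open>F\<close> from
      outside.\<close>
    have "(F ^^ (n + (k - j))) f s = (F ^^ k) ((F ^^ (n - j)) f) s"
      unfolding e(1) funpow_add by simp
    also have "\<dots> = (F ^^ j) ((F ^^ (n - j)) f) s"
      by (rule jk) (rule pro_endoD(2)[OF pro_endo_funpow[OF V F] f])
    also have "\<dots> = (F ^^ n) f s"
      by (subst (2) e(2)) (simp add: funpow_add)
    finally show "(F ^^ (n + (k - j))) f s = (F ^^ n) f s" .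
  qed
qed

text \<open>\<open>fact n\<close> is a multiple of the period as soon as \<open>n\<close> is at
  least the period.\<close>

lemma pro_endo_fact_periodic:
  assumes V: "directed V" and F: "pro_endo V F" and s: "s \<in> congs V"
  obtains N where "\<And>n k f. n \<ge> N \<Longrightarrow> k \<ge> N \<Longrightarrow> f \<in> Omega V \<Longrightarrow> (F ^^ (fact n + k)) f s = (F ^^ k) f s"
proof -
  obtain i p where ip: "p \<ge> 1" "\<And>n f. n \<ge> i \<Longrightarrow> f \<in> Omega V \<Longrightarrow> (F ^^ (n + p)) f s = (F ^^ n) f s"
    using pro_endo_eventually_periodic[OF V F s] by metis
  have mult: "(F ^^ (k + p * m)) f s = (F ^^ k) f s" if "k \<ge> i" "f \<in> Omega V" for k m f
  proof (induction m)
    case (Suc m)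
    have "(F ^^ (k + p * Suc m)) f s = (F ^^ ((k + p * m) + p)) f s" by (simp add: algebra_simps)
    also have "\<dots> = (F ^^ (k + p * m)) f s" using that by (intro ip(2)) auto
    finally show ?case using Suc by simp
  qed simp
  show ?thesis
  proof
    fix n k f assume n: "max i p \<le> n" "max i p \<le> k" and f: "f \<in> Omega V"
    obtain m where "fact n = p * m" using dvd_fact[OF ip(1), of n] n(1) by (auto simp: dvd_def)
    then show "(F ^^ (fact n + k)) f s = (F ^^ k) f s"
      using mult[of k f m] n(2) f by (simp add: add.commute)
  qed
qed

text \<open>The idempotent power computed coordinatewise, as the eventual value along the factorial
  powers. \<open>omega_power_eq_om\<close> identifies it with the limit in the monoid of continuous
  endomorphisms.\<close>

definition om :: "'a::finite pseudovariety \<Rightarrow> ('a pro \<Rightarrow> 'a pro) \<Rightarrow> 'a pro \<Rightarrow> 'a pro" where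
  "om V F f = (\<lambda>s\<in>congs V. THE c. \<forall>\<^sub>F n in sequentially. (F ^^ fact n) f s = c)"

context
  fixes V :: "'a::finite pseudovariety" and F
  assumes V: "directed V" and F: "pro_endo V F"
begin

lemma funpow_in: "f \<in> Omega V \<Longrightarrow> (F ^^ n) f \<in> Omega V"
  by (rule pro_endoD(2)[OF pro_endo_funpow[OF V F]])

lemma om_apply:
  assumes s: "s \<in> congs V"
  obtains N where "\<And>n f. n \<ge> N \<Longrightarrow> f \<in> Omega V \<Longrightarrow> om V F f s = (F ^^ fact n) f s"
    and "\<And>n k f. n \<ge> N \<Longrightarrow> k \<ge> N \<Longrightarrow> f \<in> Omega V \<Longrightarrow> (F ^^ (fact n + k)) f s = (F ^^ k) f s"
proof -
  obtain N where N: "\<And>n k f. n \<ge> N \<Longrightarrow> k \<ge> N \<Longrightarrow> f \<in> Omega V \<Longrightarrow> (F ^^ (fact n + k)) f s = (F ^^ k) f s"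
    using pro_endo_fact_periodic[OF V F s] by metis
  show ?thesis
  proof
    fix n f assume n: "n \<ge> N" and f: "f \<in> Omega V"
    have eq: "(F ^^ fact m) f s = (F ^^ fact n) f s" if m: "m \<ge> N" for m
      using N[OF n _ f, of "fact m"] N[OF m _ f, of "fact n"] fact_ge_self[of m] fact_ge_self[of n] n m
      by (simp add: add.commute)
    have "(THE c. \<forall>\<^sub>F n in sequentially. (F ^^ fact n) f s = c) = (F ^^ fact n) f s"
    proof (rule the_equality)
      show "\<forall>\<^sub>F m in sequentially. (F ^^ fact m) f s = (F ^^ fact n) f s"
        using eq by (auto simp: eventually_sequentially)
      fix c assume "\<forall>\<^sub>F m in sequentially. (F ^^ fact m) f s = c"
      then obtain M where "\<And>m. m \<ge> M \<Longrightarrow> (F ^^ fact m) f s = c" by (auto simp: eventually_sequentially)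
      from this[of "max M N"] eq[of "max M N"] show "c = (F ^^ fact n) f s" by simp
    qed
    with s show "om V F f s = (F ^^ fact n) f s" by (simp add: om_def)
  qed (rule N)
qed

lemma om_in:
  assumes f: "f \<in> Omega V"
  shows "om V F f \<in> Omega V"
proof (rule OmegaI)
  show "om V F f \<in> extensional (congs V)" by (simp add: om_def)
  fix r s assume rs: "r \<in> congs V" "s \<in> congs V" "r \<subseteq> s"
  obtain M where M: "\<And>n. n \<ge> M \<Longrightarrow> om V F f r = (F ^^ fact n) f r"
    using om_apply[OF rs(1)] f by metis
  obtain N where N: "\<And>n. n \<ge> N \<Longrightarrow> om V F f s = (F ^^ fact n) f s"
    using om_apply[OF rs(2)] f by metis
  let ?g = "(F ^^ fact (max M N)) f"
  obtain w where "w \<noteq> []" "?g r = cls r w" using Omega_apply(2)[OF funpow_in[OF f] rs(1)] by blast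
  moreover from this have "?g s = cls s w" using Omega_cls_mono[OF funpow_in[OF f] rs] by blast
  ultimately show "\<exists>w. w \<noteq> [] \<and> om V F f r = cls r w \<and> om V F f s = cls s w"
    using M[of "max M N"] N[of "max M N"] by auto
qed

lemma pro_endo_om: "pro_endo V (om V F)"
  unfolding pro_endo_def unif_def
proof (intro conjI ballI)
  fix s assume s: "s \<in> congs V"
  obtain N where N: "\<And>f. f \<in> Omega V \<Longrightarrow> om V F f s = (F ^^ fact N) f s"
    using om_apply[OF s] by (metis order_refl)
  show "\<exists>r\<in>congs V. \<forall>f\<in>Omega V. \<forall>g\<in>Omega V. f r = g r \<longrightarrow> om V F f s = om V F g s"
    using unifD(3)[OF pro_endoD(1)[OF pro_endo_funpow[OF V F, of "fact N"]] s] N by metis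
next
  fix f g assume fg: "f \<in> Omega V" "g \<in> Omega V"
  show "om V F (Omega_mult V f g) = Omega_mult V (om V F f) (om V F g)"
  proof (rule Omega_eqI)
    fix s assume s: "s \<in> congs V"
    obtain N where N: "\<And>f. f \<in> Omega V \<Longrightarrow> om V F f s = (F ^^ fact N) f s"
      using om_apply[OF s] by (metis order_refl)
    show "om V F (Omega_mult V f g) s = Omega_mult V (om V F f) (om V F g) s"
      using N fg pro_endoD(3)[OF pro_endo_funpow[OF V F, of "fact N"] fg] by (simp add: Omega_mult_apply s)
  qed (use fg om_in in auto)
qed (use om_in in auto)

text \<open>At a given coordinate, \<open>om V F\<close> acts as the identity on the range of a high
  enough power of \<open>F\<close>. Approximation by such ranges suffices, which fits elements known
  only through words that represent them.\<close>

lemma om_fixed_approx: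
  assumes h: "h \<in> Omega V"
    and approx: "\<And>r j. r \<in> congs V \<Longrightarrow> \<exists>f\<in>Omega V. h r = (F ^^ j) f r"
  shows "om V F h = h"
proof (rule Omega_eqI[OF om_in[OF h] h])
  fix s assume s: "s \<in> congs V"
  obtain N where N: "\<And>n f. n \<ge> N \<Longrightarrow> f \<in> Omega V \<Longrightarrow> om V F f s = (F ^^ fact n) f s"
    and N': "\<And>n k f. n \<ge> N \<Longrightarrow> k \<ge> N \<Longrightarrow> f \<in> Omega V \<Longrightarrow> (F ^^ (fact n + k)) f s = (F ^^ k) f s"
    using om_apply[OF s] by metis
  obtain r where r: "r \<in> congs V" "\<And>f g. f \<in> Omega V \<Longrightarrow> g \<in> Omega V \<Longrightarrow> f r = g r \<Longrightarrow> om V F f s = om V F g s"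
    using unifD(3)[OF pro_endoD(1)[OF pro_endo_om] s] by meson
  have rs: "r \<inter> s \<in> congs V" using V r s by (auto simp: directed_def)
  obtain f where f: "f \<in> Omega V" "h (r \<inter> s) = (F ^^ N) f (r \<inter> s)" using approx[OF rs] by blast
  have hr: "h r = (F ^^ N) f r" and hs: "h s = (F ^^ N) f s"
    using Omega_agree_mono[OF h funpow_in[OF f(1)] rs _ _ f(2)] r s by auto
  have "om V F h s = om V F ((F ^^ N) f) s" by (rule r(2)[OF h funpow_in[OF f(1)] hr])
  also have "\<dots> = (F ^^ (fact N + N)) f s"
    using N[OF order_refl funpow_in[OF f(1)]] by (simp add: funpow_add)
  also have "\<dots> = h s" using N'[OF order_refl order_refl f(1)] hs by simp
  finally show "om V F h s = h s" .
qed

lemma om_approx: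
  assumes f: "f \<in> Omega V" and r: "r \<in> congs V"
  shows "\<exists>n\<ge>j. om V F f r = (F ^^ n) f r"
proof -
  obtain N where N: "\<And>n. n \<ge> N \<Longrightarrow> om V F f r = (F ^^ fact n) f r"
    using om_apply[OF r] f by metis
  then show ?thesis
    using fact_ge_self[of "max j N"] by (intro exI[of _ "fact (max j N)"]) auto
qed

lemma om_idem:
  assumes f: "f \<in> Omega V"
  shows "om V F (om V F f) = om V F f"
proof (rule om_fixed_approx[OF om_in[OF f]])
  fix r j assume r: "r \<in> congs V"
  obtain n where n: "n \<ge> j" "om V F f r = (F ^^ n) f r" using om_approx[OF f r] by blast
  then have "n = j + (n - j)" by simp
  then have "(F ^^ n) f = (F ^^ j) ((F ^^ (n - j)) f)" by (metis comp_apply funpow_add)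
  then show "\<exists>g\<in>Omega V. om V F f r = (F ^^ j) g r" using n(2) funpow_in[OF f] by metis
qed

end

text \<open>At one coordinate each idempotent power is an honest power, so the assertion reduces to
  the iterated relation between \<open>F\<close> and \<open>G\<close>; stability of \<open>C\<close>
  keeps the iterates in the domain of \<open>Q\<close>.\<close>

lemma om_intertwine:
  assumes V: "directed V" and W: "directed W" and F: "pro_endo V F" and G: "pro_endo W G"
    and Q: "unif V W C Q" and FC: "\<And>f. f \<in> C \<Longrightarrow> F f \<in> C" and omC: "\<And>f. f \<in> C \<Longrightarrow> om V F f \<in> C"
    and eq: "\<And>f. f \<in> C \<Longrightarrow> Q (F f) = G (Q f)" and f: "f \<in> C"
  shows "Q (om V F f) = om W G (Q f)"
proof (rule Omega_eqI)
  show "Q (om V F f) \<in> Omega W" using unifD(2)[OF Q omC[OF f]] .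
  show "om W G (Q f) \<in> Omega W" using om_in[OF W G unifD(2)[OF Q f]] .
  fix s assume s: "s \<in> congs W"
  obtain r where r: "r \<in> congs V" "\<And>f g. f \<in> C \<Longrightarrow> g \<in> C \<Longrightarrow> f r = g r \<Longrightarrow> Q f s = Q g s"
    using unifD(3)[OF Q s] by meson
  obtain M where M: "\<And>n. n \<ge> M \<Longrightarrow> om V F f r = (F ^^ fact n) f r"
    using om_apply[OF V F r(1)] unifD(1)[OF Q f] by metis
  obtain N where N: "\<And>n. n \<ge> N \<Longrightarrow> om W G (Q f) s = (G ^^ fact n) (Q f) s"
    using om_apply[OF W G s] unifD(2)[OF Q f] by metis
  have iter: "(F ^^ n) f \<in> C \<and> Q ((F ^^ n) f) = (G ^^ n) (Q f)" for n
    by (induction n) (use f FC eq in auto)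
  let ?n = "fact (max M N)"
  have "Q (om V F f) s = Q ((F ^^ ?n) f) s"
    by (rule r(2)[OF omC[OF f]]) (use iter M in auto)
  then show "Q (om V F f) s = om W G (Q f) s" using iter N[of "max M N"] by simp
qed

section \<open>Profinite groups and their presentations\<close>

abbreviation FG :: "'a::finite pro set" where
  "FG \<equiv> Omega all_groups"

lemma unif_mult_left: "a \<in> Omega V \<Longrightarrow> C \<subseteq> Omega V \<Longrightarrow> unif V V C (Omega_mult V a)"
  by (rule unifI_same) (auto simp: Omega_mult_apply)

lemma unif_mult_right: "a \<in> Omega V \<Longrightarrow> C \<subseteq> Omega V \<Longrightarrow> unif V V C (\<lambda>f. Omega_mult V f a)"
  by (rule unifI_same) (auto simp: Omega_mult_apply)

text \<open>Translations are uniformly continuous, so by \<open>unif_solve\<close> the two equations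
  that characterize a group need to be solved only at each coordinate separately.\<close>

lemma is_group_closed:
  assumes V: "directed V" and K: "K \<subseteq> Omega V" "cl V K = K" "K \<noteq> {}" and sg: "semigroup_on K (Omega_mult V)"
    and l: "\<And>s a b. s \<in> congs V \<Longrightarrow> a \<in> K \<Longrightarrow> b \<in> K \<Longrightarrow> \<exists>x\<in>K. Omega_mult V a x s = b s"
    and r: "\<And>s a b. s \<in> congs V \<Longrightarrow> a \<in> K \<Longrightarrow> b \<in> K \<Longrightarrow> \<exists>x\<in>K. Omega_mult V x a s = b s"
  shows "is_group K (Omega_mult V)"
proof (rule is_groupI[OF sg K(3)])
  fix a b assume ab: "a \<in> K" "b \<in> K"
  then have abO: "a \<in> Omega V" "b \<in> Omega V" using K(1) by auto
  show "\<exists>x\<in>K. Omega_mult V a x = b"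
    using unif_solve[OF V V _ K(1) abO(2), of "Omega_mult V a"] unif_mult_left[OF abO(1) K(1)] l[OF _ ab]
    unfolding K(2) by blast
  show "\<exists>x\<in>K. Omega_mult V x a = b"
    using unif_solve[OF V V _ K(1) abO(2), of "\<lambda>x. Omega_mult V x a"] unif_mult_right[OF abO(1) K(1)] r[OF _ ab]
    unfolding K(2) by blast
qed

lemma cl_Omega: "cl V (Omega V) = Omega V"
  using subset_cl[of "Omega V" V] cl_subset_Omega by blast

lemma is_group_free_pg: "is_group FG (Omega_mult all_groups)"
proof (rule is_group_closed[OF directed_all_groups order_refl cl_Omega _ semigroup_on_Omega])
  show "FG \<noteq> ({} :: 'a pro set)" using of_word_in_Omega[of "[undefined]"] by blast
next
  fix s :: "('a list \<times> 'a list) set" and a b :: "'a pro"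
  assume s: "s \<in> congs all_groups" and ab: "a \<in> FG" "b \<in> FG"
  then have gr: "is_group (quots s) (cmult s)"
    by (simp add: congs_def all_groups_def)
  have word: "\<exists>x\<in>FG. x s = U" if "U \<in> quots s" for U
    using quotient_cls[OF that] of_word_apply[OF s] of_word_in_Omega by metis
  have "a s \<in> quots s" "b s \<in> quots s" using Omega_apply(1) ab s by auto
  from is_group_solvable[OF gr this]
  show "\<exists>x\<in>FG. Omega_mult all_groups a x s = b s"
    "\<exists>x\<in>FG. Omega_mult all_groups x a s = b s"
    using word by (metis Omega_mult_apply s)+
qed

lemma group_free_pg: "group free_pg"
  using is_group_free_pg by (simp add: free_pg_def is_group_def)

lemma carrier_free_pg [simp]: "carrier free_pg = FG"
  and mult_free_pg [simp]: "mult free_pg = Omega_mult all_groups"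
  by (simp_all add: free_pg_def as_group_def)

lemma carrier_as_group [simp]: "carrier (as_group X m) = X"
  and mult_as_group [simp]: "mult (as_group X m) = m"
  by (simp_all add: as_group_def)

text \<open>Inverses taken in \<open>K\<close> cancel at the coordinate \<open>s\<close>, which
  gives the cancellation criterion of \<open>congs_all_groups\<close>. The group may lie in any
  \<open>Omega W\<close>, in particular in the free profinite semigroup.\<close>

lemma ker_cong_in_groups:
  fixes \<theta> :: "'a::finite \<Rightarrow> 'b::finite pro"
  assumes K: "K \<subseteq> Omega W" and gr: "is_group K (Omega_mult W)" and \<theta>: "\<And>c. \<theta> c \<in> K"
    and s: "s \<in> congs W"
  shows "ker_cong (\<lambda>w. word_prod (Omega_mult W) \<theta> w s) \<in> congs all_groups"
proof -
  obtain e where sg: "semigroup_on K (Omega_mult W)"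
    and e: "\<And>u. u \<in> K \<Longrightarrow> Omega_mult W e u = u" "\<And>u. u \<in> K \<Longrightarrow> Omega_mult W u e = u"
      "\<And>u. u \<in> K \<Longrightarrow> \<exists>v\<in>K. Omega_mult W u v = e \<and> Omega_mult W v u = e"
    using gr by (rule is_groupE) (rule that; assumption)
  let ?m = "word_prod (Omega_mult W) \<theta>"
  have mK: "?m w \<in> K" if "w \<noteq> []" for w using word_prod_in[OF sg \<theta> that] .
  have c: "?m v s = ?m w s"
    if ne: "u \<noteq> []" "v \<noteq> []" "w \<noteq> []" and eq: "?m (u @ v) s = ?m (u @ w) s \<or> ?m (v @ u) s = ?m (w @ u) s" for u v w
  proof -
    obtain i where i: "i \<in> K" "Omega_mult W (?m u) i = e" "Omega_mult W i (?m u) = e"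
      using e(3)[OF mK[OF ne(1)]] by blast
    have l: "Omega_mult W i (?m (u @ x)) = ?m x" "Omega_mult W (?m (x @ u)) i = ?m x" if "x \<noteq> []" for x
      using semigroup_onD(2)[OF sg i(1) mK[OF ne(1)] mK[OF that]]
        semigroup_onD(2)[OF sg mK[OF that] mK[OF ne(1)] i(1)] i e mK[OF that]
      by (simp_all add: word_prod_append[OF sg \<theta>] that ne)
    show ?thesis
      using eq Omega_mult_agree[OF s, of i i "?m (u @ v)" "?m (u @ w)"]
        Omega_mult_agree[OF s, of "?m (v @ u)" "?m (w @ u)" i i] l[OF ne(2)] l[OF ne(3)] by auto
  qed
  have "\<forall>u v w. u \<noteq> [] \<longrightarrow> v \<noteq> [] \<longrightarrow> w \<noteq> [] \<longrightarrow> ((u @ v, u @ w) \<in> ker_cong (\<lambda>w. ?m w s)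
      \<or> (v @ u, w @ u) \<in> ker_cong (\<lambda>w. ?m w s)) \<longrightarrow> (v, w) \<in> ker_cong (\<lambda>w. ?m w s)"
  proof (intro allI impI)
    fix u v w :: "'a list" assume ne: "u \<noteq> []" "v \<noteq> []" "w \<noteq> []"
      and "(u @ v, u @ w) \<in> ker_cong (\<lambda>w. ?m w s) \<or> (v @ u, w @ u) \<in> ker_cong (\<lambda>w. ?m w s)"
    then have "?m (u @ v) s = ?m (u @ w) s \<or> ?m (v @ u) s = ?m (w @ u) s" by (simp add: ker_cong_def)
    from c[OF ne this] show "(v, w) \<in> ker_cong (\<lambda>w. ?m w s)" using ne by (simp add: ker_cong_def)
  qed
  then show ?thesis
    unfolding congs_all_groups using word_cong_ker_word_prod[OF K sg \<theta> s] by (intro conjI)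
qed

lemma free_pg_hom_extension:
  fixes \<theta> :: "'a::finite \<Rightarrow> 'b::finite pro"
  assumes K: "K \<subseteq> Omega W" and gr: "is_group K (Omega_mult W)" and \<theta>: "\<And>c. \<theta> c \<in> K"
  obtains F where "unif all_groups W FG F" "\<And>f. f \<in> FG \<Longrightarrow> F f \<in> cl W K"
    "\<And>f g. f \<in> FG \<Longrightarrow> g \<in> FG \<Longrightarrow>
       F (Omega_mult all_groups f g) = Omega_mult W (F f) (F g)"
    "\<And>c. F (pg_gen c) = \<theta> c"
proof -
  have sg: "semigroup_on K (Omega_mult W)" using gr by (rule is_groupE)
  have "\<forall>s\<in>congs W. ker_cong (\<lambda>w. word_prod (Omega_mult W) \<theta> w s) \<in> congs all_groups"
    by (intro ballI ker_cong_in_groups[OF K gr \<theta>])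
  from hom_extension[OF directed_all_groups K sg \<theta> this, folded pg_gen_def]
  show ?thesis by (elim exE conjE) (rule that, assumption, simp_all)
qed

lemma pg_gen_in [simp]: "pg_gen c \<in> FG"
  by (simp add: pg_gen_def)

text \<open>Words in the generators alone are dense in the free profinite group, so a closed
  property needs no case for inverses.\<close>

lemma free_pg_induct:
  assumes cl: "closedin free_pg_top {f \<in> FG. P f}" and gen: "\<And>c. P (pg_gen c)"
    and mult: "\<And>f g. f \<in> FG \<Longrightarrow> g \<in> FG \<Longrightarrow> P f \<Longrightarrow> P g \<Longrightarrow> P (Omega_mult all_groups f g)"
    and f: "f \<in> FG"
  shows "P f"
proof -
  have "P (of_word all_groups w)" if "w \<noteq> []" for w
    using that
  proof (induction w)
    case (Cons c w)
    show ?case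
    proof (cases "w = []")
      case True
      then show ?thesis using gen by (simp add: pg_gen_def)
    next
      case False
      then show ?thesis
        using mult[OF pg_gen_in of_word_in_Omega gen Cons.IH] of_word_append[of "[c]" w all_groups]
        by (simp add: pg_gen_def)
    qed
  qed simp
  then have "P g" if "g \<in> of_word all_groups ` free_semigroup" for g using that by auto
  moreover have "f \<in> free_pg_top closure_of (of_word all_groups ` free_semigroup)"
    using f by (subst closure_of_Omega_top[OF directed_all_groups]) (auto simp: words_cl_free)
  ultimately show ?thesis using forall_in_closure_of[of f free_pg_top _ P] cl by simp
qed

lemma cont_endos_eqI:
  assumes f: "f \<in> cont_endos free_pg free_pg_top" and g: "g \<in> cont_endos free_pg free_pg_top"
    and gen: "\<And>c. f (pg_gen c) = g (pg_gen c)"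
  shows "f = g"
proof (rule extensionalityI)
  show "f \<in> extensional FG" "g \<in> extensional FG"
    using f g by (auto simp: cont_endos_def)
  have "closedin free_pg_top {u \<in> FG. f u = g u}"
    using closedin_continuous_maps_eq[OF Hausdorff_Omega_top, of free_pg_top all_groups f g] f g
    by (auto simp: cont_endos_def)
  then show "f u = g u" if "u \<in> FG" for u
    by (rule free_pg_induct[where P = "\<lambda>u. f u = g u"])
       (use f g gen that in \<open>auto simp: cont_endos_def hom_def\<close>)
qed

lemma unif_continuous_Omega:
  "directed V \<Longrightarrow> directed W \<Longrightarrow> unif V W (Omega V) F \<Longrightarrow> continuous_map (Omega_top V) (Omega_top W) F"
  using unif_continuous[of V W "Omega V" F] subtopology_topspace[of "Omega_top V"] by simp

lemma pro_endo_cont_endos: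
  fixes F :: "'a::finite pro \<Rightarrow> 'a pro"
  assumes F: "pro_endo all_groups F"
  shows "restrict F FG \<in> cont_endos free_pg free_pg_top"
proof -
  have "continuous_map free_pg_top free_pg_top F"
    by (rule unif_continuous_Omega[OF directed_all_groups directed_all_groups pro_endoD(1)[OF F]])
  then have "continuous_map free_pg_top free_pg_top (restrict F FG)"
    by (rule continuous_map_eq) auto
  then show ?thesis
    using pro_endoD(2,3)[OF F] by (auto simp: cont_endos_def hom_def)
qed

lemma pro_endo_restrict:
  assumes "pro_endo V F"
  shows "pro_endo V (restrict F (Omega V))"
proof -
  have "unif V V (Omega V) (restrict F (Omega V))"
    using pro_endoD(1)[OF assms] unfolding unif_def by simp
  then show ?thesis using pro_endoD(2,3)[OF assms] by (simp add: pro_endo_def)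
qed

text \<open>At every coordinate the factorial powers are eventually constant, which yields pointwise
  convergence to \<open>om\<close>; the Hausdorff property makes this the limit selected by
  \<open>THE\<close>.\<close>

lemma omega_power_eq_om:
  fixes F :: "'a::finite pro \<Rightarrow> 'a pro"
  assumes F: "pro_endo all_groups F"
  shows "omega_power free_pg free_pg_top F = restrict (om all_groups F) FG"
proof -
  let ?\<Omega> = "Omega (all_groups :: 'a pseudovariety)"
  note V = directed_all_groups
  let ?E = "cont_endos (free_pg :: 'a pro monoid) free_pg_top"
  let ?f = "\<lambda>n. restrict (F ^^ fact n) ?\<Omega>" and ?g = "restrict (om all_groups F) ?\<Omega>"
  have fE: "?f n \<in> ?E" for n by (rule pro_endo_cont_endos[OF pro_endo_funpow[OF V F]])
  have gE: "?g \<in> ?E" by (rule pro_endo_cont_endos[OF pro_endo_om[OF V F]])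
  have pt: "limitin (free_pg_top) (\<lambda>n. ?f n u) (?g u) sequentially" if u: "u \<in> ?\<Omega>" for u
    unfolding limitin_sequentially
  proof (intro conjI allI impI)
    show "?g u \<in> topspace free_pg_top" using om_in[OF V F u] u by simp
    fix U assume "openin free_pg_top U \<and> ?g u \<in> U"
    then obtain r where r: "r \<in> congs all_groups" "\<And>g. g \<in> ?\<Omega> \<Longrightarrow> g r = ?g u r \<Longrightarrow> g \<in> U"
      using openin_Omega_top[OF V] by meson
    obtain N where "\<And>n. n \<ge> N \<Longrightarrow> om all_groups F u r = (F ^^ fact n) u r"
      using om_apply[OF V F r(1)] u by metis
    then show "\<exists>N. \<forall>n\<ge>N. ?f n u \<in> U"
      using r(2) funpow_in[OF V F u] u by (intro exI[of _ N]) auto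
  qed
  have lim: "limitin (cont_endos_top free_pg free_pg_top) ?f ?g sequentially"
    unfolding cont_endos_top_def limitin_subtopology limitin_componentwise
    using fE gE pt funpow_in[OF V F] by (auto intro!: always_eventually)
  have H: "Hausdorff_space (cont_endos_top (free_pg :: 'a pro monoid) free_pg_top)"
    unfolding cont_endos_top_def
    by (simp add: Hausdorff_space_subtopology Hausdorff_space_product_topology Hausdorff_Omega_top)
  show ?thesis
    unfolding omega_power_def carrier_free_pg
    by (rule the_equality[of "\<lambda>g. limitin (cont_endos_top free_pg free_pg_top) ?f g sequentially", OF lim])
       (rule limitin_Hausdorff_unique[OF _ lim trivial_limit_sequentially H])
qed

text \<open>The first isomorphism theorem for compact groups: a continuous surjection from a compact
  space onto a Hausdorff space is closed, hence a quotient map, so the induced bijection is a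
  homeomorphism.\<close>

lemma admits_presentationI:
  fixes F :: "'a::finite pro \<Rightarrow> 'b::finite pro"
  assumes W: "directed W" and F: "unif all_groups W FG F"
    and hom: "\<And>f g. f \<in> FG \<Longrightarrow> g \<in> FG \<Longrightarrow>
       F (Omega_mult all_groups f g) = Omega_mult W (F f) (F g)"
    and ran: "F ` FG = H"
    and ker: "closed_congruence_generated free_pg free_pg_top R
       = {(u, v). u \<in> FG \<and> v \<in> FG \<and> F u = F v}"
  shows "admits_presentation (as_group H (Omega_mult W)) (subtopology (Omega_top W) H) R"
proof -
  let ?\<Omega> = "Omega (all_groups :: 'a pseudovariety)" and ?T = "Omega_top (all_groups :: 'a pseudovariety)"
  define r where "r = {(u, v). u \<in> ?\<Omega> \<and> v \<in> ?\<Omega> \<and> F u = F v}"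
  have HO: "H \<subseteq> Omega W" using ran unifD(2)[OF F] by blast
  have eq: "equiv ?\<Omega> r"
    by (intro equivI) (auto simp: r_def refl_on_def sym_def trans_def)
  define h where "h = (\<lambda>U. F (SOME u. u \<in> U))"
  have cls: "r `` {u} = {v \<in> ?\<Omega>. F v = F u}" if "u \<in> ?\<Omega>" for u using that by (auto simp: r_def)
  have h: "h (r `` {u}) = F u" if u: "u \<in> ?\<Omega>" for u
    unfolding h_def cls[OF u] by (rule someI2[of _ u]) (use u in auto)
  have q: "\<exists>u\<in>?\<Omega>. U = r `` {u}" if "U \<in> ?\<Omega> // r" for U using that by (auto simp: quotient_def)
  have bij: "bij_betw h (?\<Omega> // r) H"
    unfolding bij_betw_def
  proof
    show "inj_on h (?\<Omega> // r)"
    proof (rule inj_onI)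
      fix U V assume UV: "U \<in> ?\<Omega> // r" "V \<in> ?\<Omega> // r" "h U = h V"
      obtain u v where uv: "u \<in> ?\<Omega>" "U = r `` {u}" "v \<in> ?\<Omega>" "V = r `` {v}" using q UV by meson
      then have "F u = F v" using UV(3) by (simp only: h)
      then show "U = V" using uv by (simp add: cls)
    qed
    have "h ` (?\<Omega> // r) = (\<lambda>u. h (r `` {u})) ` ?\<Omega>" by (auto simp: quotient_def)
    also have "\<dots> = H" unfolding ran[symmetric] using h by (intro image_cong) auto
    finally show "h ` (?\<Omega> // r) = H" .
  qed
  have mult: "quot_mult (Omega_mult all_groups) r (r `` {u}) (r `` {v}) = r `` {Omega_mult all_groups u v}"
    if "u \<in> ?\<Omega>" "v \<in> ?\<Omega>" for u v
  proof -
    have "{Omega_mult all_groups u' v' |u' v'. u' \<in> r `` {u} \<and> v' \<in> r `` {v}} \<subseteq> r `` {Omega_mult all_groups u v}"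
      using that by (auto simp: cls hom)
    moreover have "Omega_mult all_groups u v \<in> {Omega_mult all_groups u' v' |u' v'. u' \<in> r `` {u} \<and> v' \<in> r `` {v}}"
      using that by (auto simp: cls)
    moreover have "r `` (r `` {w}) = r `` {w}" if "w \<in> ?\<Omega>" for w
      using that by (auto simp: r_def)
    moreover have "r `` {Omega_mult all_groups u v} \<subseteq> r `` S"
      if "Omega_mult all_groups u v \<in> S" for S using that by blast
    moreover have "r `` S \<subseteq> r `` (r `` {Omega_mult all_groups u v})"
      if "S \<subseteq> r `` {Omega_mult all_groups u v}" for S using that by (rule Image_mono[OF order_refl])
    ultimately show ?thesis
      unfolding quot_mult_def using Omega_mult_in_Omega[OF that] by (metis (no_types, lifting) subset_antisym)
  qed
  have pres: "presented_pg R = as_group (?\<Omega> // r) (quot_mult (Omega_mult all_groups) r)"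
    unfolding presented_pg_def Let_def ker by (simp add: r_def)
  have ptop: "presented_pg_top R = quot_top ?T r"
    unfolding presented_pg_top_def ker by (simp add: r_def)
  have "h \<in> iso (presented_pg R) (as_group H (Omega_mult W))"
    unfolding iso_def hom_def pres
  proof (clarsimp simp: bij, intro conjI ballI)
    show "h \<in> ?\<Omega> // r \<rightarrow> H" using bij by (auto simp: bij_betw_def)
    fix U V assume UV: "U \<in> ?\<Omega> // r" "V \<in> ?\<Omega> // r"
    obtain u v where "u \<in> ?\<Omega>" "U = r `` {u}" "v \<in> ?\<Omega>" "V = r `` {v}" using q UV by meson
    then show "h (quot_mult (Omega_mult all_groups) r U V) = Omega_mult W (h U) (h V)"
      by (simp only: mult h hom Omega_mult_in_Omega)
  qed
  moreover have "homeomorphic_map (presented_pg_top R) (subtopology (Omega_top W) H) h"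
  proof -
    have oq: "openin (quot_top ?T r) \<U> \<longleftrightarrow> \<U> \<subseteq> ?\<Omega> // r \<and> openin ?T (\<Union>\<U>)" for \<U>
      using openin_quot_top[of ?T r] eq by simp
    have U: "\<Union>(?\<Omega> // r) = ?\<Omega>" by (rule Union_quotient[OF eq])
    have top: "topspace (quot_top ?T r) = ?\<Omega> // r"
    proof (intro equalityI)
      show "topspace (quot_top ?T r) \<subseteq> ?\<Omega> // r"
        using openin_topspace[of "quot_top ?T r"] oq by blast
      show "?\<Omega> // r \<subseteq> topspace (quot_top ?T r)"
        by (rule openin_subset) (use oq U openin_topspace[of ?T] in simp)
    qed
    have topH: "topspace (subtopology (Omega_top W) H) = H" using HO by auto
    have cont: "continuous_map ?T (subtopology (Omega_top W) H) F"
      by (rule continuous_map_into_subtopology[OF unif_continuous_Omega[OF directed_all_groups W F]])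
         (use ran in auto)
    have "closed_map ?T (subtopology (Omega_top W) H) F"
      by (rule continuous_imp_closed_map_gen[OF compact_Omega_top _ cont])
         (intro Hausdorff_imp_kc_space Hausdorff_space_subtopology Hausdorff_Omega_top)
    then have qF: "quotient_map ?T (subtopology (Omega_top W) H) F"
      using cont ran topH by (intro continuous_closed_imp_quotient_map) auto
    have "openin (quot_top ?T r) {U \<in> ?\<Omega> // r. h U \<in> N} \<longleftrightarrow> openin (subtopology (Omega_top W) H) N"
      if "N \<subseteq> H" for N
    proof -
      have "\<Union>{U \<in> ?\<Omega> // r. h U \<in> N} = {u \<in> ?\<Omega>. F u \<in> N}"
      proof (intro equalityI subsetI)
        fix u assume "u \<in> \<Union>{U \<in> ?\<Omega> // r. h U \<in> N}"
        then obtain U where U: "U \<in> ?\<Omega> // r" "h U \<in> N" "u \<in> U" by blast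
        obtain v where v: "v \<in> ?\<Omega>" "U = r `` {v}" using q[OF U(1)] by blast
        then have "F v \<in> N" using U(2) by (simp only: h)
        then show "u \<in> {u \<in> ?\<Omega>. F u \<in> N}" using U(3) v by (simp add: cls)
      next
        fix u assume "u \<in> {u \<in> ?\<Omega>. F u \<in> N}"
        then have u: "u \<in> ?\<Omega>" "h (r `` {u}) \<in> N" by (auto simp only: h)
        moreover have "u \<in> r `` {u}" using u(1) by (simp add: cls)
        ultimately show "u \<in> \<Union>{U \<in> ?\<Omega> // r. h U \<in> N}" using quotientI[OF u(1), of r] by blast
      qed
      then show ?thesis
        using qF that unfolding oq quotient_map_def topH by auto
    qed
    then have "quotient_map (quot_top ?T r) (subtopology (Omega_top W) H) h"
      using bij unfolding quotient_map_def topH top bij_betw_def by blast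
    then show ?thesis
      unfolding homeomorphic_map_def ptop top using bij by (simp add: bij_betw_def)
  qed
  ultimately show ?thesis
    unfolding admits_presentation_def by blast
qed

text \<open>\<open>P\<close> is a retraction of the free profinite group whose range \<open>F\<close> maps isomorphically to a copy.\<close>

lemma closed_congruence_generated_retract:
  fixes F :: "'a::finite pro \<Rightarrow> 'b::finite pro"
  assumes W: "directed W" and F: "unif all_groups W FG F"
    and hom: "\<And>f g. f \<in> FG \<Longrightarrow> g \<in> FG \<Longrightarrow>
       F (Omega_mult all_groups f g) = Omega_mult W (F f) (F g)"
    and P: "pro_endo all_groups P"
    and FP: "\<And>u. u \<in> FG \<Longrightarrow> F (P u) = F u"
    and PF: "\<And>u v. u \<in> FG \<Longrightarrow> v \<in> FG \<Longrightarrow> F u = F v \<Longrightarrow> P u = P v"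
  shows "closed_congruence_generated free_pg free_pg_top (range (\<lambda>c. (P (pg_gen c), pg_gen c)))
       = {(u, v). u \<in> FG \<and> v \<in> FG \<and> F u = F v}"
proof -
  let ?\<Omega> = "Omega (all_groups :: 'a pseudovariety)" and ?T = "Omega_top (all_groups :: 'a pseudovariety)"
  let ?R = "range (\<lambda>c. (P (pg_gen c), pg_gen c))"
  let ?k = "{(u, v). u \<in> ?\<Omega> \<and> v \<in> ?\<Omega> \<and> F u = F v}"
  note V = directed_all_groups
  have cF: "continuous_map ?T (Omega_top W) F" by (rule unif_continuous_Omega[OF V W F])
  have cP: "continuous_map ?T ?T P" by (rule unif_continuous_Omega[OF V V pro_endoD(1)[OF P]])
  have "congruence ?\<Omega> (Omega_mult all_groups) ?k"
    unfolding congruence_def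
  proof
    show "equiv ?\<Omega> ?k" by (intro equivI) (auto simp: refl_on_def sym_def trans_def)
  qed (auto simp: hom)
  moreover have "closedin (prod_topology ?T ?T) ?k"
  proof -
    have "continuous_map (prod_topology ?T ?T) (Omega_top W) (\<lambda>p. F (fst p))"
      "continuous_map (prod_topology ?T ?T) (Omega_top W) (\<lambda>p. F (snd p))"
      using continuous_map_compose[OF continuous_map_fst cF] continuous_map_compose[OF continuous_map_snd cF]
      by (simp_all add: comp_def)
    from closedin_continuous_maps_eq[OF Hausdorff_Omega_top this]
    have "closedin (prod_topology ?T ?T) {x \<in> ?\<Omega> \<times> ?\<Omega>. F (fst x) = F (snd x)}" by simp
    moreover have "{x \<in> ?\<Omega> \<times> ?\<Omega>. F (fst x) = F (snd x)} = ?k" by auto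
    ultimately show ?thesis by simp
  qed
  moreover have "?R \<subseteq> ?k" using FP pro_endoD(2)[OF P] by auto
  moreover have "?k \<subseteq> r"
    if r: "congruence ?\<Omega> (Omega_mult all_groups) r" "closedin (prod_topology ?T ?T) r" "?R \<subseteq> r" for r
  proof -
    have e: "equiv ?\<Omega> r" using r(1) by (simp add: congruence_def)
    \<comment> \<open>The set of all \<open>u\<close> with \<open>(P u, u) \<in> r\<close> is
      closed, contains the generators and is closed under products, so it is everything. A pair in
      the kernel is then linked by \<open>u\<close>, \<open>P u = P v\<close>,
      \<open>v\<close>.\<close>
    have "continuous_map ?T (prod_topology ?T ?T) (\<lambda>u. (P u, u))"
      using cP by (intro continuous_map_pairedI) auto
    from closedin_continuous_map_preimage[OF this r(2)]
    have cl: "closedin ?T {u \<in> ?\<Omega>. (P u, u) \<in> r}" by simp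
    have Pr: "(P u, u) \<in> r" if "u \<in> ?\<Omega>" for u
    proof (rule free_pg_induct[OF cl _ _ that])
      show "(P (pg_gen c), pg_gen c) \<in> r" for c using r(3) by auto
      fix f g assume fg: "f \<in> ?\<Omega>" "g \<in> ?\<Omega>" "(P f, f) \<in> r" "(P g, g) \<in> r"
      have "(Omega_mult all_groups (P f) (P g), Omega_mult all_groups f g) \<in> r"
        using r(1) fg(3,4) unfolding congruence_def by blast
      then show "(P (Omega_mult all_groups f g), Omega_mult all_groups f g) \<in> r"
        by (simp add: pro_endoD(3)[OF P fg(1,2)])
    qed
    have sym: "sym r" and tr: "trans r" using e by (auto simp: equiv_def)
    show ?thesis
    proof clarify
      fix u v assume uv: "u \<in> ?\<Omega>" "v \<in> ?\<Omega>" "F u = F v"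
      have "(u, P u) \<in> r" using Pr[OF uv(1)] sym by (meson symD)
      moreover have "(P u, v) \<in> r" using Pr[OF uv(2)] PF[OF uv] by simp
      ultimately show "(u, v) \<in> r" using tr by (meson transD)
    qed
  qed
  ultimately show ?thesis
    unfolding closed_congruence_generated_def carrier_free_pg mult_free_pg
    by (intro equalityI Inter_lower Inter_greatest) auto
qed

section \<open>Words of the Thue-Morse substitution\<close>

lemma tau_Nil [simp]: "tau [] = []"
  and tau_Cons [simp]: "tau (c # w) = tau_letter c @ tau w"
  and tau_append [simp]: "tau (u @ v) = tau u @ tau v"
  by (simp_all add: tau_def)

lemma tau_eq_Nil [simp]: "tau w = [] \<longleftrightarrow> w = []"
  by (cases w) (auto, metis tau_letter.elims list.distinct(1))

lemma length_tau [simp]: "length (tau w) = 2 * length w"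
proof (induction w)
  case (Cons c w)
  then show ?case by (cases c) auto
qed simp

lemma taun_append [simp]: "(tau ^^ n) (u @ v) = (tau ^^ n) u @ (tau ^^ n) v"
  by (induction n) auto

lemma taun_Nil [simp]: "(tau ^^ n) [] = []"
  by (induction n) auto

lemma taun_eq_Nil [simp]: "(tau ^^ n) w = [] \<longleftrightarrow> w = []"
  by (induction n) auto

lemma length_taun [simp]: "length ((tau ^^ n) w) = 2 ^ n * length w"
  by (induction n) auto

lemma taun_add: "(tau ^^ (m + n)) w = (tau ^^ m) ((tau ^^ n) w)"
  by (simp add: funpow_add)

lemma tau_nth_pair: "i < length w \<Longrightarrow> tau w ! (2 * i) \<noteq> tau w ! Suc (2 * i)"
proof (induction w arbitrary: i)
  case (Cons c w)
  show ?case
  proof (cases i)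
    case 0
    then show ?thesis by (cases c) auto
  next
    case (Suc j)
    then have "tau w ! (2 * j) \<noteq> tau w ! Suc (2 * j)" using Cons by simp
    then show ?thesis using Suc by (cases c) auto
  qed
qed simp

lemma tau_inj: "tau u = tau v \<Longrightarrow> u = v"
proof (induction u arbitrary: v)
  case Nil
  then show ?case by (metis tau_Nil tau_eq_Nil)
next
  case (Cons c u)
  then obtain d v' where "v = d # v'" by (metis list.exhaust list.distinct(1) tau_eq_Nil)
  with Cons show ?case by (cases c; cases d) auto
qed

lemma tau_split:
  assumes "tau t = P @ Q" "even (length P)"
  shows "\<exists>t1 t2. t = t1 @ t2 \<and> P = tau t1 \<and> Q = tau t2"
proof -
  obtain m where m: "length P = 2 * m" using assms(2) by blast
  have "2 * length t = length P + length Q" using arg_cong[OF assms(1), of length] by simp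
  then have "m \<le> length t" using m by linarith
  have "tau (take m t) @ tau (drop m t) = P @ Q"
    by (metis assms(1) append_take_drop_id tau_append)
  moreover have "length (tau (take m t)) = length P" using m \<open>m \<le> length t\<close> by simp
  ultimately show ?thesis
    by (metis append_eq_append_conv append_take_drop_id)
qed

text \<open>A square of a letter in \<open>tau t\<close> straddles two blocks; this fixes the parity of the
  occurrences of the images of words that are not powers of a letter.\<close>

definition alternates :: "ab list \<Rightarrow> bool" where
  "alternates v \<longleftrightarrow> (\<exists>v1 c d v2. v = v1 @ [c, d] @ v2 \<and> c \<noteq> d)"

lemma alternates_tau: "v \<noteq> [] \<Longrightarrow> alternates (tau v)"
proof -
  assume "v \<noteq> []"
  then obtain c w where v: "v = c # w" by (cases v) auto
  obtain d where "tau_letter c = [c, d]" "c \<noteq> d" by (cases c) auto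
  then show ?thesis
    unfolding alternates_def v by (intro exI[of _ "[]"] exI[of _ c] exI[of _ d] exI[of _ "tau w"]) simp
qed

lemma tau_sync:
  assumes eq: "tau t = P @ tau v @ Q" and v: "alternates v"
  shows "\<exists>t1 t2. t = t1 @ v @ t2 \<and> P = tau t1 \<and> Q = tau t2"
proof -
  obtain v1 c d v2 where vd: "v = v1 @ [c, d] @ v2" "c \<noteq> d" using v by (auto simp: alternates_def)
  have "tau v = tau v1 @ [c, d, d, c] @ tau v2"
    using vd by (cases c; cases d) auto
  then have t: "tau t = (P @ tau v1 @ [c]) @ d # d # (c # tau v2 @ Q)" using eq by simp
  \<comment> \<open>The position of the first letter of the square \<open>d d\<close>. If
    \<open>length P\<close> were odd, this position would be even and the square would be a block of
    \<open>tau t\<close>.\<close>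
  let ?n = "length P + 2 * length v1 + 1"
  have nn: "tau t ! ?n = d" "tau t ! Suc ?n = d"
    unfolding t by (simp_all add: nth_append)
  have "even (length P)"
  proof (rule ccontr)
    assume "odd (length P)"
    then obtain i where i: "?n = 2 * i" by (metis even_add even_mult_iff even_numeral evenE odd_one)
    have "Suc ?n < length (tau t)" unfolding t by simp
    then have "i < length t" using i by simp
    with tau_nth_pair[OF this] nn i show False by metis
  qed
  then obtain t1 t2 where t12: "t = t1 @ t2" "P = tau t1" "tau v @ Q = tau t2"
    using tau_split[OF eq] by blast
  then obtain t3 t4 where "t2 = t3 @ t4" "tau v = tau t3" "Q = tau t4"
    using tau_split[of t2 "tau v" Q] by auto
  then show ?thesis using t12 tau_inj by blast
qed

lemma alternates_taun: "alternates v \<Longrightarrow> alternates ((tau ^^ n) v)"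
proof -
  assume v: "alternates v"
  then have "v \<noteq> []" by (auto simp: alternates_def)
  with v show ?thesis by (cases n) (simp_all add: alternates_tau)
qed

text \<open>The outermost \<open>tau\<close> is peeled off; by \<open>alternates_taun\<close> the
  inner image of \<open>v\<close> still fixes the parity of its occurrences.\<close>

lemma taun_sync:
  assumes "(tau ^^ n) t = P @ (tau ^^ n) v @ Q" "alternates v"
  shows "\<exists>t1 t2. t = t1 @ v @ t2 \<and> P = (tau ^^ n) t1 \<and> Q = (tau ^^ n) t2"
  using assms(1)
proof (induction n arbitrary: P Q)
  case (Suc n)
  then have "tau ((tau ^^ n) t) = P @ tau ((tau ^^ n) v) @ Q" by simp
  from tau_sync[OF this alternates_taun[OF assms(2)]] obtain P' Q' where
    "(tau ^^ n) t = P' @ (tau ^^ n) v @ Q'" "P = tau P'" "Q = tau Q'" by blast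
  with Suc.IH show ?case by fastforce
qed simp

subsection \<open>The language\<close>

lemma letter_in_tau: "w \<noteq> [] \<Longrightarrow> c \<in> set (tau w)"
proof -
  assume "w \<noteq> []"
  then obtain d v where "w = d # v" by (cases w) auto
  then show ?thesis by (cases c; cases d) auto
qed

lemma sublist_taun_mono: "sublist u v \<Longrightarrow> sublist ((tau ^^ n) u) ((tau ^^ n) v)"
  unfolding sublist_def by (metis taun_append)

text \<open>One occurrence suffices: both letters occur in the image under \<open>tau\<close> of any
  nonempty word, so a factor of \<open>(tau ^^ k) [c]\<close> is a factor of every later image of
  every letter.\<close>

lemma language_iff: "w \<in> language tau \<longleftrightarrow> w \<noteq> [] \<and> (\<exists>k c. sublist w ((tau ^^ k) [c]))"
proof
  assume "w \<in> language tau"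
  then obtain K where "w \<noteq> []" "\<forall>k\<ge>K. \<forall>c. sublist w ((tau ^^ k) [c])"
    by (auto simp: language_def)
  then show "w \<noteq> [] \<and> (\<exists>k c. sublist w ((tau ^^ k) [c]))" by blast
next
  assume "w \<noteq> [] \<and> (\<exists>k c. sublist w ((tau ^^ k) [c]))"
  then obtain k c where w: "w \<noteq> []" "sublist w ((tau ^^ k) [c])" by blast
  have "sublist w ((tau ^^ n) [d])" if "n \<ge> Suc k" for n d
  proof -
    define m where "m = n - Suc k"
    have n: "n = k + Suc m" using that by (simp add: m_def)
    have "c \<in> set ((tau ^^ Suc m) [d])" using letter_in_tau[of "(tau ^^ m) [d]"] by simp
    then have "sublist [c] ((tau ^^ Suc m) [d])" by (auto simp: sublist_def dest: split_list)
    then have "sublist ((tau ^^ k) [c]) ((tau ^^ n) [d])"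
      unfolding n taun_add by (rule sublist_taun_mono)
    with w(2) show ?thesis by (rule sublist_order.order_trans)
  qed
  with w(1) show "w \<in> language tau" by (auto simp: language_def intro!: exI[of _ "Suc k"])
qed

lemma language_sublist: "w \<in> language tau \<Longrightarrow> sublist u w \<Longrightarrow> u \<noteq> [] \<Longrightarrow> u \<in> language tau"
  by (meson language_iff sublist_order.order_trans)

lemma language_taun: "(tau ^^ n) [c] \<in> language tau"
  unfolding language_iff by auto

lemma language_desubst:
  assumes "w \<in> language tau"
  shows "\<exists>t. t \<in> language tau \<and> sublist w ((tau ^^ n) t)"
proof -
  obtain K where K: "\<And>k c. k \<ge> K \<Longrightarrow> sublist w ((tau ^^ k) [c])"
    using assms by (auto simp: language_def)
  have "sublist w ((tau ^^ n) ((tau ^^ K) [La]))"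
    using K[of "n + K" La] by (simp add: taun_add)
  then show ?thesis using language_taun[of K La] by blast
qed

text \<open>One of the two adjacent pairs inside a cube starts at an even position and would be a
  block of \<open>tau t\<close>, whose two letters differ.\<close>

lemma no_cube: "w \<in> language tau \<Longrightarrow> \<not> sublist [c, c, c] w"
proof
  assume w: "w \<in> language tau" and "sublist [c, c, c] w"
  obtain t where "sublist w ((tau ^^ 1) t)" using language_desubst[OF w] by blast
  then have "sublist w (tau t)" by simp
  then have "sublist [c, c, c] (tau t)"
    using \<open>sublist [c, c, c] w\<close> by (meson sublist_order.order_trans)
  then obtain P Q where t: "tau t = P @ c # c # c # Q" by (auto simp: sublist_def)
  define n where "n = (if even (length P) then length P else Suc (length P))"
  have "even n" by (simp add: n_def)
  then obtain i where i: "n = 2 * i" by blast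
  have "tau t ! n = c" "tau t ! Suc n = c" "Suc n < length (tau t)"
    unfolding t n_def by (auto simp: nth_append)
  with i tau_nth_pair[of i t] show False by auto
qed

text \<open>A word longer than two images of letters under \<open>tau ^^ (n + 3)\<close> contains a
  complete one. The three extra steps provide room: either letter occurs in the interior of
  \<open>(tau ^^ 3) [d]\<close>, so that \<open>x\<close> and \<open>y\<close> are nonempty.\<close>

lemma language_recurrent:
  "\<exists>l. \<forall>w\<in>language tau. length w > l \<longrightarrow> (\<exists>x y. x \<noteq> [] \<and> y \<noteq> [] \<and> w = x @ (tau ^^ n) [c] @ y)"
proof (rule exI[of _ "2 * 2 ^ (n + 3)"], intro ballI impI)
  fix w assume w: "w \<in> language tau" and l: "length w > 2 * 2 ^ (n + 3)"
  let ?N = "n + 3"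
  obtain t where "sublist w ((tau ^^ ?N) t)" using language_desubst[OF w] by blast
  then obtain P Q where t: "(tau ^^ ?N) t = P @ w @ Q" by (auto simp: sublist_def)
  let ?L = "(2::nat) ^ ?N"
  \<comment> \<open>The index of the first block that starts strictly after
    \<open>P\<close>.\<close>
  define i where "i = Suc (length P div ?L)"
  have "length P < i * ?L"
    unfolding i_def using dividend_less_div_times[of ?L "length P"] by (simp add: algebra_simps)
  moreover have "i * ?L \<le> length P + ?L"
    unfolding i_def using div_times_less_eq_dividend[of "length P" ?L] by simp
  moreover have "2 * ?L < length w" using l .
  moreover have len: "?L * length t = length P + length w + length Q"
    using arg_cong[OF t, of length] by simp
  ultimately have Pi: "length P < i * ?L" "Suc i * ?L < length P + length w" "Suc i * ?L < length t * ?L"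
    by (simp_all add: mult.commute)
  then have it: "i < length t" using mult_less_cancel2[of "Suc i" ?L "length t"] by simp
  define A B C where "A = (tau ^^ ?N) (take i t)" and "B = (tau ^^ ?N) [t ! i]" and "C = (tau ^^ ?N) (drop (Suc i) t)"
  have "take i t @ [t ! i] @ drop (Suc i) t = t" using id_take_nth_drop[OF it] by simp
  then have "A @ B @ C = P @ w @ Q" unfolding A_def B_def C_def t[symmetric] taun_append[symmetric] by simp
  moreover have lAB: "length A = i * ?L" "length B = ?L" using it by (simp_all add: A_def B_def)
  ultimately obtain A' where A': "A = P @ A'" "A' @ B @ C = w @ Q"
    using Pi(1) by (auto simp: append_eq_append_conv2)
  have "length (A' @ B) < length w" using A'(1) lAB Pi(2) by simp
  moreover have "prefix (A' @ B) (w @ Q)" "prefix w (w @ Q)" by (metis A'(2) append_assoc prefixI, simp)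
  ultimately obtain y where "w = (A' @ B) @ y"
    by (meson less_imp_le prefix_def prefix_length_prefix)
  then obtain x y d where w': "w = x @ (tau ^^ ?N) [d] @ y" by (auto simp: B_def)
  \<comment> \<open>The third images are abbabaab and its complement: the letter \<open>d\<close>
    recurs at index 3, and the other letter stands at index 1.\<close>
  have "\<exists>p q. p \<noteq> [] \<and> q \<noteq> [] \<and> (tau ^^ 3) [d] = p @ [c] @ q"
  proof (cases "c = d")
    case True
    then show ?thesis
      by (intro exI[of _ "take 3 ((tau ^^ 3) [d])"] exI[of _ "drop 4 ((tau ^^ 3) [d])"])
         (cases d; simp add: eval_nat_numeral)
  next
    case False
    then show ?thesis
      by (intro exI[of _ "take 1 ((tau ^^ 3) [d])"] exI[of _ "drop 2 ((tau ^^ 3) [d])"])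
         (cases d; cases c; simp add: eval_nat_numeral)
  qed
  then obtain p q where pq: "p \<noteq> []" "q \<noteq> []" "(tau ^^ 3) [d] = p @ [c] @ q" by blast
  have "w = (x @ (tau ^^ n) p) @ (tau ^^ n) [c] @ ((tau ^^ n) q @ y)"
    unfolding w' taun_add pq(3) taun_append append_assoc by (rule refl)
  moreover have "(tau ^^ n) p \<noteq> []" "(tau ^^ n) q \<noteq> []" using pq by simp_all
  ultimately show "\<exists>x y. x \<noteq> [] \<and> y \<noteq> [] \<and> w = x @ (tau ^^ n) [c] @ y"
    by (metis append_is_Nil_conv)
qed

subsection \<open>Return words\<close>

text \<open>The return words of \<open>b.a\<close>.\<close>

definition return_words :: "ab list set" where
  "return_words = {[La, Lb], [La, La, Lb], [La, Lb, Lb], [La, La, Lb, Lb]}"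

inductive_set returns :: "ab list set" where
  single: "u \<in> return_words \<Longrightarrow> u \<in> returns"
| step: "u \<in> return_words \<Longrightarrow> v \<in> returns \<Longrightarrow> u @ v \<in> returns"

lemma returns_ne: "v \<in> returns \<Longrightarrow> v \<noteq> []"
  by (induction rule: returns.induct) (auto simp: return_words_def)

lemma returns_hd_last: "v \<in> returns \<Longrightarrow> hd v = La \<and> last v = Lb"
  by (induction rule: returns.induct) (auto simp: return_words_def returns_ne)

lemma returns_append: "u \<in> returns \<Longrightarrow> v \<in> returns \<Longrightarrow> u @ v \<in> returns"
  by (induction rule: returns.induct) (auto intro: returns.step)

text \<open>Without cubes, each run of equal letters has length one or two; a run of a followed by a
  run of b is a return word, and what remains again starts with a.\<close>

lemma returnsI:
  assumes "v \<noteq> []" "hd v = La" "last v = Lb" "\<And>c. \<not> sublist [c, c, c] v"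
  shows "v \<in> returns"
  using assms
proof (induction "length v" arbitrary: v rule: less_induct)
  case less
  have cont: "v \<in> returns" if v: "v = u @ v'" and u: "u \<in> return_words" and v': "v' = [] \<or> hd v' = La" for u v'
  proof (cases "v' = []")
    case True
    then show ?thesis using v u by (simp add: returns.single)
  next
    case False
    have "length v' < length v" using u v by (auto simp: return_words_def)
    moreover have "last v' = Lb" using less.prems(3) v False by simp
    moreover have "\<not> sublist [c, c, c] v'" for c
      using less.prems(4)[of c] v by (metis sublist_appendI sublist_order.order_trans append.right_neutral)
    ultimately have "v' \<in> returns" using less.hyps False v' by blast
    then show ?thesis using v u by (simp add: returns.step)
  qed
  have cube: "v \<noteq> p @ [c, c, c] @ q" for p c q
    using less.prems(4)[of c] by (metis sublist_appendI)
  have bs: "\<exists>r. w = Lb # r" if "w \<noteq> []" "hd w \<noteq> La" for w using that ab.exhaust by (cases w) auto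
  have tail: "v \<in> returns" if v: "v = p @ Lb # w" and p: "p = [La] \<or> p = [La, La]" for p w
  proof (cases "w = [] \<or> hd w = La")
    case True
    then show ?thesis using p v by (intro cont[of "p @ [Lb]" w]) (auto simp: return_words_def)
  next
    case False
    then obtain w' where w: "w = Lb # w'" using bs by blast
    have "w' = [] \<or> hd w' = La"
    proof (rule ccontr)
      assume "\<not> (w' = [] \<or> hd w' = La)"
      then obtain w'' where "w' = Lb # w''" using bs by blast
      then show False using cube[of p Lb w''] v w by simp
    qed
    then show ?thesis using p v w by (intro cont[of "p @ [Lb, Lb]" w']) (auto simp: return_words_def)
  qed
  obtain w where v: "v = La # w" using less.prems(1,2) by (cases v) auto
  then have wne: "w \<noteq> []" using less.prems(3) by auto
  show ?case
  proof (cases "hd w = La")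
    case True
    then obtain w' where w: "w = La # w'" using wne by (cases w) auto
    then have "w' \<noteq> []" using v less.prems(3) by auto
    moreover have "hd w' \<noteq> La" using cube[of "[]" La "tl w'"] v w \<open>w' \<noteq> []\<close> by (cases w') auto
    ultimately obtain w'' where "w' = Lb # w''" using bs by blast
    then show ?thesis using tail[of "[La, La]" w''] v w by simp
  next
    case False
    then obtain w' where "w = Lb # w'" using bs wne by blast
    then show ?thesis using tail[of "[La]" w'] v by simp
  qed
qed

definition phi :: "ab list \<Rightarrow> ab list" where "phi = tau ^^ 2"

lemma phi_append: "phi (u @ v) = phi u @ phi v" and phi_ne: "phi w = [] \<longleftrightarrow> w = []"
  by (simp_all add: phi_def)

lemma phin_taun: "(phi ^^ n) = (tau ^^ (2 * n))"
  by (simp add: phi_def funpow_mult)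

lemma phi_return_words:
  "phi [La, Lb] = [La, Lb, Lb] @ [La, Lb] @ [La, La, Lb]"
  "phi [La, La, Lb] = [La, Lb, Lb] @ [La, La, Lb, Lb] @ [La, Lb] @ [La, La, Lb]"
  "phi [La, Lb, Lb] = [La, Lb, Lb] @ [La, Lb] @ [La, La, Lb, Lb] @ [La, La, Lb]"
  "phi [La, La, Lb, Lb] = [La, Lb, Lb] @ [La, La, Lb, Lb] @ [La, Lb] @ [La, La, Lb, Lb] @ [La, La, Lb]"
  by (simp_all add: phi_def eval_nat_numeral)

lemma returns_base: "[La, Lb] \<in> returns" "[La, La, Lb] \<in> returns" "[La, Lb, Lb] \<in> returns" "[La, La, Lb, Lb] \<in> returns"
  by (auto intro!: returns.single simp: return_words_def)

text \<open>Each product in \<open>phi_return_words\<close> has at least three factors, so that what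
  remains after removal of the first or the last one is nonempty and belongs to
  \<open>returns\<close>.\<close>

lemma phi_returns_decomp:
  assumes "v \<in> returns"
  shows "\<exists>v'\<in>returns. phi v = [La, Lb, Lb] @ v'" and "\<exists>v'\<in>returns. phi v = v' @ [La, La, Lb]"
proof -
  let ?P = "\<lambda>v. (\<exists>v'\<in>returns. phi v = [La, Lb, Lb] @ v') \<and> (\<exists>v'\<in>returns. phi v = v' @ [La, La, Lb])"
  have base: "?P u" if "u \<in> return_words" for u
    using that unfolding return_words_def using phi_return_words returns_base returns_append
    by (elim insertE emptyE) (simp_all, (metis append_Cons append_Nil)+)
  have "?P v"
    using assms
  proof induction
    case (step u v)
    note u = base[OF step(1)]
    have pv: "phi v \<in> returns" using step.IH returns_base returns_append by metis
    have pu: "phi u \<in> returns" using u returns_base returns_append by metis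
    obtain x y where "x \<in> returns" "phi u = [La, Lb, Lb] @ x" "y \<in> returns" "phi v = y @ [La, La, Lb]"
      using u step.IH by blast
    then show ?case
      using returns_append[OF \<open>x \<in> returns\<close> pv] returns_append[OF pu \<open>y \<in> returns\<close>]
      by (auto simp: phi_append)
  qed (rule base)
  then show "\<exists>v'\<in>returns. phi v = [La, Lb, Lb] @ v'" "\<exists>v'\<in>returns. phi v = v' @ [La, La, Lb]" by auto
qed

lemma phi_returns: "v \<in> returns \<Longrightarrow> phi v \<in> returns"
  using phi_returns_decomp(1) returns_base returns_append by metis

lemma phin_returns: "v \<in> returns \<Longrightarrow> (phi ^^ n) v \<in> returns"
  by (induction n) (auto simp: phi_returns)

lemma returns_in_language: "v \<in> language tau \<Longrightarrow> hd v = La \<Longrightarrow> last v = Lb \<Longrightarrow> v \<in> returns"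
  using returnsI no_cube language_iff by blast

text \<open>Recognizability: both ends of \<open>w\<close> lie in the middle of an occurrence of \<open>phi\<^sup>n (ba)\<close>,
  hence at cutting points.\<close>

lemma desubstitute:
  assumes L: "p @ w @ q \<in> language tau"
    and p: "suffix ((phi ^^ n) [Lb]) p" and q: "prefix ((phi ^^ n) [La]) q"
    and w: "prefix ((phi ^^ n) [La]) w" "suffix ((phi ^^ n) [Lb]) w"
  shows "\<exists>v\<in>returns. w = (phi ^^ n) v"
proof -
  let ?f = "tau ^^ (2 * n)"
  obtain t where t: "t \<in> language tau" "sublist (p @ w @ q) (?f t)" using language_desubst[OF L] by blast
  then obtain P Q where eq: "?f t = P @ p @ w @ q @ Q" by (auto simp: sublist_def)
  obtain p' q' w' w'' where d: "p = p' @ ?f [Lb]" "q = ?f [La] @ q'" "w = ?f [La] @ w'" "w = w'' @ ?f [Lb]"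
    using p q w unfolding phin_taun prefix_def suffix_def by blast
  have alt: "alternates [Lb, La]"
    unfolding alternates_def by (intro exI[of _ "[]"] exI[of _ Lb] exI[of _ La]) simp
  have ba: "?f [Lb, La] = ?f [Lb] @ ?f [La]" using taun_append[of "2 * n" "[Lb]" "[La]"] by simp
  have "?f t = (P @ p') @ ?f [Lb, La] @ (w' @ q @ Q)" unfolding eq ba d(1) by (simp add: d(3))
  from taun_sync[OF this alt] obtain t1 t2 where
    t1: "t = t1 @ [Lb, La] @ t2" "P @ p' = ?f t1" "w' @ q @ Q = ?f t2" by blast
  have "?f t = (P @ p @ w'') @ ?f [Lb, La] @ (q' @ Q)" unfolding eq ba d(2) by (simp add: d(4))
  from taun_sync[OF this alt] obtain t3 t4 where
    t3: "t = t3 @ [Lb, La] @ t4" "P @ p @ w'' = ?f t3" "q' @ Q = ?f t4" by blast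
  have Pp: "P @ p = ?f (t1 @ [Lb])" using t1(2) d(1) by simp
  have Ppw: "P @ p @ w = ?f (t3 @ [Lb])" using t3(2) d(4) by simp
  have "length (P @ p) < length (P @ p @ w)" using d(3) by simp
  then have "2 ^ (2 * n) * length (t1 @ [Lb]) < 2 ^ (2 * n) * length (t3 @ [Lb])"
    unfolding Pp Ppw length_taun .
  then have lt: "length t1 < length t3" by simp
  have "t1 @ [Lb] @ (La # t2) = t3 @ [Lb] @ (La # t4)" using t1(1) t3(1) by simp
  then obtain u where u: "t3 = t1 @ [Lb] @ u"
    using lt by (auto simp: append_eq_append_conv2 Cons_eq_append_conv)
  have "P @ p @ w = (P @ p) @ ?f (u @ [Lb])"
    unfolding Ppw Pp u using taun_append[of "2 * n" "t1 @ [Lb]" "u @ [Lb]"] by simp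
  then have wv: "w = ?f (u @ [Lb])" by simp
  \<comment> \<open>The preimage of \<open>w\<close> is the part of \<open>t\<close> between the two
    cuts, so it begins with the a of the first occurrence of ba and ends with the b of the
    second.\<close>
  have "La # t2 = u @ [Lb] @ La # t4" using t1(1) t3(1) u by simp
  then have "hd (u @ [Lb]) = La" by (cases u) auto
  moreover have "u @ [Lb] \<in> language tau"
  proof (rule language_sublist[OF t(1)])
    have "t = (t1 @ [Lb]) @ (u @ [Lb]) @ (La # t4)" using t3(1) u by simp
    then show "sublist (u @ [Lb]) t" by (metis sublist_appendI)
  qed simp
  ultimately show ?thesis
    using returns_in_language[of "u @ [Lb]"] wv unfolding phin_taun by (intro bexI[of _ "u @ [Lb]"]) simp_all
qed

section \<open>The maximal subgroup fixed by the substitution\<close>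

abbreviation psg :: "ab pseudovariety" where
  "psg \<equiv> all_semigroups"

abbreviation mS :: "ab pro \<Rightarrow> ab pro \<Rightarrow> ab pro" (infixl "\<cdot>" 70) where
  "x \<cdot> y \<equiv> Omega_mult psg x y"

abbreviation FS :: "ab pro set" where
  "FS \<equiv> Omega psg"

abbreviation pw :: "ab list \<Rightarrow> ab pro" where
  "pw \<equiv> of_word psg"

lemma pro_endo_of_hom:
  fixes g :: "'a::finite list \<Rightarrow> 'a list"
  assumes app: "\<And>u v. g (u @ v) = g u @ g v" and ne: "\<And>w. w \<noteq> [] \<Longrightarrow> g w \<noteq> []"
  shows "\<exists>F. pro_endo all_semigroups F \<and> (\<forall>w. w \<noteq> [] \<longrightarrow> F (of_word all_semigroups w) = of_word all_semigroups (g w))"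
proof -
  let ?V = "all_semigroups :: 'a pseudovariety"
  define \<theta> where "\<theta> = (\<lambda>c. of_word ?V (g [c]))"
  have \<theta>: "\<theta> c \<in> Omega ?V" for c by (simp add: \<theta>_def ne)
  have "\<forall>s\<in>congs ?V. ker_cong (\<lambda>w. word_prod (Omega_mult ?V) \<theta> w s) \<in> congs ?V"
  proof
    fix s assume "s \<in> congs ?V"
    from word_cong_ker_word_prod[OF order_refl semigroup_on_Omega \<theta> this]
    show "ker_cong (\<lambda>w. word_prod (Omega_mult ?V) \<theta> w s) \<in> congs ?V"
      by (subst congs_all_semigroups) (rule conjI)
  qed
  from hom_extension[OF directed_all_semigroups order_refl semigroup_on_Omega \<theta> this]
  obtain F where F: "unif ?V ?V (Omega ?V) F"
    "\<forall>f\<in>Omega ?V. \<forall>g\<in>Omega ?V. F (Omega_mult ?V f g) = Omega_mult ?V (F f) (F g)"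
    "\<forall>c. F (of_word ?V [c]) = \<theta> c" by blast
  have "F (of_word ?V w) = of_word ?V (g w)" if "w \<noteq> []" for w
    using that
  proof (induction w)
    case (Cons c w)
    show ?case
    proof (cases "w = []")
      case True
      then show ?thesis using F(3) by (simp add: \<theta>_def)
    next
      case False
      then have "F (of_word ?V (c # w)) = Omega_mult ?V (F (of_word ?V [c])) (F (of_word ?V w))"
        using of_word_append[of "[c]" w ?V] F(2) by simp
      also have "\<dots> = Omega_mult ?V (of_word ?V (g [c])) (of_word ?V (g w))"
        using Cons.IH[OF False] F(3) by (simp add: \<theta>_def)
      also have "\<dots> = of_word ?V (g (c # w))"
        using of_word_append[of "g [c]" "g w" ?V] app[of "[c]" w] ne False by simp
      finally show ?thesis .
    qed
  qed simp
  with F show ?thesis unfolding pro_endo_def by blast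
qed

section \<open>The endomorphism induced by the squared substitution and its idempotent power\<close>

definition phi_hat :: "ab pro \<Rightarrow> ab pro" where
  "phi_hat = (SOME F. pro_endo psg F \<and> (\<forall>w. w \<noteq> [] \<longrightarrow> F (pw w) = pw (phi w)))"

lemma pro_endo_phi_hat: "pro_endo psg phi_hat"
  and phi_hat_word: "w \<noteq> [] \<Longrightarrow> phi_hat (pw w) = pw (phi w)"
proof -
  have "\<exists>F. pro_endo psg F \<and> (\<forall>w. w \<noteq> [] \<longrightarrow> F (pw w) = pw (phi w))"
    by (rule pro_endo_of_hom) (simp_all add: phi_append phi_ne)
  from someI_ex[OF this]
  have "pro_endo psg phi_hat \<and> (\<forall>w. w \<noteq> [] \<longrightarrow> phi_hat (pw w) = pw (phi w))"
    unfolding phi_hat_def .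
  then show "pro_endo psg phi_hat" "w \<noteq> [] \<Longrightarrow> phi_hat (pw w) = pw (phi w)" by auto
qed

lemma phin_append: "(phi ^^ n) (u @ v) = (phi ^^ n) u @ (phi ^^ n) v"
  and phin_ne: "(phi ^^ n) w = [] \<longleftrightarrow> w = []"
  by (simp_all add: phin_taun)

lemma phi_hat_funpow_word: "w \<noteq> [] \<Longrightarrow> (phi_hat ^^ n) (pw w) = pw ((phi ^^ n) w)"
  by (induction n) (auto simp: phi_hat_word phin_ne)

definition Phi :: "ab pro \<Rightarrow> ab pro" where
  "Phi = om psg phi_hat"

lemmas psg_dir = directed_all_semigroups[where ?'a = ab]

lemma Phi_endo: "pro_endo psg Phi"
  unfolding Phi_def by (rule pro_endo_om[OF psg_dir pro_endo_phi_hat])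

abbreviation returns_cl :: "ab pro set" where
  "returns_cl \<equiv> words_cl psg returns"

lemma pw_returns_sub: "pw ` returns \<subseteq> FS"
  using returns_ne by auto

lemma pw_returns: "w \<in> returns \<Longrightarrow> pw w \<in> returns_cl"
  using subset_cl[OF pw_returns_sub] by blast

lemma pw_returns_mult:
  "f \<in> pw ` returns \<Longrightarrow> g \<in> pw ` returns \<Longrightarrow> f \<cdot> g \<in> pw ` returns"
  using returns_append returns_ne of_word_append[of _ _ psg] by (auto simp: image_iff) (metis)

lemma returns_cl_mult: "f \<in> returns_cl \<Longrightarrow> g \<in> returns_cl \<Longrightarrow> f \<cdot> g \<in> returns_cl"
  by (rule cl_mult[OF pw_returns_mult])

lemma returns_cl_Omega: "f \<in> returns_cl \<Longrightarrow> f \<in> FS"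
  by (rule cl_subset_Omega)

lemma unif_returns_cl: "pro_endo psg F \<Longrightarrow> unif psg psg returns_cl F"
  using unif_subset[OF pro_endoD(1)] returns_cl_Omega by blast

lemma phi_hat_returns_cl: "f \<in> returns_cl \<Longrightarrow> (phi_hat ^^ n) f \<in> returns_cl"
proof -
  have "(phi_hat ^^ n) g \<in> returns_cl" if "g \<in> pw ` returns" for g
    using that phi_hat_funpow_word returns_ne pw_returns phin_returns by auto
  then show "f \<in> returns_cl \<Longrightarrow> (phi_hat ^^ n) f \<in> returns_cl"
    by (rule unif_range[OF psg_dir unif_returns_cl[OF pro_endo_funpow[OF psg_dir pro_endo_phi_hat]] pw_returns_sub])
qed

lemma Phi_returns_cl: 
  assumes f: "f \<in> returns_cl"
  shows "Phi f \<in> returns_cl"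
proof -
  have "Phi f \<in> cl psg returns_cl"
  proof (rule clI)
    show "Phi f \<in> FS" using pro_endoD(2)[OF Phi_endo] f returns_cl_Omega by blast
    fix r assume "r \<in> congs psg"
    then obtain n where "Phi f r = (phi_hat ^^ n) f r"
      using om_approx[OF psg_dir pro_endo_phi_hat returns_cl_Omega[OF f]] unfolding Phi_def by blast
    then show "\<exists>g\<in>returns_cl. Phi f r = g r" using phi_hat_returns_cl[OF f] by blast
  qed
  then show ?thesis unfolding cl_cl .
qed

text \<open>\<open>Phi\<close> is idempotent and preserves \<open>returns_cl\<close>, so the fixed
  points form the image of \<open>returns_cl\<close> under \<open>Phi\<close>. As a set of fixed
  points it is visibly closed.\<close>

definition fix_grp :: "ab pro set" where
  "fix_grp = {k \<in> returns_cl. Phi k = k}"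

lemma fix_grp_Omega: "fix_grp \<subseteq> FS"
  using returns_cl_Omega by (auto simp: fix_grp_def)

lemma Phi_in_fix_grp: "f \<in> returns_cl \<Longrightarrow> Phi f \<in> fix_grp"
  using Phi_returns_cl om_idem[OF psg_dir pro_endo_phi_hat returns_cl_Omega]
  by (simp add: fix_grp_def Phi_def)

lemma semigroup_on_fix_grp: "semigroup_on fix_grp (Omega_mult psg)"
  unfolding semigroup_on_def
proof (intro conjI ballI)
  fix u v assume "u \<in> fix_grp" "v \<in> fix_grp"
  then show "u \<cdot> v \<in> fix_grp"
    using pro_endoD(3)[OF Phi_endo, of u v] by (simp add: fix_grp_def returns_cl_mult returns_cl_Omega)
next
  fix u v w assume "u \<in> fix_grp" "v \<in> fix_grp" "w \<in> fix_grp"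
  then show "(u \<cdot> v) \<cdot> w = u \<cdot> (v \<cdot> w)"
    using fix_grp_Omega by (intro Omega_mult_assoc) auto
qed

lemma cl_fix_grp: "cl psg fix_grp = fix_grp"
proof (intro equalityI subsetI)
  fix f assume f: "f \<in> cl psg fix_grp"
  have "f \<in> cl psg returns_cl" using f cl_mono[of fix_grp returns_cl psg] by (auto simp: fix_grp_def)
  then have fr: "f \<in> returns_cl" unfolding cl_cl .
  have sub: "cl psg fix_grp \<subseteq> FS" using cl_subset_Omega by blast
  have "Phi f = f"
    by (rule unif_eqI[OF psg_dir unif_subset[OF pro_endoD(1)[OF Phi_endo] sub]
          unif_subset[OF pro_endoD(1)[OF pro_endo_id] sub] fix_grp_Omega _ f])
       (simp add: fix_grp_def)
  with fr show "f \<in> fix_grp" by (simp add: fix_grp_def)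
qed (use subset_cl[OF fix_grp_Omega] in blast)

text \<open>From \<open>k = Phi k\<close>: replace the argument of \<open>Phi\<close> by a word,
  then \<open>Phi\<close> by a power of \<open>phi\<close>, whose exponent may be chosen as large as
  desired.\<close>

lemma fix_grp_approx:
  assumes k: "k \<in> fix_grp" and s: "s \<in> congs psg"
  shows "\<exists>w\<in>returns. \<exists>n\<ge>j. k s = cls s ((phi ^^ n) w)"
proof -
  have kr: "k \<in> returns_cl" and Pk: "Phi k = k" using k by (auto simp: fix_grp_def)
  obtain g where g: "g \<in> pw ` returns" "Phi k s = Phi g s"
    using unif_approx[OF psg_dir unif_returns_cl[OF Phi_endo] pw_returns_sub kr s s] by blast
  then obtain w where w: "w \<in> returns" "g = pw w" by blast
  obtain n where "n \<ge> j" "Phi g s = (phi_hat ^^ n) g s"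
    using om_approx[OF psg_dir pro_endo_phi_hat _ s, of g j] w(2) returns_ne[OF w(1)] unfolding Phi_def by auto
  then show ?thesis
    using g w Pk phi_hat_funpow_word[OF returns_ne[OF w(1)]] s by (auto simp: of_word_apply)
qed

text \<open>On a finite set, a surjective composite of self-maps is bijective, and then so is each
  factor. The operation \<open>m\<close> is left abstract to cover both left and right
  translations.\<close>

lemma inj_on_factors:
  assumes fin: "finite T" and cl: "\<And>g t. g \<in> T \<Longrightarrow> t \<in> T \<Longrightarrow> m g t \<in> T" and gs: "set gs \<subseteq> T"
    and sub: "T \<subseteq> foldr m gs ` T" and g: "g \<in> set gs"
  shows "inj_on (m g) T"
proof -
  have in_T: "foldr m hs t \<in> T" if "set hs \<subseteq> T" "t \<in> T" for hs t
    using that by (induction hs) (auto intro: cl)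
  obtain hs ks where gs_eq: "gs = hs @ g # ks" using g by (meson split_list)
  have "foldr m gs ` T = T" using sub in_T[OF gs] by blast
  then have inj: "inj_on (foldr m gs) T" using fin by (metis finite_surj_inj order_refl)
  have "inj_on (foldr m ks) T" using inj unfolding gs_eq by (auto simp: inj_on_def)
  moreover have "set ks \<subseteq> T" using gs gs_eq by auto
  ultimately have "foldr m ks ` T = T"
    using in_T by (intro endo_inj_surj[OF fin]) auto
  moreover have "inj_on (\<lambda>t. m g (foldr m ks t)) T" using inj unfolding gs_eq by (auto simp: inj_on_def)
  ultimately show ?thesis using inj_on_imageI[of "m g" "foldr m ks" T] by (simp add: comp_def)
qed

text \<open>In a finite quotient, \<open>Phi\<close> is a power of \<open>phi\<close>. Every element of the image is left divisible
  by the image of \<open>phi (abb)\<close>, in which all return words occur, so that all translations are bijective.\<close>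

lemma fix_grp_quotient:
  assumes s: "s \<in> congs psg"
  obtains T where "T = (\<lambda>k. k s) ` fix_grp" "finite T" "semigroup_on T (cmult s)"
    "\<And>t. t \<in> T \<Longrightarrow> inj_on (cmult s t) T" "\<And>t. t \<in> T \<Longrightarrow> inj_on (\<lambda>u. cmult s u t) T"
proof -
  note sc = congsD(1)[OF s]
  obtain N where N1: "\<And>n f. n \<ge> N \<Longrightarrow> f \<in> FS \<Longrightarrow> Phi f s = (phi_hat ^^ fact n) f s"
    and N2: "\<And>n k f. n \<ge> N \<Longrightarrow> k \<ge> N \<Longrightarrow> f \<in> FS \<Longrightarrow> (phi_hat ^^ (fact n + k)) f s = (phi_hat ^^ k) f s"
    unfolding Phi_def using om_apply[OF psg_dir pro_endo_phi_hat s] by metis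
  \<comment> \<open>At \<open>s\<close>, \<open>Phi\<close> equals \<open>phi ^^ (m + 2)\<close>:
    two applications of \<open>phi\<close> are set apart from the factorial exponent. The offset 4
    keeps \<open>m\<close> at least \<open>N\<close>, as the periodicity \<open>N2\<close>
    requires.\<close>
  define m where "m = fact (N + 4) - (2::nat)"
  have fm: "fact (N + 4) = m + 2" and mN: "m \<ge> N"
    using fact_ge_self[of "N + 4"] by (auto simp: m_def)
  define h where "h = (\<lambda>w. cls s ((phi ^^ m) w))"
  define T where "T = h ` returns"
  let ?M = "cmult s"
  have hM: "h (u @ v) = ?M (h u) (h v)" if "u \<noteq> []" "v \<noteq> []" for u v
    using that by (simp add: h_def phin_append quot_mult_cls[OF sc] phin_ne)
  have Phis: "Phi (pw w) s = cls s ((phi ^^ (m + 2)) w)" if "w \<noteq> []" for w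
  proof -
    have "Phi (pw w) s = (phi_hat ^^ (m + 2)) (pw w) s"
      unfolding fm[symmetric] by (rule N1) (use that in auto)
    then show ?thesis by (simp only: phi_hat_funpow_word[OF that] of_word_apply[OF s])
  qed
  have per: "h w = cls s ((phi ^^ ((m + 2) + m)) w)" if "w \<noteq> []" for w
  proof -
    have "(phi_hat ^^ (fact (N + 4) + m)) (pw w) s = (phi_hat ^^ m) (pw w) s"
      by (rule N2) (use mN that in auto)
    then show ?thesis
      unfolding fm h_def by (simp only: phi_hat_funpow_word[OF that] of_word_apply[OF s])
  qed
  \<comment> \<open>Of the two middle applications, the inner one exposes a factor abb or aab at the
    border, and the outer one turns it into a product in which all four return words occur.\<close>
  have dec: "(phi ^^ ((m + 2) + m)) w = (phi ^^ m) (phi (phi ((phi ^^ m) w)))" for w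
    by (simp only: funpow_add comp_apply) (simp add: numeral_2_eq_2)
  have T_in: "h w \<in> T" if "w \<in> returns" for w using that by (auto simp: T_def)
  have T_eq: "T = (\<lambda>k. k s) ` fix_grp"
  proof (intro equalityI subsetI)
    fix t assume "t \<in> T"
    then obtain w where w: "w \<in> returns" "t = h w" by (auto simp: T_def)
    have wne: "w \<noteq> []" using returns_ne w by blast
    have "Phi (pw ((phi ^^ m) w)) s = cls s ((phi ^^ (m + 2)) ((phi ^^ m) w))"
      using wne by (intro Phis) (simp add: phin_ne)
    also have "\<dots> = t" unfolding w(2) per[OF wne] by (simp add: funpow_add)
    finally show "t \<in> (\<lambda>k. k s) ` fix_grp"
      using Phi_in_fix_grp[OF pw_returns[OF phin_returns[OF w(1)]]] by (metis image_eqI)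
  next
    fix t assume "t \<in> (\<lambda>k. k s) ` fix_grp"
    then obtain k where k: "k \<in> fix_grp" "t = k s" by blast
    obtain w n where w: "w \<in> returns" "n \<ge> m" "k s = cls s ((phi ^^ n) w)"
      using fix_grp_approx[OF k(1) s, of m] by blast
    have "(phi ^^ n) w = (phi ^^ m) ((phi ^^ (n - m)) w)"
      using w(2) by (metis comp_apply funpow_add le_add_diff_inverse)
    then have "k s = h ((phi ^^ (n - m)) w)" using w(3) by (simp add: h_def)
    then show "t \<in> T" using k(2) T_in phin_returns[OF w(1)] by simp
  qed
  have fin: "finite T"
  proof (rule finite_subset[OF _ congsD(2)[OF s]])
    show "T \<subseteq> quots s"
      using returns_ne by (auto simp: T_def h_def phin_ne intro!: cls_in_quotient)
  qed
  have clT: "?M a b \<in> T" if ab: "a \<in> T" "b \<in> T" for a b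
  proof -
    obtain u v where "u \<in> returns" "a = h u" "v \<in> returns" "b = h v" using ab by (auto simp: T_def)
    then show ?thesis using hM[of u v] returns_ne T_in[OF returns_append, of u v] by simp
  qed
  have assocT: "?M (?M a b) c = ?M a (?M b c)" if abc: "a \<in> T" "b \<in> T" "c \<in> T" for a b c
  proof -
    obtain u v w where "u \<in> returns" "a = h u" "v \<in> returns" "b = h v" "w \<in> returns" "c = h w"
      using abc by (auto simp: T_def)
    then show ?thesis
      using hM[of "u @ v" w] hM[of u v] hM[of v w] hM[of u "v @ w"] returns_ne by simp
  qed
  have sg: "semigroup_on T ?M" using clT assocT by (simp add: semigroup_on_def)
  let ?x = "h [La, Lb]" and ?y = "h [La, La, Lb]" and ?z = "h [La, Lb, Lb]" and ?d = "h [La, La, Lb, Lb]"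
  have gens: "?x \<in> T" "?y \<in> T" "?z \<in> T" "?d \<in> T" using returns_base T_in by auto
  \<comment> \<open>The list is the factorization of \<open>phi [La, Lb, Lb]\<close>: every element
    of \<open>T\<close> arises by these four left translations in succession.\<close>
  have lsurj: "T \<subseteq> foldr ?M [?z, ?x, ?d, ?y] ` T"
  proof
    fix t assume "t \<in> T"
    then obtain w where w: "w \<in> returns" "t = h w" by (auto simp: T_def)
    obtain v where v: "v \<in> returns" "phi ((phi ^^ m) w) = [La, Lb, Lb] @ v"
      using phi_returns_decomp(1)[OF phin_returns[OF w(1)]] by blast
    have "t = h (phi [La, Lb, Lb] @ phi v)"
      unfolding w(2) per[OF returns_ne[OF w(1)]] dec v(2) phi_append unfolding h_def by (rule refl)
    also have "\<dots> = foldr ?M [?z, ?x, ?d, ?y] (h (phi v))"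
      unfolding phi_return_words append_assoc foldr.simps comp_apply id_apply
      using returns_ne[OF phi_returns[OF v(1)]]
      by (simp only: hM not_Cons_self2 list.distinct append_is_Nil_conv simp_thms)
    finally show "t \<in> foldr ?M [?z, ?x, ?d, ?y] ` T" using T_in[OF phi_returns[OF v(1)]] by blast
  qed
  \<comment> \<open>The factorization of \<open>phi [La, La, Lb]\<close> in reverse order, because
    \<open>foldr\<close> applies the last entry of its list first.\<close>
  have rsurj: "T \<subseteq> foldr (\<lambda>u t. ?M t u) [?y, ?x, ?d, ?z] ` T"
  proof
    fix t assume "t \<in> T"
    then obtain w where w: "w \<in> returns" "t = h w" by (auto simp: T_def)
    obtain v where v: "v \<in> returns" "phi ((phi ^^ m) w) = v @ [La, La, Lb]"
      using phi_returns_decomp(2)[OF phin_returns[OF w(1)]] by blast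
    have "t = h ((((phi v @ [La, Lb, Lb]) @ [La, La, Lb, Lb]) @ [La, Lb]) @ [La, La, Lb])"
      unfolding w(2) per[OF returns_ne[OF w(1)]] dec v(2) phi_append phi_return_words append_assoc
      unfolding h_def by (rule refl)
    also have "\<dots> = foldr (\<lambda>u t. ?M t u) [?y, ?x, ?d, ?z] (h (phi v))"
      unfolding foldr.simps comp_apply id_apply using returns_ne[OF phi_returns[OF v(1)]]
      by (simp only: hM not_Cons_self2 list.distinct append_is_Nil_conv simp_thms)
    finally show "t \<in> foldr (\<lambda>u t. ?M t u) [?y, ?x, ?d, ?z] ` T" using T_in[OF phi_returns[OF v(1)]] by blast
  qed
  have linj: "inj_on (?M g) T" if "g \<in> {?x, ?y, ?z, ?d}" for g
    by (rule inj_on_factors[OF fin clT _ lsurj]) (use that gens in auto)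
  have rinj: "inj_on (\<lambda>t. ?M t g) T" if "g \<in> {?x, ?y, ?z, ?d}" for g
    by (rule inj_on_factors[OF fin clT _ rsurj]) (use that gens in auto)
  have gen_inj: "inj_on (?M (h u)) T \<and> inj_on (\<lambda>t. ?M t (h u)) T" if "u \<in> return_words" for u
    using that linj[of "h u"] rinj[of "h u"] unfolding return_words_def by auto
  have inj: "inj_on (?M (h w)) T \<and> inj_on (\<lambda>t. ?M t (h w)) T" if "w \<in> returns" for w
    using that
  proof induction
    case (step u v)
    have uv: "h u \<in> T" "h v \<in> T" "h (u @ v) = ?M (h u) (h v)"
      using step T_in returns.single returns_ne by (auto simp: hM)
    note gu = gen_inj[OF step(1)]
    have "inj_on (?M (h (u @ v))) T"
    proof (rule inj_onI)
      fix a b assume ab: "a \<in> T" "b \<in> T" "?M (h (u @ v)) a = ?M (h (u @ v)) b"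
      then have "?M (h u) (?M (h v) a) = ?M (h u) (?M (h v) b)"
        using assocT[OF uv(1,2)] by (simp add: uv(3))
      then have "?M (h v) a = ?M (h v) b"
        by (rule inj_onD[OF conjunct1[OF gu]]) (use clT uv ab in auto)
      then show "a = b"
        by (rule inj_onD[OF conjunct1[OF step.IH]]) (use ab in auto)
    qed
    moreover have "inj_on (\<lambda>t. ?M t (h (u @ v))) T"
    proof (rule inj_onI)
      fix a b assume ab: "a \<in> T" "b \<in> T" "?M a (h (u @ v)) = ?M b (h (u @ v))"
      then have "?M (?M a (h u)) (h v) = ?M (?M b (h u)) (h v)"
        using assocT[OF ab(1) uv(1,2)] assocT[OF ab(2) uv(1,2)] by (simp add: uv(3))
      then have "?M a (h u) = ?M b (h u)"
        by (rule inj_onD[OF conjunct2[OF step.IH]]) (use clT uv ab in auto)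
      then show "a = b"
        by (rule inj_onD[OF conjunct2[OF gu]]) (use ab in auto)
    qed
    ultimately show ?case by (rule conjI)
  qed (rule gen_inj)
  show ?thesis
    by (rule that[OF T_eq fin sg]) (use inj in \<open>auto simp: T_def\<close>)
qed

lemma is_group_fix_grp: "is_group fix_grp (Omega_mult psg)"
proof (rule is_group_closed[OF psg_dir fix_grp_Omega cl_fix_grp _ semigroup_on_fix_grp])
  show "fix_grp \<noteq> {}"
    using Phi_in_fix_grp[OF pw_returns[OF returns_base(1)]] by blast
next
  fix s a b assume s: "s \<in> congs psg" and ab: "a \<in> fix_grp" "b \<in> fix_grp"
  obtain T where T: "T = (\<lambda>k. k s) ` fix_grp" and fin: "finite T" and sg: "semigroup_on T (cmult s)"
    and inj: "\<And>t. t \<in> T \<Longrightarrow> inj_on (cmult s t) T" "\<And>t. t \<in> T \<Longrightarrow> inj_on (\<lambda>u. cmult s u t) T"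
    by (rule fix_grp_quotient[OF s]) (rule that; assumption)
  have "a s \<in> T" "b s \<in> T" using ab by (auto simp: T)
  from finite_cancellative_solvable[OF fin sg inj this]
  have "\<exists>w\<in>T. cmult s (a s) w = b s" "\<exists>w\<in>T. cmult s w (a s) = b s" by auto
  then show "\<exists>x\<in>fix_grp. (a \<cdot> x) s = b s" "\<exists>x\<in>fix_grp. (x \<cdot> a) s = b s"
    unfolding T by (auto simp: Omega_mult_apply s)
qed

section \<open>Factors of limits of words\<close>

text \<open>All ways to cut a word in two, seen modulo \<open>s\<close>. Together with the class of
  the word this is a finite invariant compatible with concatenation: a cut of \<open>u @ v\<close>
  lies in \<open>u\<close>, between the words, or in \<open>v\<close>.\<close>

definition splits :: "('a::finite list \<times> 'a list) set \<Rightarrow> 'a list \<Rightarrow> ('a list set \<times> 'a list set) set" where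
  "splits s w = {(cls s x, cls s y) | x y. w = x @ y \<and> x \<noteq> [] \<and> y \<noteq> []}"

lemma splits_append:
  assumes s: "word_cong s" and u: "u \<noteq> []" and v: "v \<noteq> []"
  shows "splits s (u @ v) = (\<lambda>(A, B). (A, cmult s B (cls s v))) ` splits s u
    \<union> {(cls s u, cls s v)} \<union> (\<lambda>(A, B). (cmult s (cls s u) A, B)) ` splits s v"
    (is "?l = ?r")
proof (intro equalityI subsetI)
  fix p assume "p \<in> ?l"
  then obtain x y where p: "p = (cls s x, cls s y)" and xy: "u @ v = x @ y" "x \<noteq> []" "y \<noteq> []"
    by (auto simp: splits_def)
  from xy(1) consider "x = u" "y = v" | z where "z \<noteq> []" "u = x @ z" "y = z @ v"
    | z where "z \<noteq> []" "x = u @ z" "v = z @ y"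
    by (auto simp: append_eq_append_conv2)
  then show "p \<in> ?r"
  proof cases
    case 2
    then have "(cls s x, cls s z) \<in> splits s u" using xy by (auto simp: splits_def)
    moreover have "p = (cls s x, cmult s (cls s z) (cls s v))"
      using 2 p v by (simp add: quot_mult_cls[OF s])
    ultimately show ?thesis by force
  next
    case 3
    then have "(cls s z, cls s y) \<in> splits s v" using xy by (auto simp: splits_def)
    moreover have "p = (cmult s (cls s u) (cls s z), cls s y)"
      using 3 p u by (simp add: quot_mult_cls[OF s])
    ultimately show ?thesis by force
  qed (simp add: p)
next
  have l: "(cls s x, cls s y) \<in> ?l" if "u @ v = x @ y" "x \<noteq> []" "y \<noteq> []" for x y
    using that unfolding splits_def by blast
  fix p assume "p \<in> ?r"
  then show "p \<in> ?l"
  proof (elim UnE imageE)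
    fix q assume q: "p = (case q of (A, B) \<Rightarrow> (A, cmult s B (cls s v)))" "q \<in> splits s u"
    then obtain x y where "u = x @ y" "x \<noteq> []" "y \<noteq> []" "q = (cls s x, cls s y)"
      unfolding splits_def by blast
    then show ?thesis using q(1) l[of x "y @ v"] v by (simp add: quot_mult_cls[OF s])
  next
    fix q assume q: "p = (case q of (A, B) \<Rightarrow> (cmult s (cls s u) A, B))" "q \<in> splits s v"
    then obtain x y where "v = x @ y" "x \<noteq> []" "y \<noteq> []" "q = (cls s x, cls s y)"
      unfolding splits_def by blast
    then show ?thesis using q(1) l[of "u @ x" y] u by (simp add: quot_mult_cls[OF s])
  next
    assume "p \<in> {(cls s u, cls s v)}"
    then show ?thesis using l[of u v] u v by simp
  qed
qed

text \<open>This form of openness turns a product of limits into an actual cut of any word that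
  represents it; only then do closure under factors and recognizability of words apply.\<close>

definition splits_along :: "('a::finite list \<times> 'a list) set \<Rightarrow> ('a list \<times> 'a list) set \<Rightarrow> bool" where
  "splits_along s r \<longleftrightarrow> r \<subseteq> s \<and> (\<forall>u\<in>Omega all_semigroups. \<forall>v\<in>Omega all_semigroups. \<forall>w. w \<noteq> [] \<longrightarrow>
     Omega_mult all_semigroups u v r = cls r w \<longrightarrow>
     (\<exists>x y. x \<noteq> [] \<and> y \<noteq> [] \<and> w = x @ y \<and> u s = cls s x \<and> v s = cls s y))"

lemma splits_alongD:
  assumes "splits_along s r" "u \<in> Omega all_semigroups" "v \<in> Omega all_semigroups" "w \<noteq> []"
    "Omega_mult all_semigroups u v r = cls r w"
  shows "\<exists>x y. x \<noteq> [] \<and> y \<noteq> [] \<and> w = x @ y \<and> u s = cls s x \<and> v s = cls s y"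
  using assms unfolding splits_along_def by blast

text \<open>Multiplication is an open map.\<close>

lemma factor_words:
  assumes s: "s \<in> congs (all_semigroups :: 'a::finite pseudovariety)"
  shows "\<exists>r\<in>congs all_semigroups. splits_along s r"
proof -
  let ?V = "all_semigroups :: 'a pseudovariety"
  note sc = congsD(1)[OF s] and sf = congsD(2)[OF s]
  \<comment> \<open>Words congruent modulo the kernel of \<open>g\<close> have the same cuts modulo
    \<open>s\<close>, so the cut of \<open>x @ y\<close> between \<open>x\<close> and
    \<open>y\<close> can be carried over to \<open>w\<close>.\<close>
  define g where "g = (\<lambda>w. (cls s w, splits s w))"
  define r where "r = ker_cong g"
  have "word_cong r"
    unfolding r_def by (rule word_cong_ker_cong) (simp add: g_def splits_append[OF sc] quot_mult_cls[OF sc, symmetric])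
  moreover have "g ` free_semigroup \<subseteq> (quots s) \<times> Pow (quots s \<times> quots s)"
    by (auto simp: g_def splits_def intro!: cls_in_quotient)
  then have "finite (quots r)"
    unfolding r_def using sf by (intro finite_ker_cong) (meson finite_Pow_iff finite_SigmaI finite_subset)
  ultimately have r: "r \<in> congs ?V" by (simp add: congs_all_semigroups)
  have rs: "r \<subseteq> s" by (auto simp: r_def ker_cong_def g_def cls_eq_iff[OF sc])
  show ?thesis
    unfolding splits_along_def
  proof (intro bexI[OF _ r] conjI[OF rs] ballI allI impI)
    fix u v w assume uv: "u \<in> Omega ?V" "v \<in> Omega ?V" and w: "w \<noteq> []" "Omega_mult ?V u v r = cls r w"
    obtain x y where xy: "x \<noteq> []" "u r = cls r x" "y \<noteq> []" "v r = cls r y"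
      using Omega_apply(2)[OF uv(1) r] Omega_apply(2)[OF uv(2) r] by blast
    then have "cls r (x @ y) = cls r w" using w(2) Omega_mult_cls[OF r, of x y u v] by simp
    then have "(x @ y, w) \<in> r" using cls_eq_iff[OF congsD(1)[OF r]] xy w(1) by simp
    then have "splits s (x @ y) = splits s w" by (simp add: r_def ker_cong_def g_def)
    moreover have "(cls s x, cls s y) \<in> splits s (x @ y)" using xy by (auto simp: splits_def)
    ultimately obtain x' y' where "w = x' @ y'" "x' \<noteq> []" "y' \<noteq> []" "cls s x = cls s x'" "cls s y = cls s y'"
      by (auto simp: splits_def)
    moreover have "u s = cls s x" "v s = cls s y"
      using Omega_cls_mono[OF uv(1) r s rs] Omega_cls_mono[OF uv(2) r s rs] xy by auto
    ultimately show "\<exists>x y. x \<noteq> [] \<and> y \<noteq> [] \<and> w = x @ y \<and> u s = cls s x \<and> v s = cls s y" by auto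
  qed
qed

section \<open>Finite words are isolated\<close>

text \<open>All words longer than \<open>l\<close> are collapsed to one class, a zero of the
  quotient, while each shorter word is alone in its class.\<close>

definition short_cong :: "nat \<Rightarrow> ('a::finite list \<times> 'a list) set" where
  "short_cong l = ker_cong (\<lambda>w. if length w \<le> l then Some w else None)"

lemma short_cong: "short_cong l \<in> congs all_semigroups"
  unfolding congs_all_semigroups short_cong_def
proof
  let ?g = "\<lambda>w :: 'a list. if length w \<le> l then Some w else None"
  show "word_cong (ker_cong ?g)"
    by (rule word_cong_ker_cong) (auto split: if_splits)
  have "?g ` free_semigroup
      \<subseteq> insert None (Some ` {w. set w \<subseteq> UNIV \<and> length w \<le> l})" by auto
  moreover have "finite {w :: 'a list. set w \<subseteq> UNIV \<and> length w \<le> l}"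
    by (rule finite_lists_length_le) simp
  ultimately show "finite (free_semigroup // ker_cong ?g)"
    by (intro finite_ker_cong) (meson finite_imageI finite_insert finite_subset)
qed

lemma short_cong_iff: "(u, v) \<in> short_cong l \<Longrightarrow> length v \<le> l \<Longrightarrow> u = v"
  by (auto simp: short_cong_def ker_cong_def split: if_splits)

text \<open>The class of a short word is a singleton, so at any finer coordinate the same word must
  represent \<open>f\<close>.\<close>

lemma eq_word_if_short:
  fixes f :: "'a::finite pro"
  assumes f: "f \<in> Omega all_semigroups" and w: "w \<noteq> []" "length w \<le> l"
    and eq: "f (short_cong l) = cls (short_cong l) w"
  shows "f = of_word all_semigroups w"
proof (rule Omega_eqI[OF f])
  let ?V = "all_semigroups :: 'a pseudovariety"
  show "of_word ?V w \<in> Omega ?V" using w by simp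
  fix s assume s: "s \<in> congs ?V"
  define t where "t = short_cong l \<inter> s"
  have t: "t \<in> congs ?V" using directed_all_semigroups short_cong s by (auto simp: t_def directed_def)
  obtain v where v: "v \<noteq> []" "f t = cls t v" using Omega_apply(2)[OF f t] by blast
  have "f (short_cong l) = cls (short_cong l) v" and fs: "f s = cls s v"
    using Omega_cls_mono[OF f t _ _ v] short_cong s by (auto simp: t_def)
  then have "(v, w) \<in> short_cong l"
    using eq cls_eq_iff[OF congsD(1)[OF short_cong] v(1) w(1), of l] by simp
  with fs w(2) s show "f s = of_word ?V w s" using short_cong_iff by (auto simp: of_word_apply)
qed

lemma mult_ne_word:
  assumes f: "f \<in> Omega all_semigroups" and w: "w \<noteq> []"
  shows "Omega_mult all_semigroups f (of_word all_semigroups w) \<noteq> of_word all_semigroups w"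
proof
  let ?r = "short_cong (length w)"
  assume eq: "Omega_mult all_semigroups f (of_word all_semigroups w) = of_word all_semigroups w"
  obtain u where u: "u \<noteq> []" "f ?r = cls ?r u" using Omega_apply(2)[OF f short_cong] by blast
  have "cls ?r (u @ w) = cls ?r w"
    using fun_cong[OF eq, of ?r] Omega_mult_cls[OF short_cong u(1) w, where f = f and g = "of_word all_semigroups w"] u(2)
    by (simp add: of_word_apply[OF short_cong])
  then have "(u @ w, w) \<in> ?r"
    using u w by (subst (asm) cls_eq_iff[OF congsD(1)[OF short_cong]]) auto
  then show False using short_cong_iff[of "u @ w" w] u(1) by auto
qed

text \<open>Identifies words with the same prefix and the same suffix of length \<open>l\<close>;
  the suffix is stored reversed so that one fact about \<open>take\<close> handles both
  ends.\<close>

definition border_cong :: "nat \<Rightarrow> ('a::finite list \<times> 'a list) set" where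
  "border_cong l = ker_cong (\<lambda>w. (take l w, take l (rev w)))"

lemma take_append_take: "take l (u @ v) = take l (take l u @ take l v)"
  by (cases "length u \<le> l") (auto simp: min_def)

lemma border_cong: "border_cong l \<in> congs all_semigroups"
  unfolding congs_all_semigroups border_cong_def
proof
  let ?g = "\<lambda>w :: 'a list. (take l w, take l (rev w))"
  show "word_cong (ker_cong ?g)"
    by (rule word_cong_ker_cong) (metis prod.inject rev_append take_append_take)
  have "?g ` free_semigroup
      \<subseteq> {w. set w \<subseteq> UNIV \<and> length w \<le> l} \<times> {w. set w \<subseteq> UNIV \<and> length w \<le> l}" by auto
  moreover have "finite {w :: 'a list. set w \<subseteq> UNIV \<and> length w \<le> l}"
    by (rule finite_lists_length_le) simp
  ultimately show "finite (free_semigroup // ker_cong ?g)"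
    by (intro finite_ker_cong) (meson finite_SigmaI finite_subset)
qed

section \<open>The closure of the language\<close>

abbreviation lang_cl :: "ab pro set" where
  "lang_cl \<equiv> words_cl psg (language tau)"

lemma pw_language: "w \<in> language tau \<Longrightarrow> pw w \<in> FS"
  by (simp add: language_iff)

text \<open>By \<open>factor_words\<close>, the factorization can be followed on a word of the
  language, and factors of such words are again in the language.\<close>

lemma lang_cl_factor:
  assumes u: "u \<in> FS" and v: "v \<in> FS" and uv: "u \<cdot> v \<in> lang_cl"
  shows "u \<in> lang_cl" and "v \<in> lang_cl"
proof -
  have "\<exists>x y. x \<in> language tau \<and> y \<in> language tau \<and> u s = cls s x \<and> v s = cls s y" if s: "s \<in> congs psg" for s
  proof -
    obtain r where r: "r \<in> congs psg" "splits_along s r" using factor_words[OF s] by blast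
    obtain w where w: "w \<in> language tau" "(u \<cdot> v) r = cls r w" using words_clD[OF uv r(1)] by blast
    then have wne: "w \<noteq> []" by (simp add: language_iff)
    obtain x y where xy: "x \<noteq> []" "y \<noteq> []" "w = x @ y" "u s = cls s x" "v s = cls s y"
      using splits_alongD[OF r(2) u v wne w(2)] by blast
    then have "x \<in> language tau" "y \<in> language tau"
      using language_sublist[OF w(1)] by auto
    with xy show ?thesis by blast
  qed
  then have "\<exists>x\<in>language tau. u s = cls s x" "\<exists>y\<in>language tau. v s = cls s y" if "s \<in> congs psg" for s
    using that by blast+
  then show "u \<in> lang_cl" "v \<in> lang_cl" using u v by (simp_all add: words_clI)
qed

text \<open>The word ab is \<open>tau [La]\<close>, so its image under \<open>phi ^^ n\<close> is an
  image of a single letter under \<open>tau\<close>. This places \<open>Phi_ab\<close> in the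
  closure of the language.\<close>

lemma Phi_ab_approx:
  assumes s: "s \<in> congs psg"
  shows "\<exists>n\<ge>j. Phi (pw [La, Lb]) s = cls s ((tau ^^ Suc (2 * n)) [La])"
proof -
  obtain n where n: "n \<ge> j" "Phi (pw [La, Lb]) s = (phi_hat ^^ n) (pw [La, Lb]) s"
    using om_approx[OF psg_dir pro_endo_phi_hat _ s, of "pw [La, Lb]" j] unfolding Phi_def by auto
  have "(phi ^^ n) [La, Lb] = (tau ^^ Suc (2 * n)) [La]"
    unfolding phin_taun funpow_Suc_right by simp
  with n s show ?thesis by (auto simp: phi_hat_funpow_word of_word_apply)
qed

abbreviation Phi_ab :: "ab pro" where
  "Phi_ab \<equiv> Phi (pw [La, Lb])"

lemma Phi_ab_in: "Phi_ab \<in> fix_grp"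
  by (rule Phi_in_fix_grp[OF pw_returns[OF returns_base(1)]])

lemma Phi_ab_lang_cl: "Phi_ab \<in> lang_cl"
proof (rule words_clI)
  show "Phi_ab \<in> FS" using Phi_ab_in fix_grp_Omega by blast
  fix r assume "r \<in> congs psg"
  from Phi_ab_approx[OF this] show "\<exists>w\<in>language tau. Phi_ab r = cls r w"
    using language_taun by metis
qed

text \<open>Words of \<open>returns\<close> may lie outside the language. In a group, however, every
  element divides \<open>Phi_ab\<close>, and the closure of the language contains all factors of its
  elements.\<close>

lemma fix_grp_lang_cl:
  assumes k: "k \<in> fix_grp"
  shows "k \<in> lang_cl"
proof -
  obtain v where "v \<in> fix_grp" "k \<cdot> v = Phi_ab"
    using is_group_solvable(1)[OF is_group_fix_grp k Phi_ab_in] by blast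
  then show ?thesis
    using lang_cl_factor(1)[of k v] Phi_ab_lang_cl k fix_grp_Omega by auto
qed

lemma phin_hd_last:
  assumes d: "d \<in> returns"
  shows "take (2 ^ (2 * n)) ((phi ^^ n) d) = (phi ^^ n) [La]"
    and "take (2 ^ (2 * n)) (rev ((phi ^^ n) d)) = rev ((phi ^^ n) [Lb])"
proof -
  obtain x where x: "d = [La] @ x" using returns_hd_last[OF d] returns_ne[OF d] by (cases d) auto
  show "take (2 ^ (2 * n)) ((phi ^^ n) d) = (phi ^^ n) [La]"
    unfolding x phin_append by (simp add: phin_taun)
  obtain y where y: "d = y @ [Lb]" using returns_hd_last[OF d] returns_ne[OF d] by (metis append_butlast_last_id)
  show "take (2 ^ (2 * n)) (rev ((phi ^^ n) d)) = rev ((phi ^^ n) [Lb])"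
    unfolding y phin_append by (simp add: phin_taun)
qed

text \<open>A word of the language near \<open>h = h e\<close> is cut as \<open>p @ w @ q\<close>,
  with \<open>p\<close> and \<open>q\<close> near \<open>e\<close> and \<open>w\<close> near
  \<open>h\<close>. Since \<open>e\<close> is near images under \<open>phi ^^ j\<close>, the borders
  of \<open>p\<close>, \<open>w\<close> and \<open>q\<close> are those required by
  \<open>desubstitute\<close>, and \<open>w\<close> is itself such an image. As \<open>j\<close> is
  arbitrary, \<open>om_fixed_approx\<close> shows that \<open>h\<close> is fixed by
  \<open>Phi\<close>.\<close>

lemma fix_grp_recognize:
  assumes e: "e \<in> fix_grp" and h: "h \<in> lang_cl" and eh: "e \<cdot> h = h" and he: "h \<cdot> e = h"
  shows "h \<in> fix_grp"
proof -
  have eO: "e \<in> FS" and hO: "h \<in> FS" using e fix_grp_Omega h cl_subset_Omega by blast+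
  have key: "\<exists>v\<in>returns. h s = cls s ((phi ^^ j) v)" if s: "s \<in> congs psg" for s j
  proof -
    define l where "l = (2::nat) ^ (2 * j)"
    \<comment> \<open>\<open>l\<close> is the length of the images of letters under
      \<open>phi ^^ j\<close>, so words congruent modulo \<open>s'\<close> have the same borders of
      that length.\<close>
    define s' where "s' = s \<inter> border_cong l"
    have s': "s' \<in> congs psg" using psg_dir s border_cong by (auto simp: s'_def directed_def)
    \<comment> \<open>Two nested refinements for two cuts: first \<open>h = h e\<close> splits off
      \<open>q\<close>, then \<open>h = e h\<close> splits off \<open>p\<close>.\<close>
    obtain r where r: "r \<in> congs psg" "splits_along s' r" using factor_words[OF s'] by blast
    obtain r2 where r2: "r2 \<in> congs psg" "splits_along r r2" using factor_words[OF r(1)] by blast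
    obtain w0 where w0: "w0 \<in> language tau" "h r2 = cls r2 w0" using words_clD[OF h r2(1)] by blast
    then have "w0 \<noteq> []" "(h \<cdot> e) r2 = cls r2 w0" using he by (auto simp: language_iff)
    from splits_alongD[OF r2(2) hO eO this] obtain x q where
      xq: "x \<noteq> []" "q \<noteq> []" "w0 = x @ q" "h r = cls r x" "e r = cls r q" by blast
    then have "(e \<cdot> h) r = cls r x" using eh by simp
    from splits_alongD[OF r(2) eO hO xq(1) this] obtain p w where
      pw: "p \<noteq> []" "w \<noteq> []" "x = p @ w" "e s' = cls s' p" "h s' = cls s' w" by blast
    have eq: "e s' = cls s' q"
      using Omega_cls_mono[OF eO r(1) s' _ xq(2,5)] r(2) by (simp add: splits_along_def)
    obtain d n where dn: "d \<in> returns" "n \<ge> j" "e s' = cls s' ((phi ^^ n) d)"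
      using fix_grp_approx[OF e s', of j] by blast
    define D where "D = (phi ^^ (n - j)) d"
    have D: "D \<in> returns" using phin_returns[OF dn(1)] by (simp add: D_def)
    have eD: "e s' = cls s' ((phi ^^ j) D)"
      using dn(2,3) unfolding D_def by (metis comp_apply funpow_add le_add_diff_inverse)
    have Dne: "(phi ^^ j) D \<noteq> []" using returns_ne[OF D] by (simp add: phin_ne)
    have bord: "take l a = take l b \<and> take l (rev a) = take l (rev b)"
      if "cls s' a = cls s' b" "a \<noteq> []" "b \<noteq> []" for a b
    proof -
      have "(a, b) \<in> border_cong l" using that cls_eq_iff[OF congsD(1)[OF s']] by (auto simp: s'_def)
      then show ?thesis by (simp add: border_cong_def ker_cong_def)
    qed
    have la: "take l ((phi ^^ j) D) = (phi ^^ j) [La]" and lb: "take l (rev ((phi ^^ j) D)) = rev ((phi ^^ j) [Lb])"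
      using phin_hd_last[OF D] by (auto simp: l_def)
    have len: "length ((phi ^^ j) [La]) = l" "length ((phi ^^ j) [Lb]) = l" by (simp_all add: phin_taun l_def)
    have pre: "prefix ((phi ^^ j) [La]) a" if "take l a = (phi ^^ j) [La]" for a
      using that by (metis take_is_prefix)
    have suf: "suffix ((phi ^^ j) [Lb]) a" if "take l (rev a) = rev ((phi ^^ j) [Lb])" for a
      using that by (metis suffix_to_prefix rev_rev_ident take_is_prefix)
    have lenD: "length ((phi ^^ j) D) \<ge> l" using len(1) la by (metis length_take min.cobounded1)
    have "suffix ((phi ^^ j) [Lb]) p" using suf bord[of p "(phi ^^ j) D"] pw eD Dne lb by simp
    moreover have "prefix ((phi ^^ j) [La]) q" using pre bord[of q "(phi ^^ j) D"] xq eq eD Dne la by simp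
    \<comment> \<open>\<open>w\<close> could a priori be short; because of \<open>e h = h\<close>
      its borders are also those of a word that begins with \<open>(phi ^^ j) D\<close>.\<close>
    moreover have "cls s' w = cls s' ((phi ^^ j) D @ w)"
      using Omega_mult_cls[OF s' Dne pw(2), where f = e and g = h] eD pw(5) eh by simp
    then have "prefix ((phi ^^ j) [La]) w"
      using pre bord[of w "(phi ^^ j) D @ w"] pw la lenD by simp
    moreover have "cls s' w = cls s' (w @ (phi ^^ j) D)"
      using Omega_mult_cls[OF s' pw(2) Dne, where f = h and g = e] eD pw(5) he by simp
    then have "suffix ((phi ^^ j) [Lb]) w"
      using suf bord[of w "w @ (phi ^^ j) D"] pw lb lenD by simp
    moreover have "p @ w @ q \<in> language tau" using w0(1) xq(3) pw(3) by simp
    ultimately obtain v where "v \<in> returns" "w = (phi ^^ j) v" using desubstitute by blast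
    moreover have "h s = cls s w"
      using Omega_cls_mono[OF hO s' s _ pw(2,5)] by (simp add: s'_def)
    ultimately show ?thesis by blast
  qed
  have "h \<in> returns_cl"
    by (rule words_clI[OF hO]) (use key[of _ 0] in auto)
  moreover have "Phi h = h"
    unfolding Phi_def
  proof (rule om_fixed_approx[OF psg_dir pro_endo_phi_hat hO])
    fix r j assume r: "r \<in> congs psg"
    obtain v where v: "v \<in> returns" "h r = cls r ((phi ^^ j) v)" using key[OF r] by blast
    then show "\<exists>f\<in>FS. h r = (phi_hat ^^ j) f r"
      using returns_ne r by (intro bexI[of _ "pw v"]) (auto simp: phi_hat_funpow_word of_word_apply)
  qed
  ultimately show ?thesis by (simp add: fix_grp_def)
qed

lemma J_class_tau: "J_class tau = lang_cl - pw ` language tau"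
proof -
  have "pw ` language tau \<subseteq> FS" using pw_language by blast
  then show ?thesis by (simp add: J_class_def closure_of_Omega_top[OF psg_dir])
qed

lemma group_word_disjoint:
  assumes K: "K \<subseteq> FS" "is_group K (Omega_mult psg)" and w: "w \<noteq> []"
  shows "pw w \<notin> K"
proof
  assume "pw w \<in> K"
  moreover obtain e where "e \<in> K" "\<And>u. u \<in> K \<Longrightarrow> e \<cdot> u = u"
    using K(2) by (rule is_groupE) (rule that; assumption)
  ultimately show False using mult_ne_word[of e w] K(1) w by auto
qed

text \<open>A larger group has the same unit \<open>e\<close>. Its elements divide \<open>e\<close>,
  hence lie in the closure of the language, and \<open>fix_grp_recognize\<close> returns them to
  \<open>fix_grp\<close>.\<close>

lemma fix_grp_maximal: "fix_grp \<in> schuetzenberger_groups tau"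
proof -
  have "fix_grp \<subseteq> J_class tau"
    unfolding J_class_tau
    using fix_grp_lang_cl group_word_disjoint[OF fix_grp_Omega is_group_fix_grp]
    by (auto simp: language_iff)
  moreover have "K = fix_grp"
    if K: "fix_grp \<subseteq> K" "K \<subseteq> FS" "is_group K (Omega_mult psg)" for K
  proof -
    obtain e where e: "e \<in> fix_grp" "\<And>u. u \<in> fix_grp \<Longrightarrow> e \<cdot> u = u"
      using is_group_fix_grp by (rule is_groupE) (rule that; assumption)
    obtain f where sg: "semigroup_on K (Omega_mult psg)"
      and f: "f \<in> K" "\<And>u. u \<in> K \<Longrightarrow> f \<cdot> u = u" "\<And>u. u \<in> K \<Longrightarrow> u \<cdot> f = u"
        "\<And>u. u \<in> K \<Longrightarrow> \<exists>v\<in>K. u \<cdot> v = f \<and> v \<cdot> u = f"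
      using K(3) by (rule is_groupE) (rule that; assumption)
    have eK: "e \<in> K" using e K by blast
    obtain i where i: "i \<in> K" "i \<cdot> e = f" using f(4)[OF eK] by blast
    \<comment> \<open>The only idempotent of a group is its unit.\<close>
    have "e = f" using semigroup_onD(2)[OF sg i(1) eK eK] i(2) e(2)[OF e(1)] f(2)[OF eK] by simp
    have "h \<in> fix_grp" if h: "h \<in> K" for h
    proof -
      obtain h' where h': "h' \<in> K" "h \<cdot> h' = f" using f(4)[OF h] by blast
      then have "h \<in> lang_cl"
        using lang_cl_factor(1)[of h h'] fix_grp_lang_cl[OF e(1)] \<open>e = f\<close> K(2) h by auto
      then show ?thesis
        using fix_grp_recognize[OF e(1)] f(2,3)[OF h] \<open>e = f\<close> by simp
    qed
    then show ?thesis using K(1) by blast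
  qed
  ultimately show ?thesis
    unfolding schuetzenberger_groups_def maximal_subgroup_def
    using fix_grp_Omega is_group_fix_grp by blast
qed

section \<open>All maximal subgroups in the J-class are conjugate\<close>

text \<open>Stability of finite semigroups: an idempotent \<open>G\<close> below \<open>E\<close>
  that is also a factor of \<open>E\<close> equals \<open>E\<close>. In the local monoid
  \<open>M\<close> at \<open>E\<close>, \<open>m u w = E\<close> makes left translation by
  \<open>w\<close> injective, hence surjective, so that \<open>m w u = E\<close>; as
  \<open>w\<close> absorbs \<open>G\<close> on the left, so does \<open>E\<close>.\<close>

lemma finite_stability:
  assumes fin: "finite X" and sg: "semigroup_on X m"
    and X: "E \<in> X" "G \<in> X" "U \<in> X" "V \<in> X" and E: "E = m U (m G V)"
    and idem: "m E E = E" "m G G = G" and le: "m E G = G" "m G E = G"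
  shows "E = G"
proof -
  note cl = semigroup_onD(1)[OF sg] and as = semigroup_onD(2)[OF sg]
  define M where "M = {t \<in> X. m E t = t \<and> m t E = t}"
  define u where "u = m E (m U E)"
  define w where "w = m G (m V E)"
  have EM: "E \<in> M" using X idem by (simp add: M_def)
  have uX: "u \<in> X" and wX: "w \<in> X" using X cl by (simp_all add: u_def w_def)
  have Ew: "m E w = w" using as[of E G "m V E"] X cl le by (simp add: w_def)
  have wE: "m w E = w" using as[of G "m V E" E] as[of V E E] X cl idem by (simp add: w_def)
  have Gw: "m G w = w" using as[of G G "m V E"] X cl idem by (simp add: w_def)
  have uE: "m u E = u" using as[of E "m U E" E] as[of U E E] X cl idem by (simp add: u_def)
  have "m u w = m E (m U (m E w))"
    using as[of E "m U E" w] as[of U E w] X cl wX by (simp add: u_def)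
  also have "\<dots> = m E (m (m U (m G V)) E)"
    unfolding Ew unfolding w_def using as[of U "m G V" E] as[of G V E] X cl by simp
  also have "\<dots> = E" using idem E by simp
  finally have uw: "m u w = E" .
  have wM: "m w t \<in> M" if "t \<in> M" for t
    using that as[of E w t] as[of w t E] X wX cl Ew by (simp add: M_def)
  have "inj_on (m w) M"
  proof (rule inj_onI)
    fix t t' assume t: "t \<in> M" "t' \<in> M" "m w t = m w t'"
    have "m u (m w t) = t" if "t \<in> M" for t using that as[of u w t] uX wX uw by (simp add: M_def)
    with t show "t = t'" by metis
  qed
  then have "m w ` M = M"
    using fin wM by (intro endo_inj_surj) (auto simp: M_def)
  then obtain t where t: "t \<in> M" "m w t = E" using EM by (metis imageE)
  have "u = t"
    using as[of u w t] uX wX uw uE t by (simp add: M_def)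
  then have "m w u = E" using t by simp
  then have "m G E = E" using as[of G w u] X uX wX Gw by simp
  with le show ?thesis by simp
qed

lemma continuous_map_sandwich:
  assumes V: "directed V" and k: "k \<in> Omega V"
  shows "continuous_map (prod_topology (Omega_top V) (Omega_top V)) (Omega_top V)
    (\<lambda>(x, y). Omega_mult V x (Omega_mult V k y))"
  unfolding continuous_map
proof (intro conjI allI impI)
  let ?T = "prod_topology (Omega_top V) (Omega_top V)"
  let ?f = "\<lambda>(x, y). Omega_mult V x (Omega_mult V k y)"
  show "?f ` topspace ?T \<subseteq> topspace (Omega_top V)"
    using k by auto
  fix U assume U: "openin (Omega_top V) U"
  let ?S = "{p \<in> topspace ?T. ?f p \<in> U}"
  show "openin ?T
      ?S"
    unfolding openin_prod_topology_alt
  proof (intro allI impI)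
    fix x y assume "(x, y) \<in> ?S"
    then have xy: "x \<in> Omega V" "y \<in> Omega V" "?f (x, y) \<in> U" by auto
    obtain r where r: "r \<in> congs V" "\<And>g. g \<in> Omega V \<Longrightarrow> g r = ?f (x, y) r \<Longrightarrow> g \<in> U"
      using U xy(3) openin_Omega_top[OF V] by meson
    define N where "N = (\<lambda>x. {g \<in> Omega V. g r = x r})"
    have "openin (Omega_top V) (N x)" for x
      unfolding openin_Omega_top[OF V] N_def using r(1) by auto
    moreover have "x \<in> N x" "y \<in> N y" using xy by (auto simp: N_def)
    moreover have "N x \<times> N y \<subseteq> ?S"
    proof
      fix p assume "p \<in> N x \<times> N y"
      then obtain x' y' where p: "p = (x', y')" "x' \<in> Omega V" "y' \<in> Omega V" "x' r = x r" "y' r = y r"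
        by (auto simp: N_def)
      then have "?f p r = ?f (x, y) r" using r(1) by (simp add: Omega_mult_apply)
      then have "?f p \<in> U" using r(2)[of "?f p"] p k by simp
      with p show "p \<in> ?S" by simp
    qed
    ultimately show "\<exists>U' V'. openin (Omega_top V) U' \<and> openin (Omega_top V) V' \<and> x \<in> U' \<and> y \<in> V' \<and>
        U' \<times> V' \<subseteq> ?S"
      by blast
  qed
qed

text \<open>The analogue of \<open>unif_solve\<close> for two unknowns: the set of products with
  middle factor \<open>k\<close> is compact, hence closed.\<close>

lemma factor_compact:
  assumes V: "directed V" and k: "k \<in> Omega V" and f: "f \<in> Omega V"
    and sol: "\<And>s. s \<in> congs V \<Longrightarrow> \<exists>x\<in>Omega V. \<exists>y\<in>Omega V. f s = Omega_mult V x (Omega_mult V k y) s"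
  shows "\<exists>x\<in>Omega V. \<exists>y\<in>Omega V. f = Omega_mult V x (Omega_mult V k y)"
proof -
  let ?f = "\<lambda>(x, y). Omega_mult V x (Omega_mult V k y)"
  have "compactin (prod_topology (Omega_top V) (Omega_top V)) (Omega V \<times> Omega V)"
    using compact_space_prod_topology[of "Omega_top V" "Omega_top V"] compact_Omega_top[of V]
    by (auto simp: compact_space_def)
  from image_compactin[OF this continuous_map_sandwich[OF V k]]
  have "closedin (Omega_top V) (?f ` (Omega V \<times> Omega V))"
    by (rule compactin_imp_closedin[OF Hausdorff_Omega_top])
  moreover have "?f ` (Omega V \<times> Omega V) \<subseteq> Omega V" using k by auto
  ultimately have "cl V (?f ` (Omega V \<times> Omega V)) \<subseteq> ?f ` (Omega V \<times> Omega V)"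
    using closedin_iff_cl[OF V] by blast
  moreover have "f \<in> cl V (?f ` (Omega V \<times> Omega V))"
  proof (rule clI[OF f])
    fix r assume "r \<in> congs V"
    from sol[OF this] show "\<exists>g\<in>?f ` (Omega V \<times> Omega V). f r = g r" by force
  qed
  ultimately have "f \<in> ?f ` (Omega V \<times> Omega V)" by blast
  then show ?thesis by auto
qed

text \<open>Words approximating \<open>f\<close> become arbitrarily long, hence contain by
  recurrence the images of a letter that approximate \<open>Phi_ab\<close>.\<close>

lemma lang_cl_has_factor_Phi_ab:
  assumes f: "f \<in> lang_cl" and nw: "\<And>w. w \<noteq> [] \<Longrightarrow> f \<noteq> pw w"
  shows "\<exists>x\<in>FS. \<exists>y\<in>FS. f = x \<cdot> (Phi_ab \<cdot> y)"
proof (rule factor_compact[OF psg_dir])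
  show "Phi_ab \<in> FS" using Phi_ab_in fix_grp_Omega by blast
  show fO: "f \<in> FS" using f cl_subset_Omega by blast
  fix s assume s: "s \<in> congs psg"
  obtain n where n: "Phi_ab s = cls s ((tau ^^ Suc (2 * n)) [La])" using Phi_ab_approx[OF s] by blast
  obtain l where l: "\<forall>w\<in>language tau. length w > l \<longrightarrow>
      (\<exists>x y. x \<noteq> [] \<and> y \<noteq> [] \<and> w = x @ (tau ^^ Suc (2 * n)) [La] @ y)"
    using language_recurrent[of "Suc (2 * n)" La] by blast
  \<comment> \<open>The additional congruence excludes representatives of length at most
    \<open>l\<close>: with such a representative, \<open>f\<close> would be a finite word.\<close>
  define t where "t = short_cong l \<inter> s"
  have t: "t \<in> congs psg" using psg_dir short_cong s by (auto simp: t_def directed_def)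
  obtain w where w: "w \<in> language tau" "f t = cls t w" using words_clD[OF f t] by blast
  have wne: "w \<noteq> []" using w(1) by (simp add: language_iff)
  have fl: "f (short_cong l) = cls (short_cong l) w" and fs: "f s = cls s w"
    using Omega_cls_mono[OF fO t _ _ wne w(2)] short_cong s by (auto simp: t_def)
  have "length w > l" using eq_word_if_short[OF fO wne _ fl] nw[OF wne] by (meson not_le)
  then obtain x y where xy: "x \<noteq> []" "y \<noteq> []" "w = x @ (tau ^^ Suc (2 * n)) [La] @ y"
    using l w(1) by blast
  have "f s = Omega_mult psg (pw x) (Phi_ab \<cdot> (pw y)) s"
    unfolding fs xy(3) using s xy(1,2) n
    by (simp add: Omega_mult_apply of_word_apply quot_mult_cls[OF congsD(1)[OF s]] del: funpow.simps)
  moreover have "pw x \<in> FS" "pw y \<in> FS" using xy(1,2) by simp_all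
  ultimately show "\<exists>x\<in>FS. \<exists>y\<in>FS. f s = (x \<cdot> (Phi_ab \<cdot> y)) s"
    by (intro bexI)
qed

text \<open>Conversely, every word of the language occurs in late images of letters. Divisibility at
  each coordinate suffices, because stability is applied in finite quotients.\<close>

lemma Phi_ab_has_factor:
  assumes f: "f \<in> lang_cl" and s: "s \<in> congs psg"
  shows "\<exists>x\<in>FS. \<exists>y\<in>FS. Phi_ab s = (x \<cdot> (f \<cdot> y)) s"
proof -
  obtain w where w: "w \<in> language tau" "f s = cls s w" using words_clD[OF f s] by blast
  have wne: "w \<noteq> []" using w(1) by (simp add: language_iff)
  obtain K where K: "\<And>k c. k \<ge> K \<Longrightarrow> sublist w ((tau ^^ k) [c])"
    using w(1) by (auto simp: language_def)
  obtain n where n: "n \<ge> Suc K" "Phi_ab s = cls s ((tau ^^ Suc (2 * n)) [La])"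
    using Phi_ab_approx[OF s] by blast
  \<comment> \<open>With this \<open>m\<close>, the image of a at exponent \<open>m + 2\<close> is
    \<open>tau ^^ m\<close> applied to abba; \<open>w\<close> is located in the image of the first
    b, so neither outer factor is empty.\<close>
  define m where "m = 2 * n - 1"
  have m: "Suc (2 * n) = m + 2" "m \<ge> K" using n(1) by (auto simp: m_def)
  have abba: "(tau ^^ 2) [La] = [La] @ [Lb] @ [Lb, La]" by (simp add: eval_nat_numeral)
  obtain p q where pq: "(tau ^^ m) [Lb] = p @ w @ q" using K[OF m(2), of Lb] by (auto simp: sublist_def)
  let ?x = "(tau ^^ m) [La] @ p" and ?y = "q @ (tau ^^ m) [Lb, La]"
  have "(tau ^^ Suc (2 * n)) [La] = ?x @ w @ ?y"
    unfolding m(1) taun_add abba taun_append pq by simp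
  moreover have "?x \<noteq> []" "?y \<noteq> []" by simp_all
  ultimately have "Phi_ab s = Omega_mult psg (pw ?x) (f \<cdot> (pw ?y)) s" "pw ?x \<in> FS" "pw ?y \<in> FS"
    using n(2) s w(2) wne
    by (simp_all add: Omega_mult_apply of_word_apply quot_mult_cls[OF congsD(1)[OF s]] del: funpow.simps)
  then show ?thesis by blast
qed

text \<open>The unit \<open>f\<close> of \<open>H\<close> and the unit \<open>e\<close> of
  \<open>fix_grp\<close> divide each other, at least at every coordinate. Stability refines this to
  \<open>f = b a\<close> and \<open>e = a b\<close>, and conjugation by \<open>a\<close> and
  \<open>b\<close> is then an isomorphism between the groups at \<open>e\<close> and at
  \<open>f\<close>.\<close>

lemma schuetzenberger_group_conjugate:
  assumes H: "H \<in> schuetzenberger_groups tau"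
  obtains a b where "a \<in> FS" "b \<in> FS" "(\<lambda>k. b \<cdot> k \<cdot> a) ` fix_grp = H"
    "\<And>k k'. k \<in> fix_grp \<Longrightarrow> k' \<in> fix_grp \<Longrightarrow> (b \<cdot> k \<cdot> a) \<cdot> (b \<cdot> k' \<cdot> a) = b \<cdot> (k \<cdot> k') \<cdot> a"
    "\<And>k. k \<in> fix_grp \<Longrightarrow> a \<cdot> (b \<cdot> k \<cdot> a) \<cdot> b = k"
proof -
  have HJ: "H \<subseteq> lang_cl" and HO: "H \<subseteq> FS" and Hg: "is_group H (Omega_mult psg)"
    and max: "\<And>K. H \<subseteq> K \<Longrightarrow> K \<subseteq> FS \<Longrightarrow> is_group K (Omega_mult psg) \<Longrightarrow> K = H"
    using H unfolding schuetzenberger_groups_def J_class_tau maximal_subgroup_def by blast+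
  note cl = Omega_mult_in_Omega[where V = psg] and as = Omega_mult_assoc[where V = psg]
  obtain f where f: "f \<in> H" "\<And>u. u \<in> H \<Longrightarrow> f \<cdot> u = u" "\<And>u. u \<in> H \<Longrightarrow> u \<cdot> f = u"
    "\<And>u. u \<in> H \<Longrightarrow> \<exists>v\<in>H. u \<cdot> v = f \<and> v \<cdot> u = f"
    using Hg by (rule is_groupE) (rule that; assumption)
  obtain e where sgK: "semigroup_on fix_grp (Omega_mult psg)"
    and e: "e \<in> fix_grp" "\<And>u. u \<in> fix_grp \<Longrightarrow> e \<cdot> u = u" "\<And>u. u \<in> fix_grp \<Longrightarrow> u \<cdot> e = u"
    "\<And>u. u \<in> fix_grp \<Longrightarrow> \<exists>v\<in>fix_grp. u \<cdot> v = e \<and> v \<cdot> u = e"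
    using is_group_fix_grp by (rule is_groupE) (rule that; assumption)
  have fO: "f \<in> FS" and eO: "e \<in> FS" and pO: "Phi_ab \<in> FS"
    using f(1) HO e(1) fix_grp_Omega Phi_ab_in by auto
  have ff: "f \<cdot> f = f" and ee: "e \<cdot> e = e" using f e by auto
  have nw: "f \<noteq> pw w" if "w \<noteq> []" for w using group_word_disjoint[OF HO Hg that] f(1) by auto
  obtain x y0 where xy0: "x \<in> FS" "y0 \<in> FS" "f = x \<cdot> (Phi_ab \<cdot> y0)"
    using lang_cl_has_factor_Phi_ab[OF _ nw] f(1) HJ by blast
  define y where "y = Phi_ab \<cdot> y0"
  have yO: "y \<in> FS" and ey: "e \<cdot> y = y"
    using xy0 pO as[OF eO pO xy0(2)] e(2)[OF Phi_ab_in] by (simp_all add: y_def)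
  have fxy: "f = x \<cdot> y" using xy0 by (simp add: y_def)
  note O = fO eO xy0(1) yO
  have as': "(u \<cdot> v) \<cdot> w = u \<cdot> (v \<cdot> w)" if "u \<in> FS" "v \<in> FS" "w \<in> FS" for u v w
    using as that by blast
  have eyt: "e \<cdot> (y \<cdot> t) = y \<cdot> t" and eet: "e \<cdot> (e \<cdot> t) = e \<cdot> t" and fft: "f \<cdot> (f \<cdot> t) = f \<cdot> t"
    and xyt: "x \<cdot> (y \<cdot> t) = f \<cdot> t" if "t \<in> FS" for t
    using as'[OF eO yO that] as'[OF eO eO that] as'[OF fO fO that] as'[OF xy0(1) yO that] ey ee ff fxy that
    by simp_all
  \<comment> \<open>\<open>x\<close> and \<open>y\<close> are cut down so that \<open>b\<close> goes
    from \<open>e\<close> to \<open>f\<close> and \<open>a\<close> goes back. The relation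
    \<open>b a = f\<close> is immediate; \<open>a b = e\<close> needs stability.\<close>
  define b where "b = f \<cdot> (x \<cdot> e)"
  define a where "a = y \<cdot> f"
  have aO: "a \<in> FS" and bO: "b \<in> FS" using O by (simp_all add: a_def b_def)
  have ba: "b \<cdot> a = f"
    using O by (simp add: a_def b_def as' eyt xyt ff fft)
  have ea: "e \<cdot> a = a" and af: "a \<cdot> f = a" and be: "b \<cdot> e = b" and fb: "f \<cdot> b = b"
    using O by (simp_all add: a_def b_def as' eyt ee ff fft)
  define g where "g = a \<cdot> b"
  have gO: "g \<in> FS" using aO bO by (simp add: g_def)
  have eg: "e \<cdot> g = g" and ge: "g \<cdot> e = g" using as'[OF eO aO bO] as'[OF aO bO eO] ea be by (simp_all add: g_def)
  have gg: "g \<cdot> g = g"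
    using as'[OF aO bO gO] as'[OF bO aO bO] ba fb aO bO by (simp add: g_def)
  have xgy: "x \<cdot> (g \<cdot> y) = f"
  proof -
    have "x \<cdot> (g \<cdot> y) = x \<cdot> (y \<cdot> (f \<cdot> (f \<cdot> (x \<cdot> (e \<cdot> y)))))"
      using O by (simp add: g_def a_def b_def as')
    also have "\<dots> = f" using O by (simp add: ey xyt fxy[symmetric] fft ff)
    finally show ?thesis .
  qed
  \<comment> \<open>\<open>g\<close> is an idempotent below \<open>e\<close>. At each coordinate
    \<open>e\<close> is a multiple of \<open>Phi_ab\<close>, hence of \<open>f = x g y\<close>, so
    that \<open>g\<close> is a factor of \<open>e\<close> and \<open>finite_stability\<close>
    applies.\<close>
  have "e = g"
  proof (rule Omega_eqI[OF eO gO])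
    fix s assume s: "s \<in> congs psg"
    obtain u v where uv: "u \<in> FS" "v \<in> FS" "Phi_ab s = (u \<cdot> (f \<cdot> v)) s"
      using Phi_ab_has_factor[OF _ s] f(1) HJ by blast
    obtain i where i: "i \<in> fix_grp" "Phi_ab \<cdot> i = e" using e(4)[OF Phi_ab_in] by blast
    have iO: "i \<in> FS" using i fix_grp_Omega by blast
    define U where "U = u \<cdot> x"
    define W where "W = y \<cdot> (v \<cdot> i)"
    have UW: "U \<in> FS" "W \<in> FS" using uv iO O by (simp_all add: U_def W_def)
    have "e s = ((u \<cdot> (f \<cdot> v)) \<cdot> i) s" using uv(3) i(2) s by (metis Omega_mult_apply)
    also have "(u \<cdot> (f \<cdot> v)) \<cdot> i = u \<cdot> ((x \<cdot> (g \<cdot> y)) \<cdot> (v \<cdot> i))"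
      unfolding xgy using uv iO O by (simp add: as')
    also have "\<dots> = U \<cdot> (g \<cdot> W)"
      using uv iO O gO by (simp add: as' U_def W_def)
    finally have es: "e s = (U \<cdot> (g \<cdot> W)) s" .
    show "e s = g s"
    proof (rule finite_stability[OF congsD(2)[OF s] semigroup_on_quot[OF congsD(1)[OF s]]])
      show "e s \<in> quots s" "g s \<in> quots s" "U s \<in> quots s" "W s \<in> quots s"
        using Omega_apply(1)[OF _ s] eO gO UW by auto
      show "e s = cmult s (U s) (cmult s (g s) (W s))"
        using es by (simp add: Omega_mult_apply s)
      show "cmult s (e s) (e s) = e s" "cmult s (g s) (g s) = g s"
        "cmult s (e s) (g s) = g s" "cmult s (g s) (e s) = g s"
        using ee gg eg ge by (metis Omega_mult_apply s)+
    qed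
  qed
  then have ab: "a \<cdot> b = e" by (simp add: g_def)
  have kO: "k \<in> FS" if "k \<in> fix_grp" for k using that fix_grp_Omega by blast
  have abt: "a \<cdot> (b \<cdot> t) = e \<cdot> t" and bat: "b \<cdot> (a \<cdot> t) = f \<cdot> t" and fbt: "f \<cdot> (b \<cdot> t) = b \<cdot> t"
    if "t \<in> FS" for t
    using as'[OF aO bO that] as'[OF bO aO that] as'[OF fO bO that] ab ba fb by simp_all
  have hom: "(b \<cdot> k \<cdot> a) \<cdot> (b \<cdot> k' \<cdot> a) = b \<cdot> (k \<cdot> k') \<cdot> a" if k: "k \<in> fix_grp" "k' \<in> fix_grp" for k k'
  proof -
    have "(b \<cdot> k \<cdot> a) \<cdot> (b \<cdot> k' \<cdot> a) = b \<cdot> (k \<cdot> (e \<cdot> (k' \<cdot> a)))"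
      using kO[OF k(1)] kO[OF k(2)] aO bO by (simp add: as' abt)
    also have "e \<cdot> (k' \<cdot> a) = k' \<cdot> a"
      using as'[OF eO kO[OF k(2)] aO] e(2)[OF k(2)] by simp
    finally show ?thesis using kO[OF k(1)] kO[OF k(2)] aO bO by (simp add: as')
  qed
  have retr: "a \<cdot> (b \<cdot> k \<cdot> a) \<cdot> b = k" if k: "k \<in> fix_grp" for k
    using kO[OF k] aO bO eO by (simp add: as' abt ab e(2)[OF k] e(3)[OF k])
  define K' where "K' = (\<lambda>k. b \<cdot> k \<cdot> a) ` fix_grp"
  have K'O: "K' \<subseteq> FS" using kO aO bO by (auto simp: K'_def)
  have bea: "b \<cdot> e \<cdot> a = f" using be ba by simp
  have K'g: "is_group K' (Omega_mult psg)"
  proof (rule is_groupI_unit)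
    show "semigroup_on K' (Omega_mult psg)"
      unfolding semigroup_on_def
    proof (intro conjI ballI)
      fix u v assume "u \<in> K'" "v \<in> K'"
      then show "u \<cdot> v \<in> K'" using hom semigroup_onD(1)[OF sgK] by (auto simp: K'_def)
    next
      fix u v w assume "u \<in> K'" "v \<in> K'" "w \<in> K'"
      then show "u \<cdot> v \<cdot> w = u \<cdot> (v \<cdot> w)" using K'O by (intro as') auto
    qed
    show "f \<in> K'" using bea e(1) by (auto simp: K'_def)
    show "f \<cdot> u = u \<and> u \<cdot> f = u" if u: "u \<in> K'" for u
    proof -
      obtain k where k: "k \<in> fix_grp" "u = b \<cdot> k \<cdot> a" using u by (auto simp: K'_def)
      then show ?thesis using hom[OF e(1) k(1)] hom[OF k(1) e(1)] e(2,3)[OF k(1)] by (simp add: bea)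
    qed
    show "\<exists>v\<in>K'. v \<cdot> u = f" if u: "u \<in> K'" for u
    proof -
      obtain k where k: "k \<in> fix_grp" "u = b \<cdot> k \<cdot> a" using u by (auto simp: K'_def)
      obtain k' where k': "k' \<in> fix_grp" "k' \<cdot> k = e" using e(4)[OF k(1)] by blast
      then have "(b \<cdot> k' \<cdot> a) \<cdot> u = f" using hom[OF k'(1) k(1)] k(2) bea by simp
      then show ?thesis using k'(1) by (auto simp: K'_def)
    qed
  qed
  \<comment> \<open>The element \<open>t = a h b\<close> divides \<open>e\<close>, so it lies in the
    closure of the language, and \<open>e\<close> is a two-sided unit for it; by recognition it is
    in \<open>fix_grp\<close>. Maximality of \<open>H\<close> then turns
    \<open>H \<subseteq> K'\<close> into equality.\<close>
  have "h \<in> K'" if h: "h \<in> H" for h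
  proof -
    have hO: "h \<in> FS" using h HO by blast
    obtain h' where h': "h' \<in> H" "h \<cdot> h' = f" using f(4)[OF h] by blast
    have h'O: "h' \<in> FS" using h' HO by blast
    define t where "t = a \<cdot> (h \<cdot> b)"
    have tO: "t \<in> FS" using aO bO hO by (simp add: t_def)
    have "t \<cdot> (a \<cdot> (h' \<cdot> b)) = a \<cdot> (h \<cdot> (f \<cdot> (h' \<cdot> b)))"
      using aO bO hO h'O by (simp add: t_def as' bat)
    also have "f \<cdot> (h' \<cdot> b) = h' \<cdot> b" using as'[OF fO h'O bO] f(2)[OF h'(1)] by simp
    also have "h \<cdot> (h' \<cdot> b) = b" using as'[OF hO h'O bO] h'(2) fb by simp
    finally have "t \<cdot> (a \<cdot> (h' \<cdot> b)) = e" using ab by simp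
    then have "t \<in> lang_cl"
      using lang_cl_factor(1)[OF tO, of "a \<cdot> (h' \<cdot> b)"] fix_grp_lang_cl[OF e(1)] aO bO h'O by simp
    moreover have "e \<cdot> t = t" "t \<cdot> e = t"
      using as'[OF eO aO, of "h \<cdot> b"] as'[OF aO _ eO, of "h \<cdot> b"] as'[OF hO bO eO] ea be hO bO by (simp_all add: t_def)
    ultimately have "t \<in> fix_grp" using fix_grp_recognize[OF e(1)] by blast
    moreover have "b \<cdot> t \<cdot> a = h"
    proof -
      have "b \<cdot> t \<cdot> a = f \<cdot> (h \<cdot> f)" using aO bO hO fO by (simp add: t_def as' bat ba)
      then show ?thesis using f(2,3)[OF h] by simp
    qed
    ultimately show ?thesis by (auto simp: K'_def)
  qed
  then have "K' = H" using max K'O K'g by blast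
  then show ?thesis using that[OF aO bO _ hom retr] by (simp add: K'_def)
qed

section \<open>The presentation\<close>

abbreviation fg :: "xyz pro monoid" where
  "fg \<equiv> free_pg"

abbreviation pgr :: "xyz pseudovariety" where
  "pgr \<equiv> all_groups"

abbreviation mG :: "xyz pro \<Rightarrow> xyz pro \<Rightarrow> xyz pro" (infixl "\<star>" 70) where
  "x \<star> y \<equiv> Omega_mult pgr x y"

abbreviation iG :: "xyz pro \<Rightarrow> xyz pro" where
  "iG x \<equiv> inv\<^bsub>fg\<^esub> x"

interpretation fg: group fg
  rewrites "carrier fg = FG" and "mult fg = Omega_mult pgr"
  by (simp_all add: group_free_pg)

lemma fg_cancel [simp]:
  assumes "x \<in> FG" "y \<in> FG"
  shows "x \<star> (iG x \<star> y) = y" and "iG x \<star> (x \<star> y) = y"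
  using assms fg.m_assoc[of x "iG x" y] fg.m_assoc[of "iG x" x y] by (simp_all add: fg.r_inv fg.l_inv)

abbreviation gx :: "xyz pro" where "gx \<equiv> pg_gen Gx"
abbreviation gy :: "xyz pro" where "gy \<equiv> pg_gen Gy"
abbreviation gz :: "xyz pro" where "gz \<equiv> pg_gen Gz"

text \<open>The letters of \<open>a\<^sup>i b\<^sup>j\<close> are weighted so that the return words \<open>ab\<close>, \<open>aab\<close>, \<open>abb\<close> and \<open>aabb\<close> of \<open>b.a\<close>
  have weights \<open>x\<close>, \<open>y\<close>, \<open>z\<close> and \<open>y x\<^sup>-\<^sup>1 z\<close>; the weight of a letter depends on its predecessor.\<close>

fun wt :: "ab \<Rightarrow> ab \<Rightarrow> xyz pro" where
  "wt Lb La = \<one>\<^bsub>fg\<^esub>"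
| "wt La La = gy \<star> iG gx"
| "wt La Lb = gx"
| "wt Lb Lb = iG gx \<star> gz"

fun weight :: "ab \<Rightarrow> ab list \<Rightarrow> xyz pro" where
  "weight c [] = \<one>\<^bsub>fg\<^esub>"
| "weight c (d # w) = wt c d \<star> weight d w"

lemma wt_in [simp]: "wt c d \<in> FG"
  by (cases c; cases d) simp_all

lemma weight_in [simp]: "weight c w \<in> FG"
  by (induction w arbitrary: c) simp_all

lemma weight_append: "weight c (u @ v) = weight c u \<star> weight (last (c # u)) v"
  by (induction u arbitrary: c) (auto simp: fg.m_assoc)

lemma weight_returns_append:
  "u \<in> returns \<Longrightarrow> weight Lb (u @ v) = weight Lb u \<star> weight Lb v"
  using returns_hd_last[of u] returns_ne[of u] by (simp add: weight_append)

lemma weight_return_words: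
  "weight Lb [La, Lb] = gx" "weight Lb [La, La, Lb] = gy" "weight Lb [La, Lb, Lb] = gz"
  "weight Lb [La, La, Lb, Lb] = gy \<star> iG gx \<star> gz"
  by (simp_all add: fg.m_assoc)

text \<open>The weight of a second word depends on the last letter of the first. Recording this
  letter and the weights after every possible predecessor makes the invariant compatible with
  concatenation.\<close>

definition weight_cong :: "(xyz list \<times> xyz list) set \<Rightarrow> (ab list \<times> ab list) set" where
  "weight_cong s = ker_cong (\<lambda>w. (last w, \<lambda>c. weight c w s))"

lemma weight_cong:
  assumes s: "s \<in> congs pgr"
  shows "weight_cong s \<in> congs psg"
  unfolding congs_all_semigroups weight_cong_def
proof
  let ?g = "\<lambda>w. (last w, \<lambda>c. weight c w s)"
  show "word_cong (ker_cong ?g)"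
  proof (rule word_cong_ker_cong)
    fix u v u' v' :: "ab list"
    assume ne: "u \<noteq> []" "v \<noteq> []" "u' \<noteq> []" "v' \<noteq> []"
      and eq: "(last u, \<lambda>c. weight c u s) = (last v, \<lambda>c. weight c v s)"
      "(last u', \<lambda>c. weight c u' s) = (last v', \<lambda>c. weight c v' s)"
    then have "\<And>c. weight c u s = weight c v s" "\<And>c. weight c u' s = weight c v' s" "last u = last v"
      by (simp_all add: fun_eq_iff)
    then have "weight c (u @ u') s = weight c (v @ v') s" for c
      using ne by (simp add: weight_append Omega_mult_apply s)
    with ne eq show "(last (u @ u'), \<lambda>c. weight c (u @ u') s) = (last (v @ v'), \<lambda>c. weight c (v @ v') s)"
      by auto
  qed
  have "?g ` free_semigroup \<subseteq> UNIV \<times> (UNIV \<rightarrow>\<^sub>E quots s)"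
    using Omega_apply(1)[OF weight_in s] by auto
  moreover have "finite ((UNIV :: ab set) \<times> ((UNIV :: ab set) \<rightarrow>\<^sub>E quots s))"
    by (intro finite_cartesian_product finite_PiE) (auto simp: congsD(2)[OF s])
  ultimately show "finite (free_semigroup // ker_cong ?g)"
    by (intro finite_ker_cong) (rule finite_subset)
qed

text \<open>Every word of \<open>returns\<close> ends in b, so the next factor is again weighed
  after b; this makes \<open>weight Lb\<close> multiplicative there.\<close>

lemma weight_extension:
  obtains Q where "unif psg pgr returns_cl Q" "\<And>w. w \<in> returns \<Longrightarrow> Q (pw w) = weight Lb w"
    "\<And>f g. f \<in> returns_cl \<Longrightarrow> g \<in> returns_cl \<Longrightarrow> Q (f \<cdot> g) = Q f \<star> Q g"
proof -
  have "\<exists>F. unif psg pgr returns_cl F \<and> (\<forall>w\<in>returns. F (pw w) = weight Lb w)"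
  proof (rule unif_extension[OF psg_dir])
    show "returns \<subseteq> free_semigroup" using returns_ne by auto
    fix s assume s: "s \<in> congs pgr"
    show "\<exists>r\<in>congs psg. \<forall>u\<in>returns. \<forall>v\<in>returns. (u, v) \<in> r \<longrightarrow> weight Lb u s = weight Lb v s"
      using weight_cong[OF s] by (intro bexI[of _ "weight_cong s"]) (auto simp: weight_cong_def ker_cong_def dest: fun_cong)
  qed simp
  then obtain Q where Q: "unif psg pgr returns_cl Q" "\<And>w. w \<in> returns \<Longrightarrow> Q (pw w) = weight Lb w" by blast
  have "Q (f \<cdot> g) = Q f \<star> Q g" if "f \<in> returns_cl" "g \<in> returns_cl" for f g
  proof (rule unif_mult[OF psg_dir Q(1) pw_returns_sub pw_returns_mult _ that])
    fix f g assume "f \<in> pw ` returns" "g \<in> pw ` returns"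
    then obtain u v where uv: "u \<in> returns" "v \<in> returns" "f = pw u" "g = pw v" by auto
    then have "f \<cdot> g = pw (u @ v)" using of_word_append[of u v psg] returns_ne by simp
    then show "Q (f \<cdot> g) = Q f \<star> Q g"
      using Q(2) uv returns_append by (simp add: weight_returns_append)
  qed
  with Q that show ?thesis by blast
qed

text \<open>On single letters, weights turn \<open>phi\<close> into \<open>Psi\<close> only up to a
  coboundary \<open>k\<close>. Since \<open>phi\<close> preserves last letters, the intermediate
  terms cancel in a word, and on \<open>returns\<close> both remaining terms sit at the letter
  b.\<close>

lemma weight_phi:
  assumes Psi: "pro_endo pgr Psi"
    and vals: "Psi gx = gz \<star> gx \<star> gy" "Psi gy = gz \<star> gy \<star> iG gx \<star> gz \<star> gx \<star> gy"
      "Psi gz = gz \<star> gx \<star> gy \<star> iG gx \<star> gz \<star> gy"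
    and w: "w \<in> returns"
  shows "weight Lb (phi w) = Psi (weight Lb w)"
proof -
  \<comment> \<open>\<open>k La\<close> is the weight of \<open>phi [La]\<close> read after b, and
    \<open>k Lb\<close> is trivial so that the boundary terms vanish on
    \<open>returns\<close>.\<close>
  define k where "k = (\<lambda>c. case c of La \<Rightarrow> gz | Lb \<Rightarrow> \<one>\<^bsub>fg\<^esub>)"
  have k [simp]: "k c \<in> FG" for c by (cases c) (simp_all add: k_def)
  interpret Psi: group_hom fg fg Psi
    using Psi by unfold_locales (auto simp: hom_def pro_endo_def unif_def)
  have inv: "Psi (iG x) = iG (Psi x)" if "x \<in> FG" for x using Psi.hom_inv that by simp
  have mult: "Psi (x \<star> y) = Psi x \<star> Psi y" if "x \<in> FG" "y \<in> FG" for x y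
    using pro_endoD(3)[OF Psi that] .
  have one: "Psi \<one>\<^bsub>fg\<^esub> = \<one>\<^bsub>fg\<^esub>" by (rule Psi.hom_one)
  have P [simp]: "Psi x \<in> FG" if "x \<in> FG" for x using pro_endoD(2)[OF Psi that] .
  have phi_letter: "phi [La] = [La, Lb, Lb, La]" "phi [Lb] = [Lb, La, La, Lb]"
    by (simp_all add: phi_def eval_nat_numeral)
  have iP: "iG (x \<star> y) = iG y \<star> iG x" if "x \<in> FG" "y \<in> FG" for x y
    using fg.inv_mult_group that by simp
  have letter: "weight c (phi [d]) = iG (k c) \<star> Psi (wt c d) \<star> k d" for c d
    by (cases c; cases d)
       (simp_all add: phi_letter k_def vals mult inv one iP fg.m_assoc fg.r_inv fg.l_inv)
  have last_phi: "last (phi [d]) = d" for d by (cases d) (simp_all add: phi_letter)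
  have "weight c (phi w) = iG (k c) \<star> Psi (weight c w) \<star> k (last (c # w))" for c w
  proof (induction w arbitrary: c)
    case Nil
    have "phi [] = []" by (simp add: phi_def)
    then show ?case by (simp add: one fg.l_inv)
  next
    case (Cons d w)
    have "phi (d # w) = phi [d] @ phi w" using phi_append[of "[d]" w] by simp
    then have "weight c (phi (d # w)) = weight c (phi [d]) \<star> weight d (phi w)"
      using last_phi[of d] phi_ne[of "[d]"] by (simp add: weight_append)
    also have "\<dots> = iG (k c) \<star> Psi (weight c (d # w)) \<star> k (last (d # w))"
      unfolding letter Cons.IH by (simp add: mult fg.m_assoc)
    finally show ?case by simp
  qed
  from this[of Lb w] show ?thesis
    using returns_hd_last[OF w] returns_ne[OF w] by (simp add: k_def)
qed

lemma fix_grp_presentation: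
  assumes Psi: "pro_endo pgr Psi"
    and vals: "Psi gx = gz \<star> gx \<star> gy" "Psi gy = gz \<star> gy \<star> iG gx \<star> gz \<star> gx \<star> gy"
      "Psi gz = gz \<star> gx \<star> gy \<star> iG gx \<star> gz \<star> gy"
  obtains \<kappa> where "unif pgr psg FG \<kappa>" "\<kappa> ` FG = fix_grp"
    "\<And>f g. f \<in> FG \<Longrightarrow> g \<in> FG \<Longrightarrow> \<kappa> (f \<star> g) = \<kappa> f \<cdot> \<kappa> g"
    "\<And>u. u \<in> FG \<Longrightarrow> \<kappa> (om pgr Psi u) = \<kappa> u"
    "\<And>u v. u \<in> FG \<Longrightarrow> v \<in> FG \<Longrightarrow> \<kappa> u = \<kappa> v \<Longrightarrow> om pgr Psi u = om pgr Psi v"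
proof -
  note pgr_dir = directed_all_groups[where ?'a = xyz]
  let ?P = "om pgr Psi"
  have P: "pro_endo pgr ?P" by (rule pro_endo_om[OF pgr_dir Psi])
  obtain Q where Q: "unif psg pgr returns_cl Q" "\<And>w. w \<in> returns \<Longrightarrow> Q (pw w) = weight Lb w"
    "\<And>f g. f \<in> returns_cl \<Longrightarrow> g \<in> returns_cl \<Longrightarrow> Q (f \<cdot> g) = Q f \<star> Q g"
    by (rule weight_extension) (rule that; assumption)
  define \<theta> where "\<theta> = (\<lambda>c. Phi (pw (case c of Gx \<Rightarrow> [La, Lb] | Gy \<Rightarrow> [La, La, Lb] | Gz \<Rightarrow> [La, Lb, Lb])))"
  have \<theta>: "\<theta> c \<in> fix_grp" for c
    unfolding \<theta>_def by (cases c) (simp_all add: Phi_in_fix_grp pw_returns returns_base)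
  obtain \<kappa> where \<kappa>: "unif pgr psg FG \<kappa>" "\<And>f. f \<in> FG \<Longrightarrow> \<kappa> f \<in> cl psg fix_grp"
    "\<And>f g. f \<in> FG \<Longrightarrow> g \<in> FG \<Longrightarrow> \<kappa> (f \<star> g) = \<kappa> f \<cdot> \<kappa> g" "\<And>c. \<kappa> (pg_gen c) = \<theta> c"
    by (rule free_pg_hom_extension[OF fix_grp_Omega is_group_fix_grp \<theta>]) (rule that; assumption)
  have \<kappa>K: "\<kappa> f \<in> fix_grp" if "f \<in> FG" for f using \<kappa>(2)[OF that] unfolding cl_fix_grp .
  have KR: "k \<in> returns_cl" and PhiK: "Phi k = k" if "k \<in> fix_grp" for k
    using that by (auto simp: fix_grp_def)
  have KO: "k \<in> FS" if "k \<in> fix_grp" for k using that fix_grp_Omega by blast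
  have PhiO: "Phi (pw w) \<in> FS" if "w \<noteq> []" for w using pro_endoD(2)[OF Phi_endo] that by simp
  have Phi_app: "Phi (pw (u @ v)) = Phi (pw u) \<cdot> Phi (pw v)" if "u \<noteq> []" "v \<noteq> []" for u v
    using of_word_append[OF that, of psg] pro_endoD(3)[OF Phi_endo, of "pw u" "pw v"] that by simp
  \<comment> \<open>\<open>?A\<close> and \<open>?B\<close> need not belong to the group. The images
    of y and z are \<open>?A \<cdot> ?X\<close> and \<open>?X \<cdot> ?B\<close>, so the inverse of
    \<open>?X\<close> stands between two copies of \<open>?X\<close> and is cancelled inside the
    group.\<close>
  have aabb: "\<kappa> (gy \<star> iG gx \<star> gz) = Phi (pw [La, La, Lb, Lb])"
  proof -
    let ?A = "Phi (pw [La])" and ?B = "Phi (pw [Lb])" and ?X = "Phi (pw [La, Lb])" and ?I = "\<kappa> (iG gx)"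
    have O: "?A \<in> FS" "?B \<in> FS" "?X \<in> FS" "?I \<in> FS"
      using PhiO KO[OF \<kappa>K] by simp_all
    have g: "\<kappa> gx = ?X" "\<kappa> gy = ?A \<cdot> ?X" "\<kappa> gz = ?X \<cdot> ?B"
      using \<kappa>(4) Phi_app[of "[La]" "[La, Lb]"] Phi_app[of "[La, Lb]" "[Lb]"] by (simp_all add: \<theta>_def)
    have "?X \<cdot> ?I \<cdot> ?X = \<kappa> (gx \<star> iG gx \<star> gx)"
      by (simp only: \<kappa>(3) g(1) pg_gen_in fg.inv_closed fg.m_closed)
    then have XIX: "?X \<cdot> ?I \<cdot> ?X = ?X" using g(1) by (simp add: fg.r_inv)
    have "\<kappa> (gy \<star> iG gx \<star> gz) = ?A \<cdot> ?X \<cdot> ?I \<cdot> (?X \<cdot> ?B)" using \<kappa>(3) g by simp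
    also have "\<dots> = ?A \<cdot> (?X \<cdot> ?I \<cdot> ?X) \<cdot> ?B" using O by (simp add: Omega_mult_assoc)
    also have "\<dots> = Phi (pw [La, La, Lb, Lb])"
      unfolding XIX using Phi_app[of "[La]" "[La, Lb]"] Phi_app[of "[La, La, Lb]" "[Lb]"] by simp
    finally show ?thesis .
  qed
  have base: "\<kappa> (weight Lb u) = Phi (pw u)" if "u \<in> return_words" for u
    using that aabb \<kappa>(4) unfolding return_words_def
    by (elim insertE emptyE) (simp_all only: weight_return_words \<theta>_def xyz.case)
  have \<kappa>q: "\<kappa> (weight Lb w) = Phi (pw w)" if "w \<in> returns" for w
    using that
  proof induction
    case (step u v)
    then have "u \<in> returns" by (simp add: returns.single)
    with step show ?case
      using Phi_app[of u v] returns_ne base[OF step(1)] \<kappa>(3) by (simp add: weight_returns_append)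
  qed (rule base)
  have \<kappa>Q: "\<kappa> (Q f) = Phi f" if "f \<in> returns_cl" for f
  proof (rule unif_eqI[OF psg_dir _ unif_returns_cl[OF Phi_endo] pw_returns_sub _ that])
    show "unif psg psg returns_cl (\<lambda>f. \<kappa> (Q f))"
      by (rule unif_comp[OF Q(1) \<kappa>(1) unifD(2)[OF Q(1)]])
  qed (auto simp: Q(2) \<kappa>q)
  \<comment> \<open>Both sides are endomorphisms of the free profinite group, so generators suffice.
    There \<open>\<kappa>\<close> gives \<open>Phi\<close> of a return word, and \<open>Q\<close>
    carries \<open>phi_hat\<close> to \<open>Psi\<close>, hence the idempotent power of the former
    to that of the latter.\<close>
  have QK: "Q (\<kappa> u) = ?P u" if u: "u \<in> FG" for u
  proof -
    have endo: "pro_endo pgr (\<lambda>u. Q (\<kappa> u))"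
      unfolding pro_endo_def
      using unif_comp[OF \<kappa>(1) Q(1) KR[OF \<kappa>K]] \<kappa>(3) Q(3) KR[OF \<kappa>K] by simp
    have gen: "Q (\<kappa> (pg_gen c)) = ?P (pg_gen c)" for c
    proof -
      define w where "w = (case c of Gx \<Rightarrow> [La, Lb] | Gy \<Rightarrow> [La, La, Lb] | Gz \<Rightarrow> [La, Lb, Lb])"
      have w: "w \<in> returns" "\<theta> c = Phi (pw w)" "weight Lb w = pg_gen c"
        unfolding w_def \<theta>_def using returns_base weight_return_words
        by (cases c; simp only: xyz.case)+
      have "Q (om psg phi_hat (pw w)) = ?P (Q (pw w))"
      proof (rule om_intertwine[OF psg_dir pgr_dir pro_endo_phi_hat Psi Q(1)])
        show "phi_hat f \<in> returns_cl" if "f \<in> returns_cl" for f using phi_hat_returns_cl[OF that, of 1] by simp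
        show "om psg phi_hat f \<in> returns_cl" if "f \<in> returns_cl" for f
          using Phi_returns_cl[OF that] by (simp add: Phi_def)
        show "pw w \<in> returns_cl" by (rule pw_returns[OF w(1)])
        show "Q (phi_hat f) = Psi (Q f)" if "f \<in> returns_cl" for f
        proof (rule unif_eqI[OF psg_dir _ _ pw_returns_sub _ that])
          show "unif psg pgr returns_cl (\<lambda>f. Q (phi_hat f))"
            by (rule unif_comp[OF unif_returns_cl[OF pro_endo_phi_hat] Q(1)])
               (use phi_hat_returns_cl[of _ 1] in simp)
          show "unif psg pgr returns_cl (\<lambda>f. Psi (Q f))"
            by (rule unif_comp[OF Q(1) pro_endoD(1)[OF Psi] unifD(2)[OF Q(1)]])
          fix f assume "f \<in> pw ` returns"
          then obtain v where v: "v \<in> returns" "f = pw v" by blast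
          then show "Q (phi_hat f) = Psi (Q f)"
            using weight_phi[OF Psi vals v(1)] phi_returns[OF v(1)] returns_ne[OF v(1)]
            by (simp add: phi_hat_word Q(2))
        qed
      qed
      then show ?thesis using \<kappa>(4)[of c] w Q(2)[OF w(1)] by (simp add: Phi_def)
    qed
    show ?thesis
    proof (rule Omega_eqI)
      show "Q (\<kappa> u) \<in> FG" "?P u \<in> FG" using pro_endoD(2)[OF endo u] pro_endoD(2)[OF P u] .
      show "Q (\<kappa> u) s = ?P u s" if "s \<in> congs pgr" for s
        by (rule pro_endo_agree_gens[OF pgr_dir endo P that _ u]) (use gen in \<open>simp add: pg_gen_def\<close>)
    qed
  qed
  show ?thesis
  proof (rule that[OF \<kappa>(1)])
    show "\<kappa> ` FG = fix_grp"
    proof (intro equalityI subsetI)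
      fix k assume k: "k \<in> fix_grp"
      then have "k = \<kappa> (Q k)" using \<kappa>Q[OF KR[OF k]] PhiK[OF k] by simp
      then show "k \<in> \<kappa> ` FG" using unifD(2)[OF Q(1) KR[OF k]] by blast
    qed (use \<kappa>K in blast)
    show "\<kappa> (f \<star> g) = \<kappa> f \<cdot> \<kappa> g" if "f \<in> FG" "g \<in> FG" for f g using \<kappa>(3)[OF that] .
    show "\<kappa> (?P u) = \<kappa> u" if u: "u \<in> FG" for u
      using \<kappa>Q[OF KR[OF \<kappa>K[OF u]]] PhiK[OF \<kappa>K[OF u]] QK[OF u] by simp
    show "?P u = ?P v" if "u \<in> FG" "v \<in> FG" "\<kappa> u = \<kappa> v" for u v
      using QK[OF that(1)] QK[OF that(2)] that(3) by simp
  qed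
qed

lemma range_xyz: "range F = {F Gx, F Gy, F Gz}"
proof -
  have U: "UNIV = {Gx, Gy, Gz}" using xyz.exhaust by blast
  show ?thesis unfolding U by simp
qed

theorem theorem7p4:
  fixes x y z :: "xyz pro" and Psi Psi_omega :: "xyz pro \<Rightarrow> xyz pro"
  assumes "x = pg_gen Gx" and "y = pg_gen Gy" and "z = pg_gen Gz"
    and "Psi = (THE f. f \<in> cont_endos free_pg free_pg_top
           \<and> f x = z \<otimes>\<^bsub>free_pg\<^esub> x \<otimes>\<^bsub>free_pg\<^esub> y
           \<and> f y = z \<otimes>\<^bsub>free_pg\<^esub> y \<otimes>\<^bsub>free_pg\<^esub> inv\<^bsub>free_pg\<^esub> x \<otimes>\<^bsub>free_pg\<^esub> z
                    \<otimes>\<^bsub>free_pg\<^esub> x \<otimes>\<^bsub>free_pg\<^esub> y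
           \<and> f z = z \<otimes>\<^bsub>free_pg\<^esub> x \<otimes>\<^bsub>free_pg\<^esub> y \<otimes>\<^bsub>free_pg\<^esub> inv\<^bsub>free_pg\<^esub> x
                    \<otimes>\<^bsub>free_pg\<^esub> z \<otimes>\<^bsub>free_pg\<^esub> y)"
    and "Psi_omega = omega_power free_pg free_pg_top Psi"
  shows "schuetzenberger_groups tau \<noteq> {}
    \<and> (\<forall>H \<in> schuetzenberger_groups tau.
         admits_presentation (as_group H free_ps_mult) (subtopology free_ps_top H)
           {(Psi_omega x, x), (Psi_omega y, y), (Psi_omega z, z)})"
proof -
  note xyz = assms(1-3)
  note pgr_dir = directed_all_groups[where ?'a = xyz]
  define \<theta> where "\<theta> = (\<lambda>c. case c of Gx \<Rightarrow> z \<star> x \<star> y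
    | Gy \<Rightarrow> z \<star> y \<star> iG x \<star> z \<star> x \<star> y | Gz \<Rightarrow> z \<star> x \<star> y \<star> iG x \<star> z \<star> y)"
  have \<theta>: "\<theta> c \<in> FG" for c
    unfolding \<theta>_def xyz by (cases c) simp_all
  obtain F where F: "unif pgr pgr FG F" "\<And>f. f \<in> FG \<Longrightarrow> F f \<in> cl pgr FG"
    "\<And>f g. f \<in> FG \<Longrightarrow> g \<in> FG \<Longrightarrow> F (f \<star> g) = F f \<star> F g" "\<And>c. F (pg_gen c) = \<theta> c"
    by (rule free_pg_hom_extension[OF order_refl is_group_free_pg \<theta>]) (rule that; assumption)
  have endoF: "pro_endo pgr F" using F(1,3) by (simp add: pro_endo_def)
  \<comment> \<open>Elements of \<open>cont_endos\<close> are extensional on the carrier, so only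
    the restricted map can be the one selected by \<open>THE\<close>.\<close>
  define G where "G = restrict F FG"
  have endoG: "pro_endo pgr G" unfolding G_def by (rule pro_endo_restrict[OF endoF])
  have Gc: "G \<in> cont_endos free_pg free_pg_top" unfolding G_def by (rule pro_endo_cont_endos[OF endoF])
  have Gv: "G x = z \<star> x \<star> y" "G y = z \<star> y \<star> iG x \<star> z \<star> x \<star> y" "G z = z \<star> x \<star> y \<star> iG x \<star> z \<star> y"
    using F(4)[of Gx] F(4)[of Gy] F(4)[of Gz] unfolding G_def xyz by (simp_all add: \<theta>_def xyz)
  have PsiG: "Psi = G"
    unfolding assms(4) mult_free_pg
  proof (rule the_equality)
    fix f
    assume f: "f \<in> cont_endos free_pg free_pg_top \<and> f x = z \<star> x \<star> y
      \<and> f y = z \<star> y \<star> iG x \<star> z \<star> x \<star> y \<and> f z = z \<star> x \<star> y \<star> iG x \<star> z \<star> y"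
    show "f = G"
    proof (rule cont_endos_eqI[OF _ Gc])
      show "f (pg_gen c) = G (pg_gen c)" for c
        using f Gv unfolding xyz by (cases c) simp_all
    qed (use f in blast)
  qed (use Gc Gv in simp)
  let ?P = "om pgr G"
  have Psi_omega: "Psi_omega (pg_gen c) = ?P (pg_gen c)" for c
    unfolding assms(5) PsiG omega_power_eq_om[OF endoG] by simp
  have R: "{(Psi_omega x, x), (Psi_omega y, y), (Psi_omega z, z)} = range (\<lambda>c. (?P (pg_gen c), pg_gen c))"
    unfolding range_xyz xyz Psi_omega by (rule refl)
  have endoP: "pro_endo pgr ?P" by (rule pro_endo_om[OF pgr_dir endoG])
  obtain \<kappa> where \<kappa>: "unif pgr psg FG \<kappa>" "\<kappa> ` FG = fix_grp"
    "\<And>f g. f \<in> FG \<Longrightarrow> g \<in> FG \<Longrightarrow> \<kappa> (f \<star> g) = \<kappa> f \<cdot> \<kappa> g"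
    "\<And>u. u \<in> FG \<Longrightarrow> \<kappa> (?P u) = \<kappa> u"
    "\<And>u v. u \<in> FG \<Longrightarrow> v \<in> FG \<Longrightarrow> \<kappa> u = \<kappa> v \<Longrightarrow> ?P u = ?P v"
    by (rule fix_grp_presentation[OF endoG Gv[unfolded xyz]]) (rule that; assumption)
  have \<kappa>K: "\<kappa> u \<in> fix_grp" if "u \<in> FG" for u using \<kappa>(2) that by blast
  have "admits_presentation (as_group H free_ps_mult) (subtopology free_ps_top H)
      (range (\<lambda>c. (?P (pg_gen c), pg_gen c)))"
    if H: "H \<in> schuetzenberger_groups tau" for H
  proof -
    obtain a b where ab: "a \<in> FS" "b \<in> FS" "(\<lambda>k. b \<cdot> k \<cdot> a) ` fix_grp = H"
      "\<And>k k'. k \<in> fix_grp \<Longrightarrow> k' \<in> fix_grp \<Longrightarrow> (b \<cdot> k \<cdot> a) \<cdot> (b \<cdot> k' \<cdot> a) = b \<cdot> (k \<cdot> k') \<cdot> a"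
      "\<And>k. k \<in> fix_grp \<Longrightarrow> a \<cdot> (b \<cdot> k \<cdot> a) \<cdot> b = k"
      by (rule schuetzenberger_group_conjugate[OF H]) (rule that; assumption)
    \<comment> \<open>Conjugation carries \<open>\<kappa>\<close> to a surjection onto
      \<open>H\<close>; being injective on \<open>fix_grp\<close>, it leaves the kernel
      unchanged.\<close>
    define \<eta> where "\<eta> = (\<lambda>u. b \<cdot> \<kappa> u \<cdot> a)"
    have "unif psg psg FS (\<lambda>k. b \<cdot> k \<cdot> a)"
      by (rule unifI_same[OF order_refl]) (use ab(1,2) in \<open>simp_all add: Omega_mult_apply\<close>)
    then have \<eta>: "unif pgr psg FG \<eta>"
      unfolding \<eta>_def by (rule unif_comp[OF \<kappa>(1) _ unifD(2)[OF \<kappa>(1)]])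
    have \<eta>_hom: "\<eta> (f \<star> g) = \<eta> f \<cdot> \<eta> g" if "f \<in> FG" "g \<in> FG" for f g
      using ab(4)[OF \<kappa>K \<kappa>K] \<kappa>(3) that by (simp add: \<eta>_def)
    have \<eta>_ran: "\<eta> ` FG = H"
      unfolding ab(3)[symmetric] \<kappa>(2)[symmetric] \<eta>_def image_image by (rule refl)
    have \<eta>_inj: "\<kappa> u = \<kappa> v" if "u \<in> FG" "v \<in> FG" "\<eta> u = \<eta> v" for u v
    proof -
      have "\<kappa> u = a \<cdot> \<eta> u \<cdot> b" "\<kappa> v = a \<cdot> \<eta> v \<cdot> b"
        unfolding \<eta>_def using ab(5)[OF \<kappa>K] that(1,2) by (auto simp only:)
      then show ?thesis using that(3) by (simp only:)
    qed
    have FP: "\<eta> (?P u) = \<eta> u" if "u \<in> FG" for u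
      unfolding \<eta>_def \<kappa>(4)[OF that] by (rule refl)
    have PF: "?P u = ?P v" if "u \<in> FG" "v \<in> FG" "\<eta> u = \<eta> v" for u v
      by (rule \<kappa>(5)[OF that(1,2) \<eta>_inj[OF that]])
    have "closed_congruence_generated free_pg free_pg_top (range (\<lambda>c. (?P (pg_gen c), pg_gen c)))
        = {(u, v). u \<in> FG \<and> v \<in> FG \<and> \<eta> u = \<eta> v}"
      by (rule closed_congruence_generated_retract[OF psg_dir \<eta> _ endoP])
         (rule \<eta>_hom FP PF; assumption)+
    then show ?thesis
      by (rule admits_presentationI[OF psg_dir \<eta> _ \<eta>_ran, rotated]) (rule \<eta>_hom)
  qed
  then show ?thesis
    unfolding R using fix_grp_maximal by blast
qed

end
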